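(* Let $\mathfrak{m}(t)$, $0\le t\le 1$, be the Brownian meander of length $1$. Then, as $\varepsilon\to0+$, $$ \mathsf{P}\{\| \mathfrak{m}\| \leq \varepsilon \} \sim 4 \sqrt{\frac{2 }{3\pi} }\, \exp\left(- \frac98 \varepsilon^{-2}\right). $$
   Context: $\|X\|=\left(\int_0^1X^2(t)\,dt\right)^{1/2}$. The Brownian meander $\mathfrak{m}$ is, informally, a Brownian motion started at $0$ and conditioned to stay positive up to time $1$; rigorously, if $W$ is a standard Brownian motion and $g=\sup\{t\le1:W(t)=0\}$, then $\mathfrak{m}(t)=|W(g+t(1-g))|/\sqrt{1-g}$, $0\le t\le1$. The notation $f(\varepsilon)\sim g(\varepsilon)$ means $f(\varepsilon)/g(\varepsilon)\to1$. *)

theory Defs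
  imports "HOL-Probability.Probability" "HOL-Library.Landau_Symbols"
begin

(* Paths are continuous, and start at 0, for every outcome and not only almost surely.
   The time parameter is real; nothing is required at negative times. *)
locale std_brownian_motion = prob_space M for M :: "'a measure" +
  fixes W :: "real \<Rightarrow> 'a \<Rightarrow> real"
  assumes measurable_at: "\<And>t. 0 \<le> t \<Longrightarrow> random_variable borel (W t)"
    and start: "\<And>\<omega>. \<omega> \<in> space M \<Longrightarrow> W 0 \<omega> = 0"
    and continuous_paths: "\<And>\<omega>. \<omega> \<in> space M \<Longrightarrow> continuous_on {0..} (\<lambda>t. W t \<omega>)"
    and normal_increments: "\<And>s t. 0 \<le> s \<Longrightarrow> s < t \<Longrightarrow>
      distributed M lborel (\<lambda>\<omega>. W t \<omega> - W s \<omega>) (normal_density 0 (sqrt (t - s)))"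
    and independent_increments: "\<And>(\<tau> :: nat \<Rightarrow> real) n. 0 \<le> \<tau> 0 \<Longrightarrow> mono_on {..n} \<tau> \<Longrightarrow>
      indep_vars (\<lambda>_. borel) (\<lambda>i \<omega>. W (\<tau> (Suc i)) \<omega> - W (\<tau> i) \<omega>) {..<n}"

definition last_zero :: "(real \<Rightarrow> 'a \<Rightarrow> real) \<Rightarrow> 'a \<Rightarrow> real" where
  "last_zero W \<omega> = Sup {t. 0 \<le> t \<and> t \<le> 1 \<and> W t \<omega> = 0}"

(* On the null event last_zero W \<omega> = 1 division by zero makes the path identically 0. *)
definition meander :: "(real \<Rightarrow> 'a \<Rightarrow> real) \<Rightarrow> real \<Rightarrow> 'a \<Rightarrow> real" where
  "meander W t \<omega> =
     \<bar>W (last_zero W \<omega> + t * (1 - last_zero W \<omega>)) \<omega>\<bar> / sqrt (1 - last_zero W \<omega>)"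

definition L2_norm01 :: "(real \<Rightarrow> real) \<Rightarrow> real" where
  "L2_norm01 X = sqrt (LINT t:{0..1}|lborel. (X t)\<^sup>2)"

unbundle asymp_equiv_syntax

end

theory Submission
  imports Defs "HOL-Real_Asymp.Real_Asymp"
begin

text \<open>
  Let \<open>V\<close> be the squared norm of the meander, \<open>g\<close> the last zero before time 1 and \<open>h\<^sub>b\<close> the density of the first
  hitting time of level \<open>b\<close>, whose Laplace transform at \<open>c\<^sup>2/2\<close> is \<open>exp (- b c)\<close>.

  The Laplace transform of \<open>V\<close> at \<open>c\<^sup>2/2\<close> is \<open>sqrt (c / sinh c) / cosh c\<close>. Reflecting the path after its first
  zero in \<open>[s,1]\<close> cancels the paths with such a zero in the expectation of \<open>sgn W(s) sgn W(1) \<Psi>\<close>, for an even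
  functional \<open>\<Psi>\<close> of the path after \<open>t \<ge> s\<close>; so this expectation is that of \<open>\<Psi>\<close> on the event \<open>g < s\<close>. For
  \<open>\<Psi> = exp (- \<alpha>\<^sup>2/2 \<integral>W\<^sup>2)\<close> it is a Gaussian integral over two opposite quadrants, hence an arctangent. Splitting
  the range of \<open>g\<close> into small intervals and rescaling turns the differences of these arctangents into a Riemann
  sum, in which the arcsine density of \<open>g\<close> appears as a factor; \<open>c \<rightarrow> 0\<close> gives \<open>0 < g < 1\<close> almost surely.

  Dividing by \<open>c\<^sup>2/2\<close> gives the Laplace transform of the distribution function \<open>F\<close> of \<open>V\<close>. After multiplication by
  \<open>1 + exp (- 2 c)\<close>, which clears the denominator coming from \<open>cosh c\<close>, it is a power series in \<open>exp (- 2 c)\<close> with positive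
  coefficients. So \<open>F + F * h\<^sub>2\<close> is a positive series of mixtures of the \<open>h\<^sub>b\<close>, whose term with the smallest levels,
  \<open>b \<ge> 3/2\<close>, produces the stated asymptotics, while \<open>F * h\<^sub>2 = o(F)\<close>.
\<close>

section \<open>Mehler kernels and Gaussian quadrant integrals\<close>

text \<open>The last zero g is not a stopping time, so the Markov property does not apply at g; the
  signed expectation trades the event \<open>g < s\<close> for the values of the path at fixed
  times. Two times s \<le> t occur because subtraction must isolate a cell: with the energy taken
  from the right end t of the cell, the values at s = t and at its left end differ exactly by the
  paths with g in the cell. The frequency has to change from cell to cell, as \<alpha> = c / (1 -
  left end), because the squared norm of the meander is the energy after g divided by (1 - g)^2. All
  expectations are computed on finite grids, where reflection at a fixed index merely flips signs of
  independent symmetric increments, so that no strong Markov property enters. The price is paid in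
  the limit: a grid sees only sign changes, hence almost every path with a zero in [s, 1] must be
  shown to change sign there. Expanding 1 / cosh c itself would give alternating signs and no
  termwise bounds. With the factor 1 + exp (- 2 c) all terms are positive, but the identity concerns
  F plus a convolution of F, which is absorbed by monotonicity of F.\<close>

lemma nn_integral_exp_quadratic:
  fixes A B :: real
  assumes "A > 0"
  shows "(\<integral>\<^sup>+y. ennreal (exp (- A * y\<^sup>2 / 2 + B * y)) \<partial>lborel)
    = ennreal (sqrt (2 * pi / A) * exp (B\<^sup>2 / (2 * A)))"
proof -
  have "exp (- A * y\<^sup>2 / 2 + B * y)
      = sqrt (2 * pi / A) * exp (B\<^sup>2 / (2 * A)) * normal_density (B / A) (1 / sqrt A) y" for y
  proof -
    have "- A * y\<^sup>2 / 2 + B * y = B\<^sup>2 / (2 * A) - (y - B / A)\<^sup>2 * A / 2"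
      using assms by (simp add: field_simps power2_eq_square)
    then show ?thesis
      using assms
      by (simp add: normal_density_def real_sqrt_divide real_sqrt_mult power_divide exp_add [symmetric]
          field_simps exp_diff exp_minus)
  qed
  then have "(\<integral>\<^sup>+y. ennreal (exp (- A * y\<^sup>2 / 2 + B * y)) \<partial>lborel)
     = (\<integral>\<^sup>+y. ennreal (sqrt (2 * pi / A) * exp (B\<^sup>2 / (2 * A))) * ennreal (normal_density (B / A) (1 / sqrt A) y) \<partial>lborel)"
    using assms by (simp add: ennreal_mult'')
  also have "\<dots> = ennreal (sqrt (2 * pi / A) * exp (B\<^sup>2 / (2 * A)))"
    using assms by (simp add: nn_integral_cmult nn_integral_eq_integral)
  finally show ?thesis .
qed

definition gauss_kernel :: "real \<Rightarrow> real \<Rightarrow> real \<Rightarrow> real \<Rightarrow> real \<Rightarrow> real" where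
  "gauss_kernel p q s x y = exp (- (p * x\<^sup>2 + q * y\<^sup>2) / 2 + s * x * y)"

lemma gauss_kernel_pos [simp]: "0 < gauss_kernel p q s x y"
  and gauss_kernel_nonneg [simp]: "0 \<le> gauss_kernel p q s x y"
  by (simp_all add: gauss_kernel_def)

lemma measurable_gauss_kernel [measurable (raw)]:
  assumes [measurable]: "f \<in> borel_measurable N" "g \<in> borel_measurable N"
  shows "(\<lambda>w. gauss_kernel p q s (f w) (g w)) \<in> borel_measurable N"
  unfolding gauss_kernel_def by measurable

lemma gauss_kernel_compose:
  assumes "q + p' > 0"
  shows "(\<integral>\<^sup>+y. ennreal (gauss_kernel p q s x y) * ennreal (gauss_kernel p' q' s' y z) \<partial>lborel)
    = ennreal (sqrt (2 * pi / (q + p')) *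
        gauss_kernel (p - s\<^sup>2 / (q + p')) (q' - s'\<^sup>2 / (q + p')) (s * s' / (q + p')) x z)"
proof -
  have eq: "gauss_kernel p q s x y * gauss_kernel p' q' s' y z
     = exp (- (p * x\<^sup>2 + q' * z\<^sup>2) / 2) * exp (- (q + p') * y\<^sup>2 / 2 + (s * x + s' * z) * y)" for y
    by (simp add: gauss_kernel_def exp_add [symmetric] algebra_simps add_divide_distrib diff_divide_distrib)
  have "(\<integral>\<^sup>+y. ennreal (gauss_kernel p q s x y) * ennreal (gauss_kernel p' q' s' y z) \<partial>lborel)
     = (\<integral>\<^sup>+y. ennreal (exp (- (p * x\<^sup>2 + q' * z\<^sup>2) / 2)) * ennreal (exp (- (q + p') * y\<^sup>2 / 2 + (s * x + s' * z) * y)) \<partial>lborel)"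
    unfolding ennreal_mult' [OF gauss_kernel_nonneg, symmetric] eq by (simp add: ennreal_mult')
  also have "\<dots> = ennreal (exp (- (p * x\<^sup>2 + q' * z\<^sup>2) / 2)) *
      ennreal (sqrt (2 * pi / (q + p')) * exp ((s * x + s' * z)\<^sup>2 / (2 * (q + p'))))"
    by (subst nn_integral_cmult) (simp_all only: nn_integral_exp_quadratic [OF assms], measurable)
  also have "\<dots> = ennreal (sqrt (2 * pi / (q + p')) *
      (exp (- (p * x\<^sup>2 + q' * z\<^sup>2) / 2) * exp ((s * x + s' * z)\<^sup>2 / (2 * (q + p')))))"
    by (subst ennreal_mult' [symmetric]) (simp_all add: mult_ac)
  also have "exp (- (p * x\<^sup>2 + q' * z\<^sup>2) / 2) * exp ((s * x + s' * z)\<^sup>2 / (2 * (q + p')))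
     = gauss_kernel (p - s\<^sup>2 / (q + p')) (q' - s'\<^sup>2 / (q + p')) (s * s' / (q + p')) x z"
  proof -
    \<comment> \<open>With the reciprocal as a variable, the identity between the exponents is
      polynomial.\<close>
    define r where "r = inverse (q + p')"
    have "- (p * x\<^sup>2 + q' * z\<^sup>2) / 2 + (s * x + s' * z)\<^sup>2 * r / 2
      = - ((p - s\<^sup>2 * r) * x\<^sup>2 + (q' - s'\<^sup>2 * r) * z\<^sup>2) / 2 + s * s' * r * x * z"
      by algebra
    moreover have "u / (q + p') = u * r" "u / (2 * (q + p')) = u * r / 2" for u
      by (simp_all only: r_def divide_inverse inverse_mult_distrib mult_ac)
    ultimately show ?thesis
      by (simp only: gauss_kernel_def exp_add [symmetric])
  qed
  finally show ?thesis .
qed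

text \<open>The propagator of the harmonic oscillator: with H = - (1/2) d^2/dx^2 + a^2 x^2 / 2 this
  is the kernel of exp (- (\<theta> / a) H), so \<open>a\<close> is a frequency and \<theta> is
  frequency times elapsed time.\<close>

definition mehler :: "real \<Rightarrow> real \<Rightarrow> real \<Rightarrow> real \<Rightarrow> real" where
  "mehler a \<theta> x y = sqrt (a / (2 * pi * sinh \<theta>)) *
     gauss_kernel (a * cosh \<theta> / sinh \<theta>) (a * cosh \<theta> / sinh \<theta>) (a / sinh \<theta>) x y"

lemma measurable_mehler [measurable (raw)]:
  assumes [measurable]: "f \<in> borel_measurable N" "g \<in> borel_measurable N"
  shows "(\<lambda>w. mehler a \<theta> (f w) (g w)) \<in> borel_measurable N"
  unfolding mehler_def by measurable

text \<open>After the addition formulas for sinh and cosh, the exponents match by cosh^2 = 1 +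
  sinh^2 (\<open>e1\<close>, \<open>e2\<close>, \<open>e3\<close>) and the normalising roots match
  by \<open>e4\<close>.\<close>

lemma mehler_compose:
  assumes a: "a > 0" and pos: "\<theta> > 0" "\<phi> > 0"
  shows "(\<integral>\<^sup>+y. ennreal (mehler a \<theta> x y) * ennreal (mehler a \<phi> y z) \<partial>lborel)
    = ennreal (mehler a (\<theta> + \<phi>) x z)"
proof -
  define s1 where "s1 = sinh \<theta>"
  define s2 where "s2 = sinh \<phi>"
  define c1 where "c1 = cosh \<theta>"
  define c2 where "c2 = cosh \<phi>"
  define u where "u = s1 * c2 + c1 * s2"
  have sp: "s1 > 0" "s2 > 0" "c1 > 0" "c2 > 0"
    using pos by (simp_all add: s1_def s2_def c1_def c2_def)
  then have up: "u > 0" by (simp add: u_def add_pos_pos)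
  have sq: "c1\<^sup>2 = s1\<^sup>2 + 1" "c2\<^sup>2 = s2\<^sup>2 + 1"
    by (simp_all add: c1_def s1_def c2_def s2_def cosh_square_eq)
  have sum: "sinh (\<theta> + \<phi>) = u" "cosh (\<theta> + \<phi>) = c1 * c2 + s1 * s2"
    by (simp_all add: u_def s1_def s2_def c1_def c2_def sinh_add cosh_add)
  have den: "a * c1 / s1 + a * c2 / s2 = a * u / (s1 * s2)"
    using sp by (simp add: u_def field_simps)
  have den_pos: "a * c1 / s1 + a * c2 / s2 > 0"
    using sp a by (simp add: add_pos_pos)
  have e1: "a * c1 / s1 - (a / s1)\<^sup>2 / (a * u / (s1 * s2)) = a * (c1 * c2 + s1 * s2) / u"
  proof -
    have "c1 * u - s2 = s1 * (c1 * c2 + s1 * s2)"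
      using sq(1) unfolding u_def by algebra
    moreover have "a * c1 / s1 - (a / s1)\<^sup>2 / (a * u / (s1 * s2)) = a * (c1 * u - s2) / (s1 * u)"
      using sp up a by (simp add: field_simps power2_eq_square)
    ultimately show ?thesis using sp up by simp
  qed
  have e2: "a * c2 / s2 - (a / s2)\<^sup>2 / (a * u / (s1 * s2)) = a * (c1 * c2 + s1 * s2) / u"
  proof -
    have "c2 * u - s1 = s2 * (c1 * c2 + s1 * s2)"
      using sq(2) unfolding u_def by algebra
    moreover have "a * c2 / s2 - (a / s2)\<^sup>2 / (a * u / (s1 * s2)) = a * (c2 * u - s1) / (s2 * u)"
      using sp up a by (simp add: field_simps power2_eq_square)
    ultimately show ?thesis using sp up by simp
  qed
  have e3: "a / s1 * (a / s2) / (a * u / (s1 * s2)) = a / u"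
    using sp up a by (simp add: field_simps)
  have e4: "sqrt (a / (2 * pi * s1)) * sqrt (a / (2 * pi * s2)) * sqrt (2 * pi / (a * u / (s1 * s2)))
     = sqrt (a / (2 * pi * u))"
    using sp up a by (simp add: real_sqrt_mult [symmetric] field_simps del: real_sqrt_mult)
  have "(\<integral>\<^sup>+y. ennreal (mehler a \<theta> x y) * ennreal (mehler a \<phi> y z) \<partial>lborel)
     = (\<integral>\<^sup>+y. ennreal (sqrt (a / (2 * pi * s1)) * sqrt (a / (2 * pi * s2))) *
         (ennreal (gauss_kernel (a * c1 / s1) (a * c1 / s1) (a / s1) x y) *
          ennreal (gauss_kernel (a * c2 / s2) (a * c2 / s2) (a / s2) y z)) \<partial>lborel)"
    using sp a unfolding mehler_def s1_def [symmetric] s2_def [symmetric] c1_def [symmetric] c2_def [symmetric]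
    by (simp add: ennreal_mult' mult_ac)
  also have "\<dots> = ennreal (sqrt (a / (2 * pi * s1)) * sqrt (a / (2 * pi * s2))) *
        ennreal (sqrt (2 * pi / (a * u / (s1 * s2))) *
          gauss_kernel (a * (c1 * c2 + s1 * s2) / u) (a * (c1 * c2 + s1 * s2) / u) (a / u) x z)"
    using sp up a
    apply (subst nn_integral_cmult, measurable)
    apply (subst gauss_kernel_compose [OF den_pos])
    by (simp only: den e1 e2 e3)
  also have "\<dots> = ennreal (mehler a (\<theta> + \<phi>) x z)"
    using sp up a unfolding mehler_def sum e4 [symmetric]
    by (subst ennreal_mult' [symmetric]) (simp_all add: mult_ac)
  finally show ?thesis .
qed

text \<open>The parameters are forced: the coefficient of x y is 1 / d in the normal density, whence
  a = sinh \<theta> / d, and the coefficient of the squares then requires cosh \<theta> = 1 +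
  \<alpha>^2 d^2 / 2, which is the double angle formula for sinh (\<theta> / 2) = \<alpha> d / 2.
  Thus the frequency depends on the mesh and equals \<alpha> only in the limit.\<close>

lemma mehler_step:
  fixes \<alpha> d :: real
  assumes "\<alpha> > 0" "d > 0"
  defines "\<theta> \<equiv> 2 * arsinh (\<alpha> * d / 2)"
  shows "\<theta> > 0" and "exp (- \<alpha>\<^sup>2 * d / 4 * (x\<^sup>2 + y\<^sup>2)) * normal_density 0 (sqrt d) (y - x)
    = mehler (sinh \<theta> / d) \<theta> x y"
proof -
  show \<theta>: "\<theta> > 0" unfolding \<theta>_def using assms(1,2) by simp
  have "cosh (2 * arsinh (\<alpha> * d / 2)) = 2 * (sinh (arsinh (\<alpha> * d / 2)))\<^sup>2 + 1"
    unfolding cosh_double cosh_square_eq by simp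
  then have ch: "cosh \<theta> = 1 + \<alpha>\<^sup>2 * d\<^sup>2 / 2"
    unfolding \<theta>_def sinh_arsinh_real by (simp add: power2_eq_square)
  have sp: "sinh \<theta> > 0" using \<theta> by simp
  have "sinh \<theta> / d * cosh \<theta> / sinh \<theta> = (1 + \<alpha>\<^sup>2 * d\<^sup>2 / 2) / d"
    using sp unfolding ch by simp
  also have "\<dots> = 1 / d + \<alpha>\<^sup>2 * d / 2"
    using \<open>d > 0\<close> by (simp add: field_simps power2_eq_square)
  finally have e: "sinh \<theta> / d * cosh \<theta> / sinh \<theta> = 1 / d + \<alpha>\<^sup>2 * d / 2" "sinh \<theta> / d / sinh \<theta> = 1 / d"
    using sp by simp_all
  have e2: "sinh \<theta> / d / (2 * pi * sinh \<theta>) = 1 / (2 * pi * d)"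
    using sp by simp
  have "- \<alpha>\<^sup>2 * d / 4 * (x\<^sup>2 + y\<^sup>2) + - (y - x)\<^sup>2 / (2 * d)
    = - ((1 / d + \<alpha>\<^sup>2 * d / 2) * x\<^sup>2 + (1 / d + \<alpha>\<^sup>2 * d / 2) * y\<^sup>2) / 2 + 1 / d * x * y"
    using \<open>d > 0\<close> by (simp add: field_simps power2_eq_square)
  then have "exp (- \<alpha>\<^sup>2 * d / 4 * (x\<^sup>2 + y\<^sup>2)) * exp (- (y - x)\<^sup>2 / (2 * d))
     = gauss_kernel (1 / d + \<alpha>\<^sup>2 * d / 2) (1 / d + \<alpha>\<^sup>2 * d / 2) (1 / d) x y"
    unfolding gauss_kernel_def exp_add [symmetric] by simp
  then show "exp (- \<alpha>\<^sup>2 * d / 4 * (x\<^sup>2 + y\<^sup>2)) * normal_density 0 (sqrt d) (y - x)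
    = mehler (sinh \<theta> / d) \<theta> x y"
    unfolding mehler_def e e2 normal_density_def using \<open>d > 0\<close>
    by (simp add: real_sqrt_divide)
qed

text \<open>The substitution y = x r makes the inner integral over x elementary, with value 1 / (A +
  B r^2 - 2 S r). This leaves a rational function of the slope r, whose primitive is an arctangent;
  positivity of the quadratic is that of the determinant \<open>D\<close>.\<close>

lemma nn_integral_quadrant_gauss_kernel:
  assumes A: "A > 0" and B: "B > 0" and D: "D = A * B - S\<^sup>2" "D > 0"
  shows "(\<integral>\<^sup>+x. \<integral>\<^sup>+y. ennreal (gauss_kernel A B S x y) * indicator {0<..} y * indicator {0<..} x \<partial>lborel \<partial>lborel)
    = ennreal ((pi / 2 + arctan (S / sqrt D)) / sqrt D)"
proof -
  have qpos: "A + B * r\<^sup>2 - 2 * S * r > 0" for r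
  proof -
    have "B * (A + B * r\<^sup>2 - 2 * S * r) = D + (B * r - S)\<^sup>2"
      by (simp add: D(1) power2_eq_square algebra_simps)
    also have "\<dots> > 0" using D(2) by (simp add: add_pos_nonneg)
    finally show ?thesis using B by (simp add: zero_less_mult_iff)
  qed
  have "(\<integral>\<^sup>+x. \<integral>\<^sup>+y. ennreal (gauss_kernel A B S x y) * indicator {0<..} y * indicator {0<..} x \<partial>lborel \<partial>lborel)
     = (\<integral>\<^sup>+x. \<integral>\<^sup>+r. ennreal (x * exp (- x\<^sup>2 * (A + B * r\<^sup>2 - 2 * S * r) / 2)) * indicator {0<..} r * indicator {0..} x \<partial>lborel \<partial>lborel)"
  proof (rule nn_integral_cong_AE, rule AE_mp [OF AE_lborel_singleton [of 0]], rule AE_I2, rule impI)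
    fix x :: real assume "x \<noteq> 0"
    show "(\<integral>\<^sup>+y. ennreal (gauss_kernel A B S x y) * indicator {0<..} y * indicator {0<..} x \<partial>lborel)
       = (\<integral>\<^sup>+r. ennreal (x * exp (- x\<^sup>2 * (A + B * r\<^sup>2 - 2 * S * r) / 2)) * indicator {0<..} r * indicator {0..} x \<partial>lborel)"
    proof (cases "x > 0")
      case True
      have "(\<integral>\<^sup>+y. ennreal (gauss_kernel A B S x y) * indicator {0<..} y * indicator {0<..} x \<partial>lborel)
         = ennreal x * (\<integral>\<^sup>+r. ennreal (gauss_kernel A B S x (x * r)) * indicator {0<..} (x * r) \<partial>lborel)"
        using True by (subst nn_integral_real_affine [where c = x and t = 0]) auto
      also have "\<dots> = (\<integral>\<^sup>+r. ennreal x * (ennreal (gauss_kernel A B S x (x * r)) * indicator {0<..} (x * r)) \<partial>lborel)"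
        by (subst nn_integral_cmult) auto
      also have "\<dots> = (\<integral>\<^sup>+r. ennreal (x * exp (- x\<^sup>2 * (A + B * r\<^sup>2 - 2 * S * r) / 2)) * indicator {0<..} r * indicator {0..} x \<partial>lborel)"
      proof (rule nn_integral_cong)
        fix r :: real
        have "- (A * x\<^sup>2 + B * (x * r)\<^sup>2) / 2 + S * x * (x * r) = - x\<^sup>2 * (A + B * r\<^sup>2 - 2 * S * r) / 2"
          by (simp add: power2_eq_square algebra_simps add_divide_distrib diff_divide_distrib)
        then have "gauss_kernel A B S x (x * r) = exp (- x\<^sup>2 * (A + B * r\<^sup>2 - 2 * S * r) / 2)"
          unfolding gauss_kernel_def by simp
        then show "ennreal x * (ennreal (gauss_kernel A B S x (x * r)) * indicator {0<..} (x * r))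
          = ennreal (x * exp (- x\<^sup>2 * (A + B * r\<^sup>2 - 2 * S * r) / 2)) * indicator {0<..} r * indicator {0..} x"
          using True by (simp add: ennreal_mult' indicator_def zero_less_mult_iff)
      qed
      finally show ?thesis .
    qed (use \<open>x \<noteq> 0\<close> in simp)
  qed
  also have "\<dots> = (\<integral>\<^sup>+r. \<integral>\<^sup>+x. ennreal (x * exp (- x\<^sup>2 * (A + B * r\<^sup>2 - 2 * S * r) / 2)) * indicator {0<..} r * indicator {0..} x \<partial>lborel \<partial>lborel)"
    by (rule lborel_pair.Fubini') measurable
  also have "\<dots> = (\<integral>\<^sup>+r. ennreal (1 / (A + B * r\<^sup>2 - 2 * S * r)) * indicator {0..} r \<partial>lborel)"
  \<comment> \<open>Discarding the null point r = 0 replaces the open half line by the closed one on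
    which the fundamental theorem is applied.\<close>
  proof (rule nn_integral_cong_AE, rule AE_mp [OF AE_lborel_singleton [of 0]], rule AE_I2, rule impI)
    fix r :: real assume "r \<noteq> 0"
    define q where "q = A + B * r\<^sup>2 - 2 * S * r"
    have q: "q > 0" using qpos by (simp add: q_def)
    have "(\<integral>\<^sup>+x. ennreal (x * exp (- x\<^sup>2 * q / 2)) * indicator {0..} x \<partial>lborel)
       = ennreal (0 - (- exp (- 0\<^sup>2 * q / 2) / q))"
    proof (rule nn_integral_FTC_atLeast)
      show "((\<lambda>x. - exp (- x\<^sup>2 * q / 2) / q) has_real_derivative x * exp (- x\<^sup>2 * q / 2)) (at x)" for x
        using q by (auto intro!: derivative_eq_intros)
      show "((\<lambda>x. - exp (- x\<^sup>2 * q / 2) / q) \<longlongrightarrow> 0) at_top"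
        using q by real_asymp
    qed auto
    then show "(\<integral>\<^sup>+x. ennreal (x * exp (- x\<^sup>2 * (A + B * r\<^sup>2 - 2 * S * r) / 2)) * indicator {0<..} r * indicator {0..} x \<partial>lborel)
      = ennreal (1 / (A + B * r\<^sup>2 - 2 * S * r)) * indicator {0..} r"
      using \<open>r \<noteq> 0\<close> unfolding q_def [symmetric] by (auto simp: indicator_def)
  qed
  also have "\<dots> = ennreal (1 / sqrt D * (pi / 2) - 1 / sqrt D * arctan ((B * 0 - S) / sqrt D))"
  proof (rule nn_integral_FTC_atLeast)
    fix r :: real
    have sq: "sqrt D > 0" using D by simp
    have "D + (B * r - S)\<^sup>2 = B * (A + B * r\<^sup>2 - 2 * S * r)"
      by (simp add: D(1) power2_eq_square algebra_simps)
    then have "1 + ((B * r - S) / sqrt D)\<^sup>2 = B * (A + B * r\<^sup>2 - 2 * S * r) / D"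
      using D(2) by (simp add: power_divide field_simps)
    then have eq: "inverse (1 + ((B * r - S) / sqrt D)\<^sup>2) = D / (B * (A + B * r\<^sup>2 - 2 * S * r))"
      by simp
    have "((\<lambda>r. arctan ((B * r - S) / sqrt D)) has_real_derivative
        inverse (1 + ((B * r - S) / sqrt D)\<^sup>2) * (B / sqrt D)) (at r)"
      using DERIV_cdivide [OF DERIV_diff [OF DERIV_cmult_Id [of B] DERIV_const [of S]], of "sqrt D" r UNIV]
      by (intro DERIV_chain2 [OF DERIV_arctan]) simp
    then have "((\<lambda>r. 1 / sqrt D * arctan ((B * r - S) / sqrt D)) has_real_derivative
        1 / sqrt D * (inverse (1 + ((B * r - S) / sqrt D)\<^sup>2) * (B / sqrt D))) (at r)"
      by (rule DERIV_cmult)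
    moreover have "1 / sqrt D * (inverse (1 + ((B * r - S) / sqrt D)\<^sup>2) * (B / sqrt D)) = 1 / (A + B * r\<^sup>2 - 2 * S * r)"
    proof -
      have "D = sqrt D * sqrt D" using D(2) by simp
      then have "1 / sqrt D * (D / (B * q) * (B / sqrt D)) = 1 / q" if "q > 0" for q
        using sq B that by (metis (no_types, lifting) mult.commute nonzero_mult_div_cancel_left
            times_divide_eq_right times_divide_times_eq divide_self_if less_irrefl mult_cancel_right2 mult.right_neutral)
      then show ?thesis unfolding eq using qpos [of r] by simp
    qed
    ultimately show "((\<lambda>r. 1 / sqrt D * arctan ((B * r - S) / sqrt D)) has_real_derivative
        1 / (A + B * r\<^sup>2 - 2 * S * r)) (at r)" by metis
    show "0 \<le> 1 / (A + B * r\<^sup>2 - 2 * S * r)" using qpos [of r] by simp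
  next
    have "filterlim (\<lambda>r. (B * r - S) / sqrt D) at_top at_top"
      using B D(2) by real_asymp
    then have "((\<lambda>r. arctan ((B * r - S) / sqrt D)) \<longlongrightarrow> pi / 2) at_top"
      by (rule filterlim_compose [OF tendsto_arctan_at_top])
    then show "((\<lambda>r. 1 / sqrt D * arctan ((B * r - S) / sqrt D)) \<longlongrightarrow> 1 / sqrt D * (pi / 2)) at_top"
      by (rule tendsto_mult_left)
  qed measurable
  also have "\<dots> = ennreal ((pi / 2 + arctan (S / sqrt D)) / sqrt D)"
    by (simp add: arctan_minus add_divide_distrib mult.commute)
  finally show ?thesis .
qed

section \<open>Brownian motion on a finite grid: independence and Markov chain\<close>

context std_brownian_motion
begin

abbreviation grid_incr :: "(nat \<Rightarrow> real) \<Rightarrow> nat \<Rightarrow> 'a \<Rightarrow> real" where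
  "grid_incr \<tau> i \<omega> \<equiv> W (\<tau> (Suc i)) \<omega> - W (\<tau> i) \<omega>"

lemma W_eq_sum_grid_incr:
  assumes "\<tau> 0 = 0" "\<omega> \<in> space M"
  shows "W (\<tau> k) \<omega> = (\<Sum>i<k. grid_incr \<tau> i \<omega>)"
  using sum_lessThan_telescope [of "\<lambda>i. W (\<tau> i) \<omega>" k] assms start by simp

lemma grid_nonneg:
  fixes \<tau> :: "nat \<Rightarrow> real"
  assumes "\<tau> 0 = (0::real)" "mono_on {..n} \<tau>" "i \<le> n"
  shows "0 \<le> \<tau> i"
  using mono_onD [OF assms(2), of 0 i] assms(1,3) by auto

text \<open>The indices in \<open>A\<close> may lie on either side of \<open>n\<close>: the Markov
  step integrates out the last increment given the earlier ones, while
  \<open>AE_signed_INF_nonzero\<close> integrates out the first given the later ones.\<close>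

lemma indep_increment_nn_integral:
  assumes \<tau>: "\<tau> 0 = 0" "mono_on {..m} \<tau>" "\<tau> n < \<tau> (Suc n)"
    and A: "A \<subseteq> {..<m}" "n < m" "n \<notin> A"
    and f [measurable]: "f \<in> borel_measurable (PiM A (\<lambda>_. borel) \<Otimes>\<^sub>M borel)"
  shows "(\<integral>\<^sup>+\<omega>. f (\<lambda>i\<in>A. grid_incr \<tau> i \<omega>, grid_incr \<tau> n \<omega>) \<partial>M)
    = (\<integral>\<^sup>+\<omega>. \<integral>\<^sup>+z. f (\<lambda>i\<in>A. grid_incr \<tau> i \<omega>, z) * normal_density 0 (sqrt (\<tau> (Suc n) - \<tau> n)) z \<partial>lborel \<partial>M)"
proof -
  let ?P = "PiM A (\<lambda>_. borel :: real measure)"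
  let ?Q = "PiM {n} (\<lambda>_. borel :: real measure)"
  define X where "X \<omega> = (\<lambda>i\<in>A. grid_incr \<tau> i \<omega>)" for \<omega>
  define Y where "Y \<omega> = (\<lambda>i\<in>{n}. grid_incr \<tau> i \<omega>)" for \<omega>
  have Yn: "Y \<omega> n = grid_incr \<tau> n \<omega>" for \<omega> by (simp add: Y_def)
  have ind: "indep_vars (\<lambda>_. borel) (grid_incr \<tau>) {..<m}"
    using \<tau> by (intro independent_increments) auto
  have "indep_var ?P X ?Q Y"
    unfolding X_def Y_def by (rule indep_var_restrict [OF ind]) (use A in auto)
  then have X [measurable]: "X \<in> measurable M ?P" and Y [measurable]: "Y \<in> measurable M ?Q"
    and eq: "distr M ?P X \<Otimes>\<^sub>M distr M ?Q Y = distr M (?P \<Otimes>\<^sub>M ?Q) (\<lambda>\<omega>. (X \<omega>, Y \<omega>))"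
    unfolding indep_var_distribution_eq by blast+
  have n_meas [measurable]: "(\<lambda>v. v n) \<in> borel_measurable ?Q"
    by (rule measurable_component_singleton) simp
  have f1 [measurable]: "(\<lambda>p. f (fst p, snd p n)) \<in> borel_measurable (?P \<Otimes>\<^sub>M ?Q)"
    by measurable
  interpret Y: prob_space "distr M ?Q Y" by (rule prob_space_distr) simp
  have dist: "distributed M lborel (grid_incr \<tau> n) (normal_density 0 (sqrt (\<tau> (Suc n) - \<tau> n)))"
    using \<tau> A grid_nonneg [OF \<tau>(1,2), of n] by (intro normal_increments) auto
  have "(\<integral>\<^sup>+\<omega>. f (X \<omega>, grid_incr \<tau> n \<omega>) \<partial>M) = (\<integral>\<^sup>+p. f (fst p, snd p n) \<partial>distr M (?P \<Otimes>\<^sub>M ?Q) (\<lambda>\<omega>. (X \<omega>, Y \<omega>)))"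
    by (subst nn_integral_distr) (simp_all add: Yn)
  also have "\<dots> = (\<integral>\<^sup>+x. \<integral>\<^sup>+v. f (x, v n) \<partial>distr M ?Q Y \<partial>distr M ?P X)"
    unfolding eq [symmetric] by (subst Y.nn_integral_fst [symmetric]) (simp_all cong: measurable_cong_sets)
  also have "\<dots> = (\<integral>\<^sup>+\<omega>. \<integral>\<^sup>+v. f (X \<omega>, v n) \<partial>distr M ?Q Y \<partial>M)"
  proof (rule nn_integral_distr [OF X])
    have "(\<lambda>(x, v). f (x, v n)) \<in> borel_measurable (?P \<Otimes>\<^sub>M distr M ?Q Y)"
      by (simp cong: measurable_cong_sets)
    then have "(\<lambda>x. \<integral>\<^sup>+v. f (x, v n) \<partial>distr M ?Q Y) \<in> borel_measurable ?P"
      by (rule Y.borel_measurable_nn_integral)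
    then show "(\<lambda>x. \<integral>\<^sup>+v. f (x, v n) \<partial>distr M ?Q Y) \<in> borel_measurable (distr M ?P X)"
      by simp
  qed
  also have "\<dots> = (\<integral>\<^sup>+\<omega>. \<integral>\<^sup>+z. f (X \<omega>, z) * normal_density 0 (sqrt (\<tau> (Suc n) - \<tau> n)) z \<partial>lborel \<partial>M)"
  proof (rule nn_integral_cong)
    fix \<omega> assume "\<omega> \<in> space M"
    then have [measurable]: "X \<omega> \<in> space ?P" by (rule measurable_space [OF X])
    have fm [measurable]: "(\<lambda>z. f (X \<omega>, z)) \<in> borel_measurable borel"
      by measurable
    have "(\<integral>\<^sup>+v. f (X \<omega>, v n) \<partial>distr M ?Q Y) = (\<integral>\<^sup>+\<omega>'. f (X \<omega>, Y \<omega>' n) \<partial>M)"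
      by (rule nn_integral_distr) measurable
    also have "\<dots> = (\<integral>\<^sup>+z. ennreal (normal_density 0 (sqrt (\<tau> (Suc n) - \<tau> n)) z) * f (X \<omega>, z) \<partial>lborel)"
      unfolding Yn by (rule distributed_nn_integral [OF dist, symmetric]) simp
    finally show "(\<integral>\<^sup>+v. f (X \<omega>, v n) \<partial>distr M ?Q Y)
       = (\<integral>\<^sup>+z. f (X \<omega>, z) * normal_density 0 (sqrt (\<tau> (Suc n) - \<tau> n)) z \<partial>lborel)"
      by (simp add: mult.commute)
  qed
  finally show ?thesis unfolding X_def .
qed

text \<open>The past enters as a function \<open>y\<close> of the increments before
  \<open>n\<close>, since independence is available for increments; W at the n-th grid time is
  itself their sum, which is why the normal density appears shifted by it.\<close>

lemma markov_nn_integral: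
  assumes \<tau>: "\<tau> 0 = 0" "mono_on {..Suc n} \<tau>" "\<tau> n < \<tau> (Suc n)"
    and y [measurable]: "y \<in> borel_measurable (PiM {..<n} (\<lambda>_. borel :: real measure))"
    and k [measurable]: "(\<lambda>p. k (fst p) (snd p)) \<in> borel_measurable (borel \<Otimes>\<^sub>M (borel :: real measure))"
  shows "(\<integral>\<^sup>+\<omega>. y (\<lambda>i\<in>{..<n}. grid_incr \<tau> i \<omega>) * k (W (\<tau> n) \<omega>) (W (\<tau> (Suc n)) \<omega>) \<partial>M)
    = (\<integral>\<^sup>+\<omega>. y (\<lambda>i\<in>{..<n}. grid_incr \<tau> i \<omega>) *
        (\<integral>\<^sup>+z. k (W (\<tau> n) \<omega>) z * ennreal (normal_density 0 (sqrt (\<tau> (Suc n) - \<tau> n)) (z - W (\<tau> n) \<omega>)) \<partial>lborel) \<partial>M)"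
proof -
  let ?P = "PiM {..<n} (\<lambda>_. borel :: real measure)"
  let ?X = "\<lambda>\<omega>. \<lambda>i\<in>{..<n}. grid_incr \<tau> i \<omega>"
  let ?\<phi> = "normal_density 0 (sqrt (\<tau> (Suc n) - \<tau> n))"
  have [measurable (raw)]: "(\<lambda>x. k (f x) (g x)) \<in> borel_measurable N"
    if "f \<in> borel_measurable N" "g \<in> borel_measurable N" for f g and N :: "'c measure"
    using measurable_compose [OF measurable_Pair [OF that] k] by simp
  have kx [measurable]: "(\<lambda>z. k x z) \<in> borel_measurable borel" for x
    using measurable_compose [OF _ k, of "\<lambda>z. (x, z)" borel] by simp
  have w: "(\<Sum>i<n. ?X \<omega> i) = W (\<tau> n) \<omega>" if "\<omega> \<in> space M" for \<omega>
    by (rule trans [OF sum.cong W_eq_sum_grid_incr [of \<tau>, OF \<tau>(1) that, symmetric]]) auto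
  have "(\<integral>\<^sup>+\<omega>. y (?X \<omega>) * k (W (\<tau> n) \<omega>) (W (\<tau> (Suc n)) \<omega>) \<partial>M)
    = (\<integral>\<^sup>+\<omega>. (\<lambda>(x, z). y x * k (\<Sum>i<n. x i) ((\<Sum>i<n. x i) + z)) (?X \<omega>, grid_incr \<tau> n \<omega>) \<partial>M)"
    by (rule nn_integral_cong) (simp only: w prod.case, simp)
  also have "\<dots> = (\<integral>\<^sup>+\<omega>. \<integral>\<^sup>+z. (\<lambda>(x, z). y x * k (\<Sum>i<n. x i) ((\<Sum>i<n. x i) + z)) (?X \<omega>, z) * ?\<phi> z \<partial>lborel \<partial>M)"
    by (rule indep_increment_nn_integral [OF \<tau>]) (auto, measurable)
  also have "\<dots> = (\<integral>\<^sup>+\<omega>. y (?X \<omega>) * (\<integral>\<^sup>+z. k (W (\<tau> n) \<omega>) z * ennreal (?\<phi> (z - W (\<tau> n) \<omega>)) \<partial>lborel) \<partial>M)"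
  proof (rule nn_integral_cong)
    fix \<omega> assume \<omega>: "\<omega> \<in> space M"
    have "(\<lambda>z. ennreal (?\<phi> (z - W (\<tau> n) \<omega>))) \<in> borel_measurable borel"
      by measurable
    then have "(\<lambda>z. k (W (\<tau> n) \<omega>) z * ennreal (?\<phi> (z - W (\<tau> n) \<omega>))) \<in> borel_measurable borel"
      by (intro borel_measurable_times_ennreal kx)
    note nn_integral_real_affine [OF this, of 1 "W (\<tau> n) \<omega>"]
    then have "(\<integral>\<^sup>+z. k (W (\<tau> n) \<omega>) z * ennreal (?\<phi> (z - W (\<tau> n) \<omega>)) \<partial>lborel)
      = (\<integral>\<^sup>+z. k (W (\<tau> n) \<omega>) (W (\<tau> n) \<omega> + z) * ennreal (?\<phi> z) \<partial>lborel)"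
      by simp
    moreover have "(\<integral>\<^sup>+z. y (?X \<omega>) * (k (W (\<tau> n) \<omega>) (W (\<tau> n) \<omega> + z) * ennreal (?\<phi> z)) \<partial>lborel)
      = y (?X \<omega>) * (\<integral>\<^sup>+z. k (W (\<tau> n) \<omega>) (W (\<tau> n) \<omega> + z) * ennreal (?\<phi> z) \<partial>lborel)"
      by (rule nn_integral_cmult) measurable
    ultimately show "(\<integral>\<^sup>+z. (\<lambda>(x, z). y x * k (\<Sum>i<n. x i) ((\<Sum>i<n. x i) + z)) (?X \<omega>, z) * ?\<phi> z \<partial>lborel)
      = y (?X \<omega>) * (\<integral>\<^sup>+z. k (W (\<tau> n) \<omega>) z * ennreal (?\<phi> (z - W (\<tau> n) \<omega>)) \<partial>lborel)"
      by (simp only: w [OF \<omega>] prod.case mult.assoc)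
  qed
  finally show ?thesis .
qed

lemma nn_integral_W:
  assumes "0 < s" and g [measurable]: "g \<in> borel_measurable borel"
  shows "(\<integral>\<^sup>+\<omega>. g (W s \<omega>) \<partial>M) = (\<integral>\<^sup>+x. ennreal (normal_density 0 (sqrt s) x) * g x \<partial>lborel)"
proof -
  have "(\<integral>\<^sup>+\<omega>. g (W s \<omega>) \<partial>M) = (\<integral>\<^sup>+\<omega>. g (W s \<omega> - W 0 \<omega>) \<partial>M)"
    by (intro nn_integral_cong) (simp add: start)
  also have "\<dots> = (\<integral>\<^sup>+x. ennreal (normal_density 0 (sqrt s) x) * g x \<partial>lborel)"
    using distributed_nn_integral [OF normal_increments [of 0 s], of g] assms by simp
  finally show ?thesis .
qed

text \<open>The last grid point is integrated out first. This replaces \<open>h\<close> by its image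
  under one Mehler kernel and shortens the chain, so the induction has to vary \<open>h\<close>, and
  the semigroup law adds the angles. The offset 2 reserves index 1 for the time s and index 2 for
  the time t at which the weighted stretch begins.\<close>

lemma nn_integral_kernel_chain:
  fixes \<tau> :: "nat \<Rightarrow> real" and g h :: "real \<Rightarrow> ennreal"
  assumes \<tau>: "\<tau> 0 = 0" "mono_on {..N + 2} \<tau>"
    and d: "d > 0" "\<And>i. i < N \<Longrightarrow> \<tau> (Suc (i + 2)) - \<tau> (i + 2) = d"
    and \<alpha>: "\<alpha> > 0" and n: "1 \<le> n" "n \<le> N"
    and g [measurable]: "g \<in> borel_measurable borel" and h [measurable]: "h \<in> borel_measurable borel"
  defines "\<theta> \<equiv> 2 * arsinh (\<alpha> * d / 2)"
  shows "(\<integral>\<^sup>+\<omega>. g (W (\<tau> 1) \<omega>) *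
      (\<Prod>i<n. ennreal (exp (- \<alpha>\<^sup>2 * d / 4 * ((W (\<tau> (i + 2)) \<omega>)\<^sup>2 + (W (\<tau> (Suc (i + 2))) \<omega>)\<^sup>2)))) *
      h (W (\<tau> (n + 2)) \<omega>) \<partial>M)
    = (\<integral>\<^sup>+\<omega>. g (W (\<tau> 1) \<omega>) * (\<integral>\<^sup>+y. ennreal (mehler (sinh \<theta> / d) (real n * \<theta>) (W (\<tau> 2) \<omega>) y) * h y \<partial>lborel) \<partial>M)"
proof -
  define a where "a = sinh \<theta> / d"
  have \<theta>: "\<theta> > 0" unfolding \<theta>_def by (rule mehler_step(1) [OF \<alpha> d(1)])
  then have a: "a > 0" using d by (simp add: a_def)
  define w where "w x y = ennreal (exp (- \<alpha>\<^sup>2 * d / 4 * (x\<^sup>2 + y\<^sup>2)))" for x y :: real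
  define Y where "Y n \<omega> = g (W (\<tau> 1) \<omega>) * (\<Prod>i<n. w (W (\<tau> (i + 2)) \<omega>) (W (\<tau> (Suc (i + 2))) \<omega>))" for n \<omega>
  have step: "(\<integral>\<^sup>+\<omega>. Y (Suc n) \<omega> * h (W (\<tau> (Suc n + 2)) \<omega>) \<partial>M)
     = (\<integral>\<^sup>+\<omega>. Y n \<omega> * (\<integral>\<^sup>+y. ennreal (mehler a \<theta> (W (\<tau> (n + 2)) \<omega>) y) * h y \<partial>lborel) \<partial>M)"
    if n: "n < N" and [measurable]: "h \<in> borel_measurable borel" for n h
  proof -
    define y where "y x = g (\<Sum>i<1. x i) * (\<Prod>j<n. w (\<Sum>i<j+2. x i) (\<Sum>i<Suc (j+2). x i))" for x :: "nat \<Rightarrow> real"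
    have mono: "mono_on {..Suc (n + 2)} \<tau>"
      using \<tau>(2) by (rule mono_on_subset) (use n in auto)
    have yY: "y (\<lambda>i\<in>{..<n+2}. grid_incr \<tau> i \<omega>) = Y n \<omega>" if "\<omega> \<in> space M" for \<omega>
    proof -
      have s: "(\<Sum>i<k. (\<lambda>i\<in>{..<n+2}. grid_incr \<tau> i \<omega>) i) = W (\<tau> k) \<omega>" if "k \<le> n + 2" for k
        using that by (intro trans [OF sum.cong W_eq_sum_grid_incr [of \<tau>, OF \<tau>(1) \<open>\<omega> \<in> space M\<close>, symmetric]]) auto
      show ?thesis
        unfolding y_def Y_def
      proof (intro arg_cong2 [where f = "(*)"] prod.cong refl)
        show "g (\<Sum>i<1. (\<lambda>i\<in>{..<n+2}. grid_incr \<tau> i \<omega>) i) = g (W (\<tau> 1) \<omega>)"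
          by (rule arg_cong [where f = g], rule s) simp
        fix j assume "j \<in> {..<n}"
        then show "w (\<Sum>i<j+2. (\<lambda>i\<in>{..<n+2}. grid_incr \<tau> i \<omega>) i) (\<Sum>i<Suc (j+2). (\<lambda>i\<in>{..<n+2}. grid_incr \<tau> i \<omega>) i)
          = w (W (\<tau> (j + 2)) \<omega>) (W (\<tau> (Suc (j + 2))) \<omega>)"
          by (intro arg_cong2 [where f = w] s) auto
      qed
    qed
    have ym: "y \<in> borel_measurable (PiM {..<n+2} (\<lambda>_. borel))"
    proof -
      have [measurable]: "(\<lambda>x. \<Sum>i<k. x i) \<in> borel_measurable (PiM {..<n+2} (\<lambda>_. borel :: real measure))" if "k \<le> n + 2" for k
        using that by (intro borel_measurable_sum measurable_component_singleton) auto
      show ?thesis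
        unfolding y_def w_def
        by (intro borel_measurable_times_ennreal borel_measurable_prod_ennreal measurable_compose [OF _ g]
            measurable_compose [OF _ measurable_ennreal] measurable_compose [OF _ borel_measurable_exp]
            borel_measurable_times borel_measurable_add borel_measurable_power borel_measurable_const) auto
    qed
    have "(\<integral>\<^sup>+\<omega>. Y (Suc n) \<omega> * h (W (\<tau> (Suc n + 2)) \<omega>) \<partial>M)
      = (\<integral>\<^sup>+\<omega>. y (\<lambda>i\<in>{..<n+2}. grid_incr \<tau> i \<omega>) * (\<lambda>x z. w x z * h z) (W (\<tau> (n + 2)) \<omega>) (W (\<tau> (Suc (n + 2))) \<omega>) \<partial>M)"
      by (intro nn_integral_cong) (simp only: yY, simp add: Y_def mult_ac)
    also have "\<dots> = (\<integral>\<^sup>+\<omega>. y (\<lambda>i\<in>{..<n+2}. grid_incr \<tau> i \<omega>) *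
        (\<integral>\<^sup>+z. (\<lambda>x z. w x z * h z) (W (\<tau> (n + 2)) \<omega>) z * ennreal (normal_density 0 (sqrt (\<tau> (Suc (n + 2)) - \<tau> (n + 2))) (z - W (\<tau> (n + 2)) \<omega>)) \<partial>lborel) \<partial>M)"
      using d(1) d(2) [OF n] by (intro markov_nn_integral \<tau> mono ym) (auto simp: w_def)
    also have "\<dots> = (\<integral>\<^sup>+\<omega>. Y n \<omega> * (\<integral>\<^sup>+z. ennreal (mehler a \<theta> (W (\<tau> (n + 2)) \<omega>) z) * h z \<partial>lborel) \<partial>M)"
    proof (rule nn_integral_cong)
      fix \<omega> assume \<omega>: "\<omega> \<in> space M"
      have "w x z * h z * ennreal (normal_density 0 (sqrt d) (z - x)) = ennreal (mehler a \<theta> x z) * h z" for x z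
      proof -
        have "ennreal (mehler a \<theta> x z) = w x z * ennreal (normal_density 0 (sqrt d) (z - x))"
          unfolding a_def mehler_step(2) [OF \<alpha> d(1), folded \<theta>_def, symmetric] w_def
          by (rule ennreal_mult') simp
        then show ?thesis by (simp only: mult_ac)
      qed
      then show "y (\<lambda>i\<in>{..<n+2}. grid_incr \<tau> i \<omega>) *
        (\<integral>\<^sup>+z. (\<lambda>x z. w x z * h z) (W (\<tau> (n + 2)) \<omega>) z * ennreal (normal_density 0 (sqrt (\<tau> (Suc (n + 2)) - \<tau> (n + 2))) (z - W (\<tau> (n + 2)) \<omega>)) \<partial>lborel)
        = Y n \<omega> * (\<integral>\<^sup>+z. ennreal (mehler a \<theta> (W (\<tau> (n + 2)) \<omega>) z) * h z \<partial>lborel)"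
        by (simp only: yY [OF \<omega>] d(2) [OF n])
    qed
    finally show ?thesis .
  qed
  have main: "(\<integral>\<^sup>+\<omega>. Y n \<omega> * h (W (\<tau> (n + 2)) \<omega>) \<partial>M)
     = (\<integral>\<^sup>+\<omega>. Y 0 \<omega> * (\<integral>\<^sup>+y. ennreal (mehler a (real n * \<theta>) (W (\<tau> 2) \<omega>) y) * h y \<partial>lborel) \<partial>M)"
    if "1 \<le> n" "n \<le> N" "h \<in> borel_measurable borel" for n h
    using that
  \<comment> \<open>The induction starts at 1: the angle 0 would stand for the identity operator,
    which has no kernel.\<close>
  proof (induction n arbitrary: h rule: nat_induct_at_least)
    case base
    then show ?case using step [of 0 h] by (simp add: numeral_2_eq_2)
  next
    case (Suc n)
    note [measurable] = \<open>h \<in> borel_measurable borel\<close>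
    define h' where "h' x = (\<integral>\<^sup>+y. ennreal (mehler a \<theta> x y) * h y \<partial>lborel)" for x
    have [measurable]: "h' \<in> borel_measurable borel" unfolding h'_def by measurable
    have "(\<integral>\<^sup>+y. ennreal (mehler a (real n * \<theta>) x y) * h' y \<partial>lborel)
       = (\<integral>\<^sup>+z. ennreal (mehler a (real (Suc n) * \<theta>) x z) * h z \<partial>lborel)" for x
    proof -
      have "(\<integral>\<^sup>+y. ennreal (mehler a (real n * \<theta>) x y) * h' y \<partial>lborel)
        = (\<integral>\<^sup>+y. \<integral>\<^sup>+z. ennreal (mehler a (real n * \<theta>) x y) * (ennreal (mehler a \<theta> y z) * h z) \<partial>lborel \<partial>lborel)"
        unfolding h'_def by (intro nn_integral_cong nn_integral_cmult [symmetric]) measurable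
      also have "\<dots> = (\<integral>\<^sup>+z. \<integral>\<^sup>+y. ennreal (mehler a (real n * \<theta>) x y) * (ennreal (mehler a \<theta> y z) * h z) \<partial>lborel \<partial>lborel)"
        by (rule lborel_pair.Fubini') measurable
      also have "\<dots> = (\<integral>\<^sup>+z. (\<integral>\<^sup>+y. ennreal (mehler a (real n * \<theta>) x y) * ennreal (mehler a \<theta> y z) \<partial>lborel) * h z \<partial>lborel)"
        unfolding mult.assoc [symmetric] by (intro nn_integral_cong nn_integral_multc) measurable
      also have "\<dots> = (\<integral>\<^sup>+z. ennreal (mehler a (real n * \<theta> + \<theta>) x z) * h z \<partial>lborel)"
        using Suc.hyps \<theta> by (subst mehler_compose [OF a]) auto
      finally show ?thesis by (simp add: distrib_right add.commute)
    qed
    note eq = this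
    have "(\<integral>\<^sup>+\<omega>. Y (Suc n) \<omega> * h (W (\<tau> (Suc n + 2)) \<omega>) \<partial>M) = (\<integral>\<^sup>+\<omega>. Y n \<omega> * h' (W (\<tau> (n + 2)) \<omega>) \<partial>M)"
      using Suc.prems unfolding h'_def by (intro step) auto
    also have "\<dots> = (\<integral>\<^sup>+\<omega>. Y 0 \<omega> * (\<integral>\<^sup>+y. ennreal (mehler a (real n * \<theta>) (W (\<tau> 2) \<omega>) y) * h' y \<partial>lborel) \<partial>M)"
      using Suc.prems by (intro Suc.IH) auto
    finally show ?case unfolding eq .
  qed
  show ?thesis
    using main [OF n h] by (simp add: Y_def w_def a_def)
qed

end

text \<open>The path runs unweighted from s to t (\<delta> = t - s) and weighted afterwards. The
  heat kernel is only a degenerate limit of Mehler kernels, of frequency 0, so this composition is a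
  computation of its own; it simplifies through C^2 - S^2 = a^2.\<close>

lemma normal_density_mehler_compose:
  fixes a \<Theta> \<delta> :: real
  assumes a: "a > 0" and \<Theta>: "\<Theta> > 0" and \<delta>: "\<delta> > 0"
  defines "C \<equiv> a * cosh \<Theta> / sinh \<Theta>" and "S \<equiv> a / sinh \<Theta>"
  shows "(\<integral>\<^sup>+z. ennreal (normal_density 0 (sqrt \<delta>) (z - x)) * ennreal (mehler a \<Theta> z y) \<partial>lborel)
    = ennreal (sqrt (S / (2 * pi * (1 + \<delta> * C))) *
        gauss_kernel (C / (1 + \<delta> * C)) ((C + \<delta> * a\<^sup>2) / (1 + \<delta> * C)) (S / (1 + \<delta> * C)) x y)"
proof -
  define E where "E = 1 + \<delta> * C"
  have sh: "sinh \<Theta> > 0" using \<Theta> by simp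
  have pos: "C > 0" "S > 0" "E > 0"
    using a sh \<delta> by (simp_all add: C_def S_def E_def add_pos_pos)
  have CS: "C\<^sup>2 - S\<^sup>2 = a\<^sup>2"
    using sh by (simp add: C_def S_def power_divide power_mult_distrib cosh_square_eq field_simps)
  have nd: "normal_density 0 (sqrt \<delta>) (z - x) = 1 / sqrt (2 * pi * \<delta>) * gauss_kernel (1 / \<delta>) (1 / \<delta>) (1 / \<delta>) x z" for z
  proof -
    have "- (z - x)\<^sup>2 / (2 * \<delta>) = - (1 / \<delta> * x\<^sup>2 + 1 / \<delta> * z\<^sup>2) / 2 + 1 / \<delta> * x * z"
      using \<delta> by (simp add: power2_eq_square field_simps)
    then show ?thesis using \<delta> by (simp add: normal_density_def gauss_kernel_def)
  qed
  have den: "1 / \<delta> + C = E / \<delta>" using \<delta> by (simp add: E_def field_simps)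
  have "(\<integral>\<^sup>+z. ennreal (normal_density 0 (sqrt \<delta>) (z - x)) * ennreal (mehler a \<Theta> z y) \<partial>lborel)
    = (\<integral>\<^sup>+z. ennreal (1 / sqrt (2 * pi * \<delta>) * sqrt (a / (2 * pi * sinh \<Theta>))) *
        (ennreal (gauss_kernel (1 / \<delta>) (1 / \<delta>) (1 / \<delta>) x z) * ennreal (gauss_kernel C C S z y)) \<partial>lborel)"
  proof (rule nn_integral_cong)
    fix z
    show "ennreal (normal_density 0 (sqrt \<delta>) (z - x)) * ennreal (mehler a \<Theta> z y)
      = ennreal (1 / sqrt (2 * pi * \<delta>) * sqrt (a / (2 * pi * sinh \<Theta>))) *
        (ennreal (gauss_kernel (1 / \<delta>) (1 / \<delta>) (1 / \<delta>) x z) * ennreal (gauss_kernel C C S z y))"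
      unfolding nd mehler_def C_def [symmetric] S_def [symmetric]
      using \<delta> a sh by (simp add: ennreal_mult' [symmetric] mult_ac)
  qed
  also have "\<dots> = ennreal (1 / sqrt (2 * pi * \<delta>) * sqrt (a / (2 * pi * sinh \<Theta>))) *
      ennreal (sqrt (2 * pi / (1 / \<delta> + C)) *
        gauss_kernel (1 / \<delta> - (1 / \<delta>)\<^sup>2 / (1 / \<delta> + C)) (C - S\<^sup>2 / (1 / \<delta> + C)) (1 / \<delta> * S / (1 / \<delta> + C)) x y)"
    by (subst nn_integral_cmult, measurable) (subst gauss_kernel_compose, use pos \<delta> in \<open>simp_all add: add_pos_pos\<close>)
  also have "1 / \<delta> - (1 / \<delta>)\<^sup>2 / (1 / \<delta> + C) = C / E"
  proof -
    have "1 / \<delta> - (1 / \<delta>)\<^sup>2 / (E / \<delta>) = (E - 1) / (\<delta> * E)"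
      using \<delta> pos by (simp add: power2_eq_square field_simps)
    then show ?thesis unfolding den using \<delta> by (simp add: E_def)
  qed
  also have "C - S\<^sup>2 / (1 / \<delta> + C) = (C + \<delta> * a\<^sup>2) / E"
  proof -
    have "C - S\<^sup>2 / (E / \<delta>) = (C * E - \<delta> * S\<^sup>2) / E"
      using \<delta> pos by (simp add: field_simps)
    also have "C * E - \<delta> * S\<^sup>2 = C + \<delta> * (C\<^sup>2 - S\<^sup>2)"
      by (simp add: E_def power2_eq_square algebra_simps)
    finally show ?thesis unfolding den CS .
  qed
  also have "1 / \<delta> * S / (1 / \<delta> + C) = S / E"
    unfolding den using \<delta> pos by simp
  also have "ennreal (1 / sqrt (2 * pi * \<delta>) * sqrt (a / (2 * pi * sinh \<Theta>))) *
      ennreal (sqrt (2 * pi / (1 / \<delta> + C)) * gauss_kernel (C / E) ((C + \<delta> * a\<^sup>2) / E) (S / E) x y)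
     = ennreal (sqrt (S / (2 * pi * E)) * gauss_kernel (C / E) ((C + \<delta> * a\<^sup>2) / E) (S / E) x y)"
  proof -
    have "1 / sqrt (2 * pi * \<delta>) * sqrt (a / (2 * pi * sinh \<Theta>)) * sqrt (2 * pi / (E / \<delta>))
      = sqrt (1 / (2 * pi * \<delta>) * (a / (2 * pi * sinh \<Theta>)) * (2 * pi / (E / \<delta>)))"
      by (simp add: real_sqrt_mult real_sqrt_divide)
    also have "1 / (2 * pi * \<delta>) * (a / (2 * pi * sinh \<Theta>)) * (2 * pi / (E / \<delta>)) = S / (2 * pi * E)"
      using \<delta> pos by (simp add: S_def)
    finally have e: "1 / sqrt (2 * pi * \<delta>) * sqrt (a / (2 * pi * sinh \<Theta>)) * sqrt (2 * pi / (E / \<delta>)) = sqrt (S / (2 * pi * E))" .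
    show ?thesis
      unfolding den e [symmetric] using \<delta> a sh by (subst ennreal_mult' [symmetric]) (simp_all add: mult.assoc)
  qed
  finally show ?thesis by (simp add: E_def)
qed

text \<open>Reflecting an axis only changes the sign of \<open>S\<close>, and the arctangent is
  odd.\<close>

lemma nn_integral_signed_quadrant_gauss_kernel:
  assumes A: "A > 0" and B: "B > 0" and D: "D = A * B - S\<^sup>2" "D > 0"
    and \<sigma>: "\<sigma> \<in> {1, - 1}" "\<rho> \<in> {1, - 1::real}"
  shows "(\<integral>\<^sup>+x. \<integral>\<^sup>+y. ennreal (gauss_kernel A B S x y) * indicator {0<..} (\<rho> * y) * indicator {0<..} (\<sigma> * x) \<partial>lborel \<partial>lborel)
    = ennreal ((pi / 2 + \<sigma> * \<rho> * arctan (S / sqrt D)) / sqrt D)"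
proof -
  have nz: "\<sigma> \<noteq> 0" "\<rho> \<noteq> 0" "\<bar>\<sigma>\<bar> = 1" "\<bar>\<rho>\<bar> = 1" "\<sigma> * \<sigma> = 1" "\<rho> * \<rho> = 1" using \<sigma> by auto
  have gk: "gauss_kernel A B S (\<sigma> * x) (\<rho> * y) = gauss_kernel A B (\<sigma> * \<rho> * S) x y" for x y
    using \<sigma> by (auto simp: gauss_kernel_def)
  have "(\<integral>\<^sup>+x. \<integral>\<^sup>+y. ennreal (gauss_kernel A B S x y) * indicator {0<..} (\<rho> * y) * indicator {0<..} (\<sigma> * x) \<partial>lborel \<partial>lborel)
    = (\<integral>\<^sup>+x. \<integral>\<^sup>+y. ennreal (gauss_kernel A B S (\<sigma> * x) y) * indicator {0<..} (\<rho> * y) * indicator {0<..} x \<partial>lborel \<partial>lborel)"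
    using nz by (subst nn_integral_real_affine [where c = \<sigma> and t = 0]) (measurable, simp add: mult.assoc [symmetric])
  also have "\<dots> = (\<integral>\<^sup>+x. \<integral>\<^sup>+y. ennreal (gauss_kernel A B (\<sigma> * \<rho> * S) x y) * indicator {0<..} y * indicator {0<..} x \<partial>lborel \<partial>lborel)"
    unfolding gk [symmetric] using nz
    by (subst nn_integral_real_affine [where c = \<rho> and t = 0]) (measurable, simp add: mult.assoc [symmetric])
  also have "\<dots> = ennreal ((pi / 2 + arctan (\<sigma> * \<rho> * S / sqrt D)) / sqrt D)"
    using \<sigma> D by (intro nn_integral_quadrant_gauss_kernel A B) (auto simp: power_mult_distrib)
  also have "arctan (\<sigma> * \<rho> * S / sqrt D) = \<sigma> * \<rho> * arctan (S / sqrt D)"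
    using \<sigma> by (auto simp: arctan_minus)
  finally show ?thesis .
qed

text \<open>
  With trapezoidal weights, each step of the discretised chain is the normal density times a symmetric
  exponential weight, which is exactly a Mehler kernel of angle \<open>\<theta>\<close> with \<open>sinh (\<theta> / 2) = \<alpha> d / 2\<close>; by the
  semigroup law, the angles of consecutive steps add up.
\<close>

definition trapezoid :: "(real \<Rightarrow> real) \<Rightarrow> real \<Rightarrow> nat \<Rightarrow> real" where
  "trapezoid f t N = (1 - t) / N / 2 * (\<Sum>i<N. f (t + i * ((1 - t) / N)) + f (t + Suc i * ((1 - t) / N)))"

text \<open>The value of the expectation of sgn W(s) sgn W(1) times the energy weight on [t, 1]: on
  a grid with the mesh-dependent \<open>a\<close> and \<Theta>, in the limit with a = \<alpha> and
  \<Theta> = \<alpha> (1 - t). As \<alpha> tends to 0 the latter becomes (2 / pi) arctan (sqrt (s /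
  (1 - s))) = (2 / pi) arcsin (sqrt s), the arcsine law.\<close>

definition sign_value :: "real \<Rightarrow> real \<Rightarrow> real \<Rightarrow> real \<Rightarrow> real" where
  "sign_value s t a \<Theta> = 2 / pi * sqrt (a / sinh \<Theta> / (a * cosh \<Theta> / sinh \<Theta> + a\<^sup>2 * t)) *
     arctan (a / sinh \<Theta> * sqrt (s / ((1 + (t - s) * (a * cosh \<Theta> / sinh \<Theta>)) * (a * cosh \<Theta> / sinh \<Theta> + a\<^sup>2 * t))))"

context std_brownian_motion
begin

lemma nn_integral_mehler_bridge:
  fixes s t a \<Theta> :: real and g h :: "real \<Rightarrow> ennreal"
  assumes st: "0 < s" "s \<le> t" and a: "a > 0" and \<Theta>: "\<Theta> > 0"
    and g [measurable]: "g \<in> borel_measurable borel" and h [measurable]: "h \<in> borel_measurable borel"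
  defines "C \<equiv> a * cosh \<Theta> / sinh \<Theta>" and "S \<equiv> a / sinh \<Theta>" and "E \<equiv> 1 + (t - s) * (a * cosh \<Theta> / sinh \<Theta>)"
  shows "(\<integral>\<^sup>+\<omega>. g (W s \<omega>) * (\<integral>\<^sup>+y. ennreal (mehler a \<Theta> (W t \<omega>) y) * h y \<partial>lborel) \<partial>M)
    = (\<integral>\<^sup>+x. \<integral>\<^sup>+y. ennreal (1 / sqrt (2 * pi * s) * sqrt (S / (2 * pi * E)) *
         gauss_kernel (1 / s + C / E) ((C + (t - s) * a\<^sup>2) / E) (S / E) x y) * h y * g x \<partial>lborel \<partial>lborel)"
proof -
  define k where "k x y = sqrt (S / (2 * pi * E)) * gauss_kernel (C / E) ((C + (t - s) * a\<^sup>2) / E) (S / E) x y" for x y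
  have [measurable (raw)]: "(\<lambda>w. k (f w) (g w)) \<in> borel_measurable N"
    if [measurable]: "f \<in> borel_measurable N" "g \<in> borel_measurable N" for f g and N :: "'c measure"
    unfolding k_def by measurable
  have pos: "S > 0" "C > 0" "E > 0" using a \<Theta> st by (simp_all add: S_def C_def E_def add_pos_nonneg)
  have "(\<integral>\<^sup>+\<omega>. g (W s \<omega>) * (\<integral>\<^sup>+y. ennreal (mehler a \<Theta> (W t \<omega>) y) * h y \<partial>lborel) \<partial>M)
    = (\<integral>\<^sup>+\<omega>. g (W s \<omega>) * (\<integral>\<^sup>+y. ennreal (k (W s \<omega>) y) * h y \<partial>lborel) \<partial>M)"
  \<comment> \<open>For s = t the unweighted stretch is empty and has no transition density; then E
    = 1 and \<open>k\<close> is the Mehler kernel itself.\<close>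
  proof (cases "s = t")
    case True
    then have "k x y = mehler a \<Theta> x y" for x y
      unfolding k_def mehler_def C_def S_def E_def by simp
    then show ?thesis using True by simp
  next
    case False
    then have \<delta>: "t - s > 0" using st by simp
    define \<tau> where "\<tau> i = (if i = 0 then 0 else if i = 1 then s else t)" for i :: nat
    define H where "H x = (\<integral>\<^sup>+y. ennreal (mehler a \<Theta> x y) * h y \<partial>lborel)" for x
    have [measurable]: "H \<in> borel_measurable borel" unfolding H_def by measurable
    have y: "(\<lambda>x. g (\<Sum>i<1. x i)) \<in> borel_measurable (PiM {..<1::nat} (\<lambda>_. borel :: real measure))"
      by measurable
    have gW: "g (\<Sum>i<1. (\<lambda>i\<in>{..<1}. grid_incr \<tau> i \<omega>) i) = g (W s \<omega>)" if "\<omega> \<in> space M" for \<omega>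
      using that start by (simp add: \<tau>_def)
    have "(\<integral>\<^sup>+\<omega>. g (W s \<omega>) * H (W t \<omega>) \<partial>M) = (\<integral>\<^sup>+\<omega>. g (\<Sum>i<1. (\<lambda>i\<in>{..<1}. grid_incr \<tau> i \<omega>) i) * (\<lambda>x z. H z) (W (\<tau> 1) \<omega>) (W (\<tau> (Suc 1)) \<omega>) \<partial>M)"
      by (intro nn_integral_cong) (simp only: gW, simp add: \<tau>_def)
    also have "\<dots> = (\<integral>\<^sup>+\<omega>. g (\<Sum>i<1. (\<lambda>i\<in>{..<1}. grid_incr \<tau> i \<omega>) i) *
        (\<integral>\<^sup>+z. (\<lambda>x z. H z) (W (\<tau> 1) \<omega>) z * ennreal (normal_density 0 (sqrt (\<tau> (Suc 1) - \<tau> 1)) (z - W (\<tau> 1) \<omega>)) \<partial>lborel) \<partial>M)"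
      using st \<delta> y by (intro markov_nn_integral) (auto simp: \<tau>_def mono_on_def)
    also have "\<dots> = (\<integral>\<^sup>+\<omega>. g (W s \<omega>) * (\<integral>\<^sup>+y. ennreal (k (W s \<omega>) y) * h y \<partial>lborel) \<partial>M)"
    proof (rule nn_integral_cong)
      fix \<omega> assume \<omega>: "\<omega> \<in> space M"
      have "(\<integral>\<^sup>+z. H z * ennreal (normal_density 0 (sqrt (t - s)) (z - x)) \<partial>lborel) = (\<integral>\<^sup>+y. ennreal (k x y) * h y \<partial>lborel)" for x
      proof -
        have "(\<integral>\<^sup>+z. H z * ennreal (normal_density 0 (sqrt (t - s)) (z - x)) \<partial>lborel)
          = (\<integral>\<^sup>+z. \<integral>\<^sup>+y. ennreal (mehler a \<Theta> z y) * h y * ennreal (normal_density 0 (sqrt (t - s)) (z - x)) \<partial>lborel \<partial>lborel)"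
          unfolding H_def by (intro nn_integral_cong nn_integral_multc [symmetric]) measurable
        also have "\<dots> = (\<integral>\<^sup>+y. \<integral>\<^sup>+z. ennreal (mehler a \<Theta> z y) * h y * ennreal (normal_density 0 (sqrt (t - s)) (z - x)) \<partial>lborel \<partial>lborel)"
          by (rule lborel_pair.Fubini') measurable
        also have "\<dots> = (\<integral>\<^sup>+y. (\<integral>\<^sup>+z. ennreal (normal_density 0 (sqrt (t - s)) (z - x)) * ennreal (mehler a \<Theta> z y) \<partial>lborel) * h y \<partial>lborel)"
        proof (rule nn_integral_cong)
          fix y
          have "(\<integral>\<^sup>+z. ennreal (normal_density 0 (sqrt (t - s)) (z - x)) * ennreal (mehler a \<Theta> z y) \<partial>lborel) * h y
            = (\<integral>\<^sup>+z. ennreal (normal_density 0 (sqrt (t - s)) (z - x)) * ennreal (mehler a \<Theta> z y) * h y \<partial>lborel)"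
            by (rule nn_integral_multc [symmetric]) measurable
          then show "(\<integral>\<^sup>+z. ennreal (mehler a \<Theta> z y) * h y * ennreal (normal_density 0 (sqrt (t - s)) (z - x)) \<partial>lborel)
            = (\<integral>\<^sup>+z. ennreal (normal_density 0 (sqrt (t - s)) (z - x)) * ennreal (mehler a \<Theta> z y) \<partial>lborel) * h y"
            by (simp only: mult_ac)
        qed
        also have "\<dots> = (\<integral>\<^sup>+y. ennreal (k x y) * h y \<partial>lborel)"
          unfolding normal_density_mehler_compose [OF a \<Theta> \<delta>] k_def C_def S_def E_def ..
        finally show ?thesis .
      qed
      then show "g (\<Sum>i<1. (\<lambda>i\<in>{..<1}. grid_incr \<tau> i \<omega>) i) *
        (\<integral>\<^sup>+z. (\<lambda>x z. H z) (W (\<tau> 1) \<omega>) z * ennreal (normal_density 0 (sqrt (\<tau> (Suc 1) - \<tau> 1)) (z - W (\<tau> 1) \<omega>)) \<partial>lborel)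
        = g (W s \<omega>) * (\<integral>\<^sup>+y. ennreal (k (W s \<omega>) y) * h y \<partial>lborel)"
        by (simp only: gW [OF \<omega>]) (simp add: \<tau>_def)
    qed
    finally show ?thesis unfolding H_def .
  qed
  also have "\<dots> = (\<integral>\<^sup>+x. ennreal (normal_density 0 (sqrt s) x) * (g x * (\<integral>\<^sup>+y. ennreal (k x y) * h y \<partial>lborel)) \<partial>lborel)"
    by (rule nn_integral_W [OF st(1)]) measurable
  also have "\<dots> = (\<integral>\<^sup>+x. \<integral>\<^sup>+y. ennreal (1 / sqrt (2 * pi * s) * sqrt (S / (2 * pi * E)) *
         gauss_kernel (1 / s + C / E) ((C + (t - s) * a\<^sup>2) / E) (S / E) x y) * h y * g x \<partial>lborel \<partial>lborel)"
  proof (rule nn_integral_cong)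
    fix x :: real
    have "- (1 / s * x\<^sup>2) / 2 + (- (C / E * x\<^sup>2 + (C + (t - s) * a\<^sup>2) / E * y\<^sup>2) / 2 + S / E * x * y)
      = - ((1 / s + C / E) * x\<^sup>2 + (C + (t - s) * a\<^sup>2) / E * y\<^sup>2) / 2 + S / E * x * y" for y
      by (simp add: distrib_right add_divide_distrib diff_divide_distrib)
    then have gk: "exp (- (1 / s * x\<^sup>2) / 2) * gauss_kernel (C / E) ((C + (t - s) * a\<^sup>2) / E) (S / E) x y
      = gauss_kernel (1 / s + C / E) ((C + (t - s) * a\<^sup>2) / E) (S / E) x y" for y
      unfolding gauss_kernel_def exp_add [symmetric] by (simp only:)
    have nd: "normal_density 0 (sqrt s) x = 1 / sqrt (2 * pi * s) * exp (- (1 / s * x\<^sup>2) / 2)"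
      using st by (simp add: normal_density_def mult.commute)
    have eq: "ennreal (normal_density 0 (sqrt s) x) * g x * (ennreal (k x y) * h y)
       = ennreal (1 / sqrt (2 * pi * s) * sqrt (S / (2 * pi * E)) *
         gauss_kernel (1 / s + C / E) ((C + (t - s) * a\<^sup>2) / E) (S / E) x y) * h y * g x" for y
    proof -
      have "ennreal (normal_density 0 (sqrt s) x) * ennreal (k x y) = ennreal (1 / sqrt (2 * pi * s) * sqrt (S / (2 * pi * E)) *
         gauss_kernel (1 / s + C / E) ((C + (t - s) * a\<^sup>2) / E) (S / E) x y)"
        unfolding gk [symmetric] nd k_def using st by (subst ennreal_mult' [symmetric]) (simp_all add: mult_ac)
      then show ?thesis by (simp only: mult_ac)
    qed
    have "ennreal (normal_density 0 (sqrt s) x) * (g x * (\<integral>\<^sup>+y. ennreal (k x y) * h y \<partial>lborel))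
      = (\<integral>\<^sup>+y. ennreal (normal_density 0 (sqrt s) x) * g x * (ennreal (k x y) * h y) \<partial>lborel)"
      unfolding mult.assoc [symmetric, where a = "ennreal (normal_density 0 (sqrt s) x)"]
      by (rule nn_integral_cmult [symmetric]) measurable
    then show "ennreal (normal_density 0 (sqrt s) x) * (g x * (\<integral>\<^sup>+y. ennreal (k x y) * h y \<partial>lborel))
      = (\<integral>\<^sup>+y. ennreal (1 / sqrt (2 * pi * s) * sqrt (S / (2 * pi * E)) *
         gauss_kernel (1 / s + C / E) ((C + (t - s) * a\<^sup>2) / E) (S / E) x y) * h y * g x \<partial>lborel)"
      unfolding eq .
  qed
  finally show ?thesis .
qed

lemma measurable_trapezoid:
  assumes "0 \<le> t" "t \<le> 1"
  shows "(\<lambda>\<omega>. trapezoid (\<lambda>u. (W u \<omega>)\<^sup>2) t N) \<in> borel_measurable M"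
proof -
  have [measurable]: "W (t + real i * ((1 - t) / real N)) \<in> borel_measurable M" for i
    using assms by (intro measurable_at) simp
  show ?thesis unfolding trapezoid_def by measurable
qed

text \<open>Splitting by the signs of W(s) and W(1) gives four quadrant integrals of one Gaussian
  kernel. Quadrants of equal signs carry pi / 2 plus the arctangent, the others pi / 2 minus it;
  with the signs of the product the constants cancel and four arctangents remain.\<close>

lemma expectation_sign_trapezoid:
  fixes s t \<alpha> d \<theta> :: real and N :: nat
  assumes st: "0 < s" "s \<le> t" "t < 1" and \<alpha>: "\<alpha> > 0" and N: "N \<ge> 1"
  defines "d \<equiv> (1 - t) / N"
  defines "\<theta> \<equiv> 2 * arsinh (\<alpha> * d / 2)"
  shows "expectation (\<lambda>\<omega>. sgn (W s \<omega>) * sgn (W 1 \<omega>) * exp (- (\<alpha>\<^sup>2 / 2) * trapezoid (\<lambda>u. (W u \<omega>)\<^sup>2) t N))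
    = sign_value s t (sinh \<theta> / d) (N * \<theta>)"
proof -
  define a where "a = sinh \<theta> / d"
  define \<Theta> where "\<Theta> = N * \<theta>"
  define C where "C = a * cosh \<Theta> / sinh \<Theta>"
  define S where "S = a / sinh \<Theta>"
  define E where "E = 1 + (t - s) * C"
  define D where "D = (C + a\<^sup>2 * t) / (s * E)"
  define \<Psi> where "\<Psi> \<omega> = exp (- (\<alpha>\<^sup>2 / 2) * trapezoid (\<lambda>u. (W u \<omega>)\<^sup>2) t N)" for \<omega>
  have d: "d > 0" using st N by (simp add: d_def)
  have \<theta>: "\<theta> > 0" unfolding \<theta>_def by (rule mehler_step(1) [OF \<alpha> d])
  have a: "a > 0" using \<theta> d by (simp add: a_def)
  have \<Theta>: "\<Theta> > 0" using \<theta> N by (simp add: \<Theta>_def)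
  have sh: "sinh \<Theta> > 0" using \<Theta> by simp
  have pos: "C > 0" "S > 0" "E > 0"
    using a sh st by (simp_all add: C_def S_def E_def add_pos_nonneg)
  have CS: "C\<^sup>2 = S\<^sup>2 + a\<^sup>2"
    using sh by (simp add: C_def S_def power_divide power_mult_distrib cosh_square_eq field_simps)
  have Cat: "C + a\<^sup>2 * t > 0" using pos a st by (simp add: add_pos_pos)
  have D: "D > 0" using Cat pos st by (simp add: D_def)
  \<comment> \<open>The determinant of the quadratic form in (W(s), W(1)). The relation C^2 = S^2 +
    a^2 makes its numerator divisible by E, which produces the short form of
    \<open>D\<close>.\<close>
  have D_eq: "D = (1 / s + C / E) * ((C + (t - s) * a\<^sup>2) / E) - (S / E)\<^sup>2"
  proof -
    have "(1 / s + C / E) * ((C + (t - s) * a\<^sup>2) / E) - (S / E)\<^sup>2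
      = ((E + s * C) * (C + (t - s) * a\<^sup>2) - s * S\<^sup>2) / (s * E\<^sup>2)"
      using pos st by (simp add: power2_eq_square field_simps)
    also have "(E + s * C) * (C + (t - s) * a\<^sup>2) - s * S\<^sup>2 = E * (C + a\<^sup>2 * t)"
      using CS unfolding E_def by algebra
    finally show ?thesis using pos st by (simp add: D_def power2_eq_square)
  qed
  have tm: "(\<lambda>\<omega>. trapezoid (\<lambda>u. (W u \<omega>)\<^sup>2) t N) \<in> borel_measurable M"
    using st by (intro measurable_trapezoid) auto
  have \<Psi>m [measurable]: "\<Psi> \<in> borel_measurable M"
    unfolding \<Psi>_def using tm by measurable
  have [measurable]: "W s \<in> borel_measurable M" "W 1 \<in> borel_measurable M"
    using st by (auto intro: measurable_at)
  have \<Psi>01: "0 \<le> \<Psi> \<omega>" "\<Psi> \<omega> \<le> 1" for \<omega>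
  proof -
    have "0 \<le> trapezoid (\<lambda>u. (W u \<omega>)\<^sup>2) t N"
      unfolding trapezoid_def using st by (intro mult_nonneg_nonneg sum_nonneg) auto
    then show "0 \<le> \<Psi> \<omega>" "\<Psi> \<omega> \<le> 1" by (simp_all add: \<Psi>_def)
  qed
  define \<tau> where "\<tau> i = (if i = 0 then 0 else if i = 1 then s else t + real (i - 2) * d)" for i :: nat
  have \<tau>: "\<tau> 0 = 0" "\<tau> 1 = s" "\<tau> 2 = t" "\<And>i. \<tau> (i + 2) = t + real i * d"
    "\<And>i. \<tau> (Suc (i + 2)) = t + real (Suc i) * d"
    by (simp_all add: \<tau>_def)
  have \<tau>N: "\<tau> (N + 2) = 1" unfolding \<tau>(4) using N by (simp add: d_def)
  have mono: "mono_on {..N + 2} \<tau>"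
  proof (rule mono_onI)
    fix i j :: nat assume ij: "i \<le> j"
    have "real (i - 2) * d \<le> real (j - 2) * d" using ij d by (intro mult_right_mono) auto
    moreover have "0 \<le> real (j - 2) * d" using d by simp
    ultimately show "\<tau> i \<le> \<tau> j" using ij st unfolding \<tau>_def by auto
  qed
  have \<Psi>_prod: "ennreal (\<Psi> \<omega>) = (\<Prod>i<N. ennreal (exp (- \<alpha>\<^sup>2 * d / 4 * ((W (\<tau> (i + 2)) \<omega>)\<^sup>2 + (W (\<tau> (Suc (i + 2))) \<omega>)\<^sup>2))))" for \<omega>
  proof -
    have "- (\<alpha>\<^sup>2 / 2) * trapezoid (\<lambda>u. (W u \<omega>)\<^sup>2) t N = (\<Sum>i<N. - \<alpha>\<^sup>2 * d / 4 * ((W (\<tau> (i + 2)) \<omega>)\<^sup>2 + (W (\<tau> (Suc (i + 2))) \<omega>)\<^sup>2))"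
      unfolding trapezoid_def \<tau> d_def [symmetric] sum_distrib_left by (intro sum.cong) simp_all
    then have "\<Psi> \<omega> = (\<Prod>i<N. exp (- \<alpha>\<^sup>2 * d / 4 * ((W (\<tau> (i + 2)) \<omega>)\<^sup>2 + (W (\<tau> (Suc (i + 2))) \<omega>)\<^sup>2)))"
      unfolding \<Psi>_def by (simp only: exp_sum finite_lessThan)
    then show ?thesis by (simp only: prod_ennreal exp_ge_zero)
  qed
  define c where "c = 1 / sqrt (2 * pi * s) * sqrt (S / (2 * pi * E))"
  have c: "c \<ge> 0" using st pos by (simp add: c_def)
  have quad: "expectation (\<lambda>\<omega>. indicator {0<..} (\<sigma> * W s \<omega>) * indicator {0<..} (\<rho> * W 1 \<omega>) * \<Psi> \<omega>)
     = c * ((pi / 2 + \<sigma> * \<rho> * arctan (S / E / sqrt D)) / sqrt D)"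
    if \<sigma>: "\<sigma> \<in> {1, - 1}" "\<rho> \<in> {1, - 1::real}" for \<sigma> \<rho>
  proof -
    define g where "g x = (indicator {0<..} (\<sigma> * x) :: ennreal)" for x
    define h where "h x = (indicator {0<..} (\<rho> * x) :: ennreal)" for x
    have [measurable]: "g \<in> borel_measurable borel" "h \<in> borel_measurable borel"
      unfolding g_def h_def by measurable
    have at: "\<bar>\<sigma> * \<rho> * arctan (S / E / sqrt D)\<bar> \<le> pi / 2"
      using \<sigma> arctan_bounded [of "S / E / sqrt D"] by (auto simp: abs_le_iff)
    have "(\<integral>\<^sup>+\<omega>. ennreal (indicator {0<..} (\<sigma> * W s \<omega>) * indicator {0<..} (\<rho> * W 1 \<omega>) * \<Psi> \<omega>) \<partial>M)
      = (\<integral>\<^sup>+\<omega>. g (W (\<tau> 1) \<omega>) *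
      (\<Prod>i<N. ennreal (exp (- \<alpha>\<^sup>2 * d / 4 * ((W (\<tau> (i + 2)) \<omega>)\<^sup>2 + (W (\<tau> (Suc (i + 2))) \<omega>)\<^sup>2)))) *
      h (W (\<tau> (N + 2)) \<omega>) \<partial>M)"
      unfolding \<Psi>_prod [symmetric] \<tau>N \<tau>(2) g_def h_def
      by (intro nn_integral_cong) (simp add: indicator_def)
    also have "\<dots> = (\<integral>\<^sup>+\<omega>. g (W (\<tau> 1) \<omega>) * (\<integral>\<^sup>+y. ennreal (mehler (sinh \<theta> / d) (real N * \<theta>) (W (\<tau> 2) \<omega>) y) * h y \<partial>lborel) \<partial>M)"
      unfolding \<theta>_def
    proof (rule nn_integral_kernel_chain [OF \<tau>(1) mono d _ \<alpha> N order.refl])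
      show "\<tau> (Suc (i + 2)) - \<tau> (i + 2) = d" for i
        unfolding \<tau> by (simp add: distrib_right)
    qed measurable
    also have "\<dots> = (\<integral>\<^sup>+\<omega>. g (W s \<omega>) * (\<integral>\<^sup>+y. ennreal (mehler a \<Theta> (W t \<omega>) y) * h y \<partial>lborel) \<partial>M)"
      unfolding \<tau> a_def \<Theta>_def ..
    also have "\<dots> = (\<integral>\<^sup>+x. \<integral>\<^sup>+y. ennreal (c *
         gauss_kernel (1 / s + C / E) ((C + (t - s) * a\<^sup>2) / E) (S / E) x y) * h y * g x \<partial>lborel \<partial>lborel)"
      unfolding c_def E_def C_def S_def by (rule nn_integral_mehler_bridge) (use st a \<Theta> in auto)
    also have "\<dots> = (\<integral>\<^sup>+x. ennreal c * (\<integral>\<^sup>+y. ennreal (gauss_kernel (1 / s + C / E) ((C + (t - s) * a\<^sup>2) / E) (S / E) x y) * h y * g x \<partial>lborel) \<partial>lborel)"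
      by (subst nn_integral_cmult [symmetric]) (measurable, simp add: ennreal_mult' [OF c] mult.assoc)
    also have "\<dots> = ennreal c * (\<integral>\<^sup>+x. \<integral>\<^sup>+y. ennreal (gauss_kernel (1 / s + C / E) ((C + (t - s) * a\<^sup>2) / E) (S / E) x y) * h y * g x \<partial>lborel \<partial>lborel)"
      by (rule nn_integral_cmult) measurable
    also have "\<dots> = ennreal c * ennreal ((pi / 2 + \<sigma> * \<rho> * arctan (S / E / sqrt D)) / sqrt D)"
      unfolding g_def h_def
      by (subst nn_integral_signed_quadrant_gauss_kernel [OF _ _ D_eq D \<sigma>])
        (use pos a st in \<open>simp_all add: add_pos_pos add_pos_nonneg\<close>)
    also have "\<dots> = ennreal (c * ((pi / 2 + \<sigma> * \<rho> * arctan (S / E / sqrt D)) / sqrt D))"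
      by (rule ennreal_mult' [OF c, symmetric])
    finally have "(\<integral>\<^sup>+\<omega>. ennreal (indicator {0<..} (\<sigma> * W s \<omega>) * indicator {0<..} (\<rho> * W 1 \<omega>) * \<Psi> \<omega>) \<partial>M)
      = ennreal (c * ((pi / 2 + \<sigma> * \<rho> * arctan (S / E / sqrt D)) / sqrt D))" .
    then show ?thesis
      using at c D \<Psi>01 by (subst integral_eq_nn_integral) (auto simp: enn2real_ennreal abs_le_iff)
  qed
  let ?q = "\<lambda>\<sigma> \<rho> \<omega>. indicator {0<..} (\<sigma> * W s \<omega>) * indicator {0<..} (\<rho> * W 1 \<omega>) * \<Psi> \<omega> :: real"
  have int: "integrable M (?q \<sigma> \<rho>)" for \<sigma> \<rho>
    using \<Psi>01 by (intro integrable_const_bound [of _ 1] AE_I2) (auto simp: indicator_def)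
  have "expectation (\<lambda>\<omega>. sgn (W s \<omega>) * sgn (W 1 \<omega>) * \<Psi> \<omega>)
    = expectation (\<lambda>\<omega>. (?q 1 1 \<omega> + ?q (-1) (-1) \<omega>) - (?q 1 (-1) \<omega> + ?q (-1) 1 \<omega>))"
    by (intro Bochner_Integration.integral_cong refl) (simp add: sgn_if indicator_def)
  also have "\<dots> = (expectation (?q 1 1) + expectation (?q (-1) (-1))) - (expectation (?q 1 (-1)) + expectation (?q (-1) 1))"
    using int by (simp only: Bochner_Integration.integral_diff Bochner_Integration.integral_add Bochner_Integration.integrable_add)
  also have "\<dots> = 4 * c / sqrt D * arctan (S / E / sqrt D)"
    by (subst (1 2 3 4) quad) (simp_all add: algebra_simps add_divide_distrib diff_divide_distrib)
  also have "4 * c / sqrt D = 2 / pi * sqrt (S / (C + a\<^sup>2 * t))"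
  proof -
    have "c / sqrt D = sqrt (1 / (2 * pi * s) * (S / (2 * pi * E)) / D)"
      unfolding c_def by (simp add: real_sqrt_mult real_sqrt_divide)
    also have "1 / (2 * pi * s) * (S / (2 * pi * E)) / D = (1 / (2 * pi))\<^sup>2 * (S / (C + a\<^sup>2 * t))"
      using st pos Cat by (simp add: D_def power2_eq_square field_simps)
    also have "sqrt \<dots> = 1 / (2 * pi) * sqrt (S / (C + a\<^sup>2 * t))"
      by (simp only: real_sqrt_mult real_sqrt_abs) simp
    finally show ?thesis by simp
  qed
  also have "S / E / sqrt D = S * sqrt (s / (E * (C + a\<^sup>2 * t)))"
  proof -
    have "1 / E / sqrt D = sqrt ((1 / E)\<^sup>2 / D)"
      using pos by (simp add: real_sqrt_divide)
    also have "(1 / E)\<^sup>2 / D = s / (E * (C + a\<^sup>2 * t))"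
      using st pos Cat by (simp add: D_def power2_eq_square field_simps)
    finally have "S * (1 / E / sqrt D) = S * sqrt (s / (E * (C + a\<^sup>2 * t)))"
      by (rule arg_cong)
    then show ?thesis by (simp only: times_divide_eq_right mult_1_right)
  qed
  finally show ?thesis
    unfolding \<Psi>_def sign_value_def a_def [symmetric] \<Theta>_def [symmetric] C_def [symmetric] S_def [symmetric] E_def [symmetric] .
qed

end

text \<open>The summands to come compare both ends of a cell, so the integrand depends on two
  neighbouring nodes. Uniform continuity on the compact triangle x \<le> y brings each summand close
  to the integral of the diagonal values over its cell.\<close>

lemma riemann_sum_diagonal:
  fixes L :: "real \<Rightarrow> real \<Rightarrow> real"
  assumes ab: "a < b"
    and cont: "continuous_on {p \<in> {a..b} \<times> {a..b}. fst p \<le> snd p} (\<lambda>p. L (fst p) (snd p))"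
  shows "(\<lambda>N. \<Sum>k<N. (b - a) / real N * L (a + real k * ((b - a) / real N)) (a + real (Suc k) * ((b - a) / real N)))
    \<longlonglongrightarrow> integral {a..b} (\<lambda>r. L r r)"
proof -
  let ?S = "{p \<in> {a..b} \<times> {a..b}. fst p \<le> snd p}"
  let ?x = "\<lambda>N k. a + real k * ((b - a) / real N)"
  have "compact ?S"
  proof -
    have "?S = ({a..b} \<times> {a..b}) \<inter> {p. fst p \<le> snd p}" by auto
    moreover have "closed {p::real \<times> real. fst p \<le> snd p}"
      by (intro closed_Collect_le continuous_intros)
    ultimately show ?thesis by (simp add: compact_Int_closed compact_Times)
  qed
  then have uc: "uniformly_continuous_on ?S (\<lambda>p. L (fst p) (snd p))"
    using cont by (rule compact_uniformly_continuous [rotated])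
  have contD: "continuous_on {a..b} (\<lambda>r. L r r)"
  proof -
    have 1: "continuous_on {a..b} (\<lambda>r. (r, r))" by (intro continuous_intros)
    have 2: "(\<lambda>r. (r, r)) ` {a..b} \<subseteq> ?S" by auto
    show ?thesis using continuous_on_compose2 [OF cont 1 2] by simp
  qed
  show ?thesis
  proof (rule metric_LIMSEQ_I)
    fix e :: real assume "e > 0"
    define e' where "e' = e / (2 * (b - a))"
    have e': "e' > 0" using \<open>e > 0\<close> ab by (simp add: e'_def)
    obtain d where d: "d > 0" "\<And>p q. p \<in> ?S \<Longrightarrow> q \<in> ?S \<Longrightarrow> dist q p < d \<Longrightarrow> dist (L (fst q) (snd q)) (L (fst p) (snd p)) < e'"
      using uc e' unfolding uniformly_continuous_on_def by blast
    \<comment> \<open>The factor 2: the corner (u, v) of a cell of length h is at distance at most 2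
      h from any diagonal point (r, r) with r in the cell.\<close>
    obtain N0 :: nat where N0: "2 * (b - a) / d < real N0" "N0 > 0"
      using reals_Archimedean2 [of "max 1 (2 * (b - a) / d)"] by (metis max_less_iff_conj of_nat_0_less_iff zero_less_one less_trans)
    show "\<exists>N0. \<forall>N\<ge>N0. dist (\<Sum>k<N. (b - a) / real N * L (?x N k) (?x N (Suc k))) (integral {a..b} (\<lambda>r. L r r)) < e"
    proof (intro exI [of _ N0] allI impI)
      fix N assume "N \<ge> N0"
      then have N: "N > 0" "2 * (b - a) / d < real N" using N0 by auto
      define h where "h = (b - a) / real N"
      have h: "h > 0" "2 * h < d" using N ab d(1) by (simp_all add: h_def field_simps)
      have xS: "?x N (Suc k) = ?x N k + h" for k by (simp add: h_def distrib_right add_divide_distrib)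
      have x_range: "a \<le> ?x N k" "k \<le> N \<Longrightarrow> ?x N k \<le> b" for k
      proof -
        show "a \<le> ?x N k" unfolding h_def [symmetric] using h(1) by simp
        assume "k \<le> N"
        then have "real k * h \<le> real N * h" using h(1) by (intro mult_right_mono) auto
        then show "?x N k \<le> b" using N by (simp add: h_def)
      qed
      have "\<bar>(\<Sum>k<m. h * L (?x N k) (?x N (Suc k))) - integral {a..?x N m} (\<lambda>r. L r r)\<bar> \<le> e' * (real m * h)" if "m \<le> N" for m
        using that
      proof (induction m)
        case (Suc m)
        define u where "u = ?x N m"
        define v where "v = ?x N (Suc m)"
        have xS: "v = u + h" using xS [of m] by (simp only: u_def v_def)
        have uv: "a \<le> u" "u \<le> v" "v \<le> b"
          using x_range(1) [of m] x_range(2) [of "Suc m"] Suc.prems h(1) xS by (simp_all only: u_def [symmetric] v_def [symmetric])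
        have IH: "\<bar>(\<Sum>k<m. h * L (?x N k) (?x N (Suc k))) - integral {a..u} (\<lambda>r. L r r)\<bar> \<le> e' * (real m * h)"
          unfolding u_def using Suc.prems by (intro Suc.IH) simp
        have int: "integral {a..u} (\<lambda>r. L r r) + integral {u..v} (\<lambda>r. L r r) = integral {a..v} (\<lambda>r. L r r)"
          using uv by (intro Henstock_Kurzweil_Integration.integral_combine integrable_continuous_real continuous_on_subset [OF contD]) auto
        have cu: "continuous_on {u..v} (\<lambda>r. L r r)"
          using uv by (intro continuous_on_subset [OF contD]) auto
        have "integral {u..v} (\<lambda>r. L u v - L r r) = integral {u..v} (\<lambda>_. L u v) - integral {u..v} (\<lambda>r. L r r)"
          using cu by (intro Henstock_Kurzweil_Integration.integral_diff integrable_continuous_real) auto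
        also have "integral {u..v} (\<lambda>_. L u v) = h * L u v"
          using uv(2) by (simp add: xS)
        finally have eq: "h * L u v - integral {u..v} (\<lambda>r. L r r) = integral {u..v} (\<lambda>r. L u v - L r r)" by simp
        have "norm (integral {u..v} (\<lambda>r. L u v - L r r)) \<le> e' * (v - u)"
        proof (rule integral_bound [OF uv(2)])
          show "continuous_on {u..v} (\<lambda>r. L u v - L r r)" by (intro continuous_intros cu)
          fix r assume r: "r \<in> {u..v}"
          show "norm (L u v - L r r) \<le> e'"
          proof -
            have "dist (u, v) (r, r) \<le> dist u r + dist v r"
              unfolding dist_Pair_Pair using sqrt_sum_squares_le_sum [of "dist u r" "dist v r"] by simp
            also have "\<dots> \<le> h + h" using r unfolding xS by (intro add_mono) (auto simp: dist_real_def)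
            finally have "dist (u, v) (r, r) < d" using h by simp
            then have "dist (L u v) (L r r) < e'"
              using d(2) [of "(r, r)" "(u, v)"] r uv by simp
            then show "norm (L u v - L r r) \<le> e'" by (simp add: dist_real_def)
          qed
        qed
        then have "\<bar>h * L u v - integral {u..v} (\<lambda>r. L r r)\<bar> \<le> e' * h"
          unfolding eq real_norm_def using xS by simp
        then have "\<bar>((\<Sum>k<m. h * L (?x N k) (?x N (Suc k))) + h * L u v) - integral {a..v} (\<lambda>r. L r r)\<bar> \<le> e' * (real m * h) + e' * h"
          unfolding int [symmetric] using IH by linarith
        then show ?case
          unfolding sum.lessThan_Suc u_def v_def by (simp add: distrib_right distrib_left)
      qed simp
      from this [of N] have "\<bar>(\<Sum>k<N. h * L (?x N k) (?x N (Suc k))) - integral {a..b} (\<lambda>r. L r r)\<bar> \<le> e' * (b - a)"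
        using N by (simp add: h_def)
      also have "e' * (b - a) = e / 2"
      proof -
        have "e / (2 * x) * x = e / 2" if "x > 0" for x using that by simp
        then show ?thesis using ab unfolding e'_def by (metis diff_gt_0_iff_gt)
      qed
      also have "\<dots> < e" using \<open>e > 0\<close> by simp
      finally show "dist (\<Sum>k<N. (b - a) / real N * L (?x N k) (?x N (Suc k))) (integral {a..b} (\<lambda>r. L r r)) < e"
        by (simp add: dist_real_def h_def)
    qed
  qed
qed

section \<open>Reflection after the first sign change on a grid\<close>

text \<open>Reflection is in the level \<open>p k\<close>, not in 0. This keeps the law of a
  symmetric walk exactly, since only increments after \<open>k\<close> change sign, and it reverses
  the final sign and preserves the squares only up to an error governed by \<open>p k\<close>, which
  is small at a sign change.\<close>

definition reflect_after :: "nat \<Rightarrow> (nat \<Rightarrow> real) \<Rightarrow> nat \<Rightarrow> real" where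
  "reflect_after k p j = (if j \<le> k then p j else 2 * p k - p j)"

text \<open>Signs are compared with \<open>p 1\<close> because index 0 carries the starting value 0
  of the path. A path with \<open>p 1\<close> = 0 changes sign at k = 1 by this convention.\<close>

definition first_sign_change :: "nat \<Rightarrow> (nat \<Rightarrow> real) \<Rightarrow> bool" where
  "first_sign_change k p \<longleftrightarrow> (\<forall>j\<in>{1..<k}. p 1 * p j > 0) \<and> p 1 * p k \<le> 0"

definition same_sign :: "nat \<Rightarrow> (nat \<Rightarrow> real) \<Rightarrow> bool" where
  "same_sign n p \<longleftrightarrow> (\<forall>j\<in>{1..n}. p 1 * p j > 0)"

text \<open>For c = \<alpha>^2 / 4 times the mesh this is exp (- \<alpha>^2 / 2 times the
  trapezoidal sum); \<open>b\<close> is the index at which the weighted stretch begins.\<close>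

definition energy_weight :: "real \<Rightarrow> nat \<Rightarrow> nat \<Rightarrow> (nat \<Rightarrow> real) \<Rightarrow> real" where
  "energy_weight c b m p = exp (- (c * (\<Sum>i<m. (p (b + i))\<^sup>2 + (p (b + Suc i))\<^sup>2)))"

lemma energy_weight_bounds:
  assumes "c \<ge> 0"
  shows "0 \<le> energy_weight c b m p" "energy_weight c b m p \<le> 1"
  using assms by (simp_all add: energy_weight_def sum_nonneg)

definition crossing_term :: "real \<Rightarrow> nat \<Rightarrow> nat \<Rightarrow> nat \<Rightarrow> nat \<Rightarrow> (nat \<Rightarrow> real) \<Rightarrow> real" where
  "crossing_term c b m n k p = of_bool (first_sign_change k p) * (sgn (p 1) * sgn (p n) * energy_weight c b m p)"

lemma first_sign_change_unique:
  assumes "first_sign_change k p" "first_sign_change l p" "1 \<le> k" "1 \<le> l"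
  shows "k = l"
  using assms unfolding first_sign_change_def by (metis atLeastLessThan_iff linorder_neqE_nat not_less)

text \<open>A path either keeps the sign of \<open>p 1\<close> throughout, and then the product of
  signs is 1, or it has exactly one first sign change, and then exactly one crossing term is nonzero
  or the whole product vanishes.\<close>

lemma sign_decomposition:
  assumes "1 \<le> n"
  shows "sgn (p 1) * sgn (p n) * energy_weight c b m p
    = of_bool (same_sign n p) * energy_weight c b m p + (\<Sum>k=1..n. crossing_term c b m n k p)"
proof (cases "same_sign n p")
  case True
  then have "p 1 * p n > 0" using assms by (simp add: same_sign_def)
  then have "sgn (p 1) * sgn (p n) = 1" by (simp add: sgn_mult [symmetric])
  moreover have "crossing_term c b m n k p = 0" if "k \<in> {1..n}" for k
  proof -
    have "p 1 * p k > 0" using True that by (simp add: same_sign_def)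
    then show ?thesis by (simp add: crossing_term_def first_sign_change_def)
  qed
  ultimately show ?thesis using True by simp
next
  case False
  then obtain k where "k \<in> {1..n} \<and> p 1 * p k \<le> 0" by (auto simp: same_sign_def not_less)
  define l where "l = (LEAST k. k \<in> {1..n} \<and> p 1 * p k \<le> 0)"
  have l: "l \<in> {1..n}" "p 1 * p l \<le> 0"
    using LeastI [of "\<lambda>k. k \<in> {1..n} \<and> p 1 * p k \<le> 0" k] \<open>k \<in> {1..n} \<and> p 1 * p k \<le> 0\<close> by (auto simp: l_def)
  have "p 1 * p j > 0" if "j \<in> {1..<l}" for j
    using not_less_Least [of j "\<lambda>k. k \<in> {1..n} \<and> p 1 * p k \<le> 0"] that l(1) unfolding l_def [symmetric] by auto
  then have fl: "first_sign_change l p" using l by (simp add: first_sign_change_def)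
  have "(\<Sum>k=1..n. crossing_term c b m n k p) = (\<Sum>k=1..n. if k = l then sgn (p 1) * sgn (p n) * energy_weight c b m p else 0)"
    using fl l by (intro sum.cong refl) (auto simp: crossing_term_def dest: first_sign_change_unique [OF fl])
  then show ?thesis using False l by simp
qed

text \<open>The neighbours of a sign change have opposite signs or a zero, so |p k| is at most the
  step size \<epsilon>. As |p n| exceeds 2 \<epsilon>, the reflected end point 2 p k - p n has the
  opposite sign, and the two terms cancel up to the change of the weight. A square changes by 4 p k
  (p j - p k), at most 8 \<epsilon> K; each of the \<open>m\<close> summands contains two squares,
  which gives 16, and exp (- x) is 1-Lipschitz for x \<ge> 0.\<close>

lemma crossing_term_reflect_bound:
  assumes \<epsilon>: "\<epsilon> \<ge> 0" and c: "c \<ge> 0" and n: "n = b + m" and k: "k \<in> {1..n}"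
    and bound: "\<And>j. j \<le> n \<Longrightarrow> \<bar>p j\<bar> \<le> K"
    and step: "\<And>j. 1 \<le> j \<Longrightarrow> j < n \<Longrightarrow> \<bar>p (Suc j) - p j\<bar> \<le> \<epsilon>"
    and last: "\<bar>p n\<bar> > 2 * \<epsilon>"
  shows "\<bar>crossing_term c b m n k p + crossing_term c b m n k (reflect_after k p)\<bar>
    \<le> of_bool (first_sign_change k p) * (16 * c * real m * \<epsilon> * K)"
proof (cases "first_sign_change k p \<and> p 1 \<noteq> 0")
  case False
  then show ?thesis
  proof (cases "first_sign_change k p")
    case True
    then have "p 1 = 0" using False by simp
    have "0 \<le> K" using bound [of 0] by simp
    then show ?thesis using \<open>p 1 = 0\<close> k \<epsilon> c by (simp add: crossing_term_def reflect_after_def)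
  next
    case False
    then have "\<not> first_sign_change k (reflect_after k p)"
      using k by (auto simp: first_sign_change_def reflect_after_def)
    then show ?thesis using False by (simp add: crossing_term_def)
  qed
next
  case True
  let ?q = "reflect_after k p"
  have fs: "first_sign_change k p" and p1: "p 1 \<noteq> 0" using True by auto
  have k1: "k \<noteq> 1"
  proof
    assume "k = 1"
    then have "p 1 * p 1 \<le> 0" using fs by (simp add: first_sign_change_def)
    then show False using p1 by (metis mult_pos_pos mult_neg_neg linorder_neqE_linordered_idom not_less)
  qed
  then obtain l where l: "k = Suc l" "1 \<le> l" using k by (cases k) auto
  have "p 1 * p l > 0" "p 1 * p k \<le> 0"
    using fs l by (auto simp: first_sign_change_def)
  then have "p l > 0 \<and> p k \<le> 0 \<or> p l < 0 \<and> p k \<ge> 0"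
    by (auto simp: zero_less_mult_iff mult_le_0_iff)
  moreover have "\<bar>p k - p l\<bar> \<le> \<epsilon>" using step [of l] l k by simp
  ultimately have pk: "\<bar>p k\<bar> \<le> \<epsilon>" by auto
  have "k \<noteq> n" using pk last \<epsilon> by auto
  then have "k < n" using k by simp
  then have qn: "?q n = 2 * p k - p n" by (simp add: reflect_after_def)
  have sq: "sgn (?q n) = - sgn (p n)"
    using pk last unfolding qn by (auto simp: sgn_if abs_if split: if_splits)
  have q1: "?q 1 = p 1" using k by (simp add: reflect_after_def)
  have fq: "first_sign_change k ?q"
    using fs k by (auto simp: first_sign_change_def reflect_after_def)
  have K: "0 \<le> K" using bound [of 0] by simp
  have diff: "\<bar>(p j)\<^sup>2 - (?q j)\<^sup>2\<bar> \<le> 8 * \<epsilon> * K" if "j \<le> n" for j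
  proof (cases "j \<le> k")
    case False
    have "(p j)\<^sup>2 - (?q j)\<^sup>2 = 4 * (p k * (p j - p k))"
      using False by (simp add: reflect_after_def power2_eq_square algebra_simps)
    moreover have "\<bar>p k\<bar> * \<bar>p j - p k\<bar> \<le> \<epsilon> * (2 * K)"
      using pk bound [OF that] bound [of k] k \<epsilon> by (intro mult_mono) auto
    moreover have "\<bar>4 * (p k * (p j - p k))\<bar> = 4 * (\<bar>p k\<bar> * \<bar>p j - p k\<bar>)"
      by (simp only: abs_mult)
    ultimately show ?thesis by linarith
  qed (use \<epsilon> K in \<open>simp add: reflect_after_def\<close>)
  let ?Q = "\<lambda>p. c * (\<Sum>i<m. (p (b + i))\<^sup>2 + (p (b + Suc i))\<^sup>2)"
  have Q0: "0 \<le> ?Q p" for p :: "nat \<Rightarrow> real" using c by (intro mult_nonneg_nonneg sum_nonneg) auto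
  have Lip: "\<bar>exp (- x) - exp (- y)\<bar> \<le> \<bar>x - y\<bar>" if "0 \<le> x" "0 \<le> y" for x y :: real
  proof -
    have *: "exp (- u) - exp (- v) \<le> v - u" if "0 \<le> u" "u \<le> v" for u v :: real
    proof -
      have "exp (- u) - exp (- v) = exp (- u) * (1 - exp (- (v - u)))"
        by (simp add: right_diff_distrib exp_add [symmetric])
      also have "\<dots> \<le> 1 * (v - u)"
      proof (rule mult_mono)
        show "1 - exp (- (v - u)) \<le> v - u"
          using exp_ge_add_one_self [of "- (v - u)"] by linarith
      qed (use that in auto)
      finally show ?thesis by simp
    qed
    show ?thesis
      using *[of x y] *[of y x] that by (cases "x \<le> y") (auto simp: abs_if)
  qed
  have "\<bar>?Q p - ?Q ?q\<bar> = c * \<bar>\<Sum>i<m. ((p (b + i))\<^sup>2 - (?q (b + i))\<^sup>2) + ((p (b + Suc i))\<^sup>2 - (?q (b + Suc i))\<^sup>2)\<bar>"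
    using c by (simp add: right_diff_distrib [symmetric] sum_subtractf [symmetric] abs_mult algebra_simps del: sum.op_ivl_Suc)
  also have "\<dots> \<le> c * (\<Sum>i<m. 16 * \<epsilon> * K)"
  proof (intro mult_left_mono order_trans [OF sum_abs] sum_mono c)
    fix i assume "i \<in> {..<m}"
    then show "\<bar>((p (b + i))\<^sup>2 - (?q (b + i))\<^sup>2) + ((p (b + Suc i))\<^sup>2 - (?q (b + Suc i))\<^sup>2)\<bar> \<le> 16 * \<epsilon> * K"
      using diff [of "b + i"] diff [of "b + Suc i"] n by (intro order_trans [OF abs_triangle_ineq]) auto
  qed
  finally have Qd: "\<bar>?Q p - ?Q ?q\<bar> \<le> 16 * c * real m * \<epsilon> * K" by (simp add: mult_ac)
  have "crossing_term c b m n k p + crossing_term c b m n k ?q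
    = sgn (p 1) * sgn (p n) * (energy_weight c b m p - energy_weight c b m ?q)"
    unfolding crossing_term_def sq q1 using fs fq by (simp add: algebra_simps)
  then have "\<bar>crossing_term c b m n k p + crossing_term c b m n k ?q\<bar> \<le> \<bar>energy_weight c b m p - energy_weight c b m ?q\<bar>"
    by (simp add: abs_mult abs_sgn_eq)
  also have "\<dots> \<le> \<bar>?Q p - ?Q ?q\<bar>"
    unfolding energy_weight_def by (rule Lip [OF Q0 Q0])
  finally show ?thesis using Qd fs by simp
qed

context std_brownian_motion
begin

text \<open>Grids are only weakly increasing, as grid points coincide when s = t; at a repeated
  point the increment is identically 0 and has no density, but it is still symmetric.\<close>

lemma distr_neg_grid_incr:
  assumes \<tau>: "\<tau> 0 = 0" "mono_on {..n} \<tau>" "i < n"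
  shows "distr M borel (\<lambda>\<omega>. - grid_incr \<tau> i \<omega>) = distr M borel (grid_incr \<tau> i)"
proof (cases "\<tau> i < \<tau> (Suc i)")
  case True
  have nn: "0 \<le> \<tau> i" using grid_nonneg [OF \<tau>(1,2), of i] \<tau>(3) by simp
  have d: "distributed M lborel (grid_incr \<tau> i) (normal_density 0 (sqrt (\<tau> (Suc i) - \<tau> i)))"
    by (rule normal_increments [OF nn True])
  have "distributed M lborel (\<lambda>\<omega>. 0 + (- 1) * grid_incr \<tau> i \<omega>) (normal_density (0 + (- 1) * 0) (\<bar>- 1\<bar> * sqrt (\<tau> (Suc i) - \<tau> i)))"
    using True by (intro normal_density_affine [OF d]) auto
  then have "distributed M lborel (\<lambda>\<omega>. - grid_incr \<tau> i \<omega>) (normal_density 0 (sqrt (\<tau> (Suc i) - \<tau> i)))"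
    by simp
  then have "distr M lborel (\<lambda>\<omega>. - grid_incr \<tau> i \<omega>) = distr M lborel (grid_incr \<tau> i)"
    using d by (metis distributed_distr_eq_density)
  moreover have "distr M borel f = distr M lborel f" for f :: "'a \<Rightarrow> real"
    by (rule distr_cong) auto
  ultimately show ?thesis by simp
next
  case False
  have "\<tau> i \<le> \<tau> (Suc i)" using mono_onD [OF \<tau>(2), of i "Suc i"] \<tau>(3) by simp
  then have "\<tau> (Suc i) = \<tau> i" using False by simp
  then show ?thesis by simp
qed

text \<open>The reflection principle at a fixed index: multiplying independent symmetric increments
  by fixed signs leaves their joint law unchanged. The first crossing is brought in through
  \<open>F\<close> and not as a random time. Hypothesis \<open>loc\<close> is what lets
  \<open>F\<close> be evaluated on partial sums of a vector that is defined below \<open>n\<close>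
  only.\<close>

lemma expectation_reflect:
  assumes \<tau>: "\<tau> 0 = 0" "mono_on {..n} \<tau>" and n: "1 \<le> n"
    and F: "(\<lambda>x. F (\<lambda>j. \<Sum>i<j. x i)) \<in> borel_measurable (PiM {..<n} (\<lambda>_. borel :: real measure))"
    and loc: "\<And>p q. (\<And>j. j \<le> n \<Longrightarrow> p j = q j) \<Longrightarrow> F p = F q"
  shows "expectation (\<lambda>\<omega>. F (reflect_after k (\<lambda>j. W (\<tau> j) \<omega>))) = (expectation (\<lambda>\<omega>. F (\<lambda>j. W (\<tau> j) \<omega>)) :: real)"
proof -
  let ?P = "PiM {..<n} (\<lambda>_. borel :: real measure)"
  define \<sigma> where "\<sigma> i = (if i < k then 1 else - 1 :: real)" for i
  have ind: "indep_vars (\<lambda>_. borel) (grid_incr \<tau>) {..<n}"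
    using \<tau> by (intro independent_increments) auto
  have ind2: "indep_vars (\<lambda>_. borel) (\<lambda>i \<omega>. \<sigma> i * grid_incr \<tau> i \<omega>) {..<n}"
    by (rule indep_vars_compose2 [OF ind]) simp
  have rv: "random_variable borel (grid_incr \<tau> i)" if "i \<in> {..<n}" for i
    using ind that by (simp add: indep_vars_def)
  have ne: "{..<n} \<noteq> {}" using n by (simp add: lessThan_empty_iff)
  have "distr M ?P (\<lambda>\<omega>. \<lambda>i\<in>{..<n}. \<sigma> i * grid_incr \<tau> i \<omega>) = PiM {..<n} (\<lambda>i. distr M borel (\<lambda>\<omega>. \<sigma> i * grid_incr \<tau> i \<omega>))"
    using ind2 rv by (subst (asm) indep_vars_iff_distr_eq_PiM' [OF ne]) auto
  also have "\<dots> = PiM {..<n} (\<lambda>i. distr M borel (grid_incr \<tau> i))"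
  proof (intro PiM_cong refl)
    fix i assume "i \<in> {..<n}"
    then show "distr M borel (\<lambda>\<omega>. \<sigma> i * grid_incr \<tau> i \<omega>) = distr M borel (grid_incr \<tau> i)"
      using distr_neg_grid_incr [OF \<tau>, of i] by (cases "i < k") (simp_all add: \<sigma>_def)
  qed
  also have "\<dots> = distr M ?P (\<lambda>\<omega>. \<lambda>i\<in>{..<n}. grid_incr \<tau> i \<omega>)"
    using ind rv by (subst (asm) indep_vars_iff_distr_eq_PiM' [OF ne]) auto
  finally have D: "distr M ?P (\<lambda>\<omega>. \<lambda>i\<in>{..<n}. \<sigma> i * grid_incr \<tau> i \<omega>) = distr M ?P (\<lambda>\<omega>. \<lambda>i\<in>{..<n}. grid_incr \<tau> i \<omega>)" .
  have m1: "(\<lambda>\<omega>. \<lambda>i\<in>{..<n}. \<sigma> i * grid_incr \<tau> i \<omega>) \<in> measurable M ?P"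
    using rv by (intro measurable_restrict) auto
  have m2: "(\<lambda>\<omega>. \<lambda>i\<in>{..<n}. grid_incr \<tau> i \<omega>) \<in> measurable M ?P"
    using rv by (intro measurable_restrict) auto
  let ?G = "\<lambda>x. F (\<lambda>j. \<Sum>i<j. x i)"
  have v: "?G (\<lambda>i\<in>{..<n}. grid_incr \<tau> i \<omega>) = F (\<lambda>j. W (\<tau> j) \<omega>)" if \<omega>: "\<omega> \<in> space M" for \<omega>
  proof (rule loc)
    fix j assume "j \<le> n"
    then show "(\<Sum>i<j. (\<lambda>i\<in>{..<n}. grid_incr \<tau> i \<omega>) i) = W (\<tau> j) \<omega>"
      by (intro trans [OF sum.cong W_eq_sum_grid_incr [of \<tau>, OF \<tau>(1) \<omega>, symmetric]]) auto
  qed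
  have r: "?G (\<lambda>i\<in>{..<n}. \<sigma> i * grid_incr \<tau> i \<omega>) = F (reflect_after k (\<lambda>j. W (\<tau> j) \<omega>))" if \<omega>: "\<omega> \<in> space M" for \<omega>
  proof (rule loc)
    fix j assume j: "j \<le> n"
    have "(\<Sum>i<j. (\<lambda>i\<in>{..<n}. \<sigma> i * grid_incr \<tau> i \<omega>) i) = (\<Sum>i<j. \<sigma> i * grid_incr \<tau> i \<omega>)"
      using j by (intro sum.cong) auto
    also have "\<dots> = reflect_after k (\<lambda>j. W (\<tau> j) \<omega>) j"
    proof (induction j)
      case 0
      then show ?case using start [OF \<omega>] \<tau>(1) by (simp add: reflect_after_def)
    next
      case (Suc j)
      show ?case unfolding sum.lessThan_Suc Suc
        by (cases "j < k"; cases "Suc j \<le> k"; cases "j = k") (auto simp: reflect_after_def \<sigma>_def algebra_simps)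
    qed
    finally show "(\<Sum>i<j. (\<lambda>i\<in>{..<n}. \<sigma> i * grid_incr \<tau> i \<omega>) i) = reflect_after k (\<lambda>j. W (\<tau> j) \<omega>) j" .
  qed
  have "expectation (\<lambda>\<omega>. F (reflect_after k (\<lambda>j. W (\<tau> j) \<omega>))) = expectation (\<lambda>\<omega>. ?G (\<lambda>i\<in>{..<n}. \<sigma> i * grid_incr \<tau> i \<omega>))"
    by (intro Bochner_Integration.integral_cong refl) (rule r [symmetric])
  also have "\<dots> = integral\<^sup>L (distr M ?P (\<lambda>\<omega>. \<lambda>i\<in>{..<n}. \<sigma> i * grid_incr \<tau> i \<omega>)) ?G"
    by (rule integral_distr [OF m1 F, symmetric])
  also have "\<dots> = expectation (\<lambda>\<omega>. ?G (\<lambda>i\<in>{..<n}. grid_incr \<tau> i \<omega>))"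
    unfolding D by (rule integral_distr [OF m2 F])
  also have "\<dots> = expectation (\<lambda>\<omega>. F (\<lambda>j. W (\<tau> j) \<omega>))"
    by (intro Bochner_Integration.integral_cong refl) (rule v)
  finally show ?thesis .
qed

end

section \<open>The last zero and the arcsine law\<close>

lemma arctan_diff_bounds:
  fixes u v :: real
  assumes "0 \<le> u" "u \<le> v"
  shows "(v - u) / (1 + v\<^sup>2) \<le> arctan v - arctan u" "arctan v - arctan u \<le> (v - u) / (1 + u\<^sup>2)"
proof -
  have "(v - u) / (1 + v\<^sup>2) \<le> arctan v - arctan u \<and> arctan v - arctan u \<le> (v - u) / (1 + u\<^sup>2)"
  proof (cases "u = v")
    case False
    then have uv: "u < v" using assms by simp
    obtain z where z: "u < z" "z < v" "arctan v - arctan u = (v - u) * inverse (1 + z\<^sup>2)"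
      using MVT2 [OF uv, of arctan "\<lambda>x. inverse (1 + x\<^sup>2)"] DERIV_arctan by blast
    have "1 + u\<^sup>2 \<le> 1 + z\<^sup>2" "1 + z\<^sup>2 \<le> 1 + v\<^sup>2"
      using z assms by (auto intro!: power_mono)
    moreover have "0 < 1 + u\<^sup>2" by (simp add: add_pos_nonneg)
    ultimately have "inverse (1 + v\<^sup>2) \<le> inverse (1 + z\<^sup>2)" "inverse (1 + z\<^sup>2) \<le> inverse (1 + u\<^sup>2)"
      by (auto intro!: le_imp_inverse_le)
    then show ?thesis
      unfolding z(3) divide_inverse using uv by (auto intro!: mult_left_mono)
  qed simp
  then show "(v - u) / (1 + v\<^sup>2) \<le> arctan v - arctan u" "arctan v - arctan u \<le> (v - u) / (1 + u\<^sup>2)"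
    by auto
qed

section \<open>Differences of the limiting expectations and their Riemann sums\<close>

definition mehler_coth :: "real \<Rightarrow> real \<Rightarrow> real" where
  "mehler_coth \<alpha> y = \<alpha> * cosh (\<alpha> * (1 - y)) / sinh (\<alpha> * (1 - y))"

definition mehler_csch :: "real \<Rightarrow> real \<Rightarrow> real" where
  "mehler_csch \<alpha> y = \<alpha> / sinh (\<alpha> * (1 - y))"

text \<open>
  A difference quotient of \<open>sign_value\<close> in its first argument, in which the argument \<open>w\<close> of the
  derivative of the arctangent is left free. On the diagonal \<open>x = y = w\<close> it is the density of the last zero
  times the required Laplace transform.
\<close>

definition last_zero_rate :: "real \<Rightarrow> real \<Rightarrow> real \<Rightarrow> real \<Rightarrow> real" where
  "last_zero_rate \<alpha> x y w = 2 / pi * sqrt (mehler_csch \<alpha> y / (mehler_coth \<alpha> y + \<alpha>\<^sup>2 * y)) *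
     (mehler_csch \<alpha> y / sqrt (mehler_coth \<alpha> y + \<alpha>\<^sup>2 * y)) * (1 + y * mehler_coth \<alpha> y) /
     ((1 + (y - x) * mehler_coth \<alpha> y) * (sqrt y + sqrt (x / (1 + (y - x) * mehler_coth \<alpha> y))) *
      (1 + (mehler_csch \<alpha> y)\<^sup>2 / (mehler_coth \<alpha> y + \<alpha>\<^sup>2 * y) * w))"

lemma mehler_coth_csch_pos:
  assumes "\<alpha> > 0" "y < 1"
  shows "mehler_coth \<alpha> y > 0" "mehler_csch \<alpha> y > 0" "(mehler_coth \<alpha> y)\<^sup>2 = (mehler_csch \<alpha> y)\<^sup>2 + \<alpha>\<^sup>2"
proof -
  have "sinh (\<alpha> * (1 - y)) > 0" using assms by simp
  then show "mehler_coth \<alpha> y > 0" "mehler_csch \<alpha> y > 0" "(mehler_coth \<alpha> y)\<^sup>2 = (mehler_csch \<alpha> y)\<^sup>2 + \<alpha>\<^sup>2"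
    using assms
    by (simp_all add: mehler_coth_def mehler_csch_def power_divide power_mult_distrib cosh_square_eq field_simps)
qed

text \<open>Only the argument of the arctangent depends on the first time. By the mean value theorem
  the difference of the arctangents lies between the difference of the arguments times the
  derivative at either end, and these ends correspond to w = y and w = x / E.\<close>

lemma sign_value_diff_bounds:
  fixes x y \<alpha> :: real
  assumes xy: "0 < x" "x \<le> y" "y < 1" and \<alpha>: "\<alpha> > 0"
  shows "(y - x) * last_zero_rate \<alpha> x y y \<le> sign_value y y \<alpha> (\<alpha> * (1 - y)) - sign_value x y \<alpha> (\<alpha> * (1 - y))" (is ?lower)
    and "sign_value y y \<alpha> (\<alpha> * (1 - y)) - sign_value x y \<alpha> (\<alpha> * (1 - y))
      \<le> (y - x) * last_zero_rate \<alpha> x y (x / (1 + (y - x) * mehler_coth \<alpha> y))" (is ?upper)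
proof -
  define C where "C = mehler_coth \<alpha> y"
  define S where "S = mehler_csch \<alpha> y"
  define B where "B = C + \<alpha>\<^sup>2 * y"
  define E where "E = 1 + (y - x) * C"
  define q where "q = sqrt (x / E)"
  define \<kappa> where "\<kappa> = S / sqrt B"
  define Z where "Z = 2 / pi * sqrt (S / B)"
  have CS: "C > 0" "S > 0" using mehler_coth_csch_pos [OF \<alpha> xy(3)] by (simp_all add: C_def S_def)
  have B: "B > 0" using CS \<alpha> xy by (simp add: B_def add_pos_pos)
  have E: "E \<ge> 1" using CS xy by (simp add: E_def)
  have \<kappa>: "\<kappa> > 0" using CS B by (simp add: \<kappa>_def)
  have Z: "Z \<ge> 0" using CS B by (simp add: Z_def)
  have q2: "q\<^sup>2 = x / E" using xy E by (simp add: q_def)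
  have "x / E \<le> y" using xy E by (simp add: divide_le_eq mult_le_cancel_left1 order_trans [of x y "y * E"])
  then have q: "0 \<le> q" "q \<le> sqrt y" using xy E by (simp_all add: q_def)
  have sy: "sqrt y > 0" using xy by simp
  have sv: "sign_value s y \<alpha> (\<alpha> * (1 - y)) = Z * arctan (\<kappa> * sqrt (s / (1 + (y - s) * C)))" for s
  proof -
    have "S * sqrt (s / ((1 + (y - s) * C) * B)) = \<kappa> * sqrt (s / (1 + (y - s) * C))"
      by (simp add: \<kappa>_def real_sqrt_divide real_sqrt_mult)
    then show ?thesis
      unfolding sign_value_def Z_def B_def C_def S_def mehler_coth_def mehler_csch_def by simp
  qed
  have svy: "sign_value y y \<alpha> (\<alpha> * (1 - y)) = Z * arctan (\<kappa> * sqrt y)" unfolding sv by simp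
  have svx: "sign_value x y \<alpha> (\<alpha> * (1 - y)) = Z * arctan (\<kappa> * q)" unfolding sv q_def E_def ..
  \<comment> \<open>Rationalising the difference of roots extracts the factor y - x, so that the
    remaining quotient is continuous up to the diagonal.\<close>
  have diff: "sqrt y - q = (y - x) * (1 + y * C) / (E * (sqrt y + q))"
  proof -
    have "(sqrt y - q) * (sqrt y + q) = y - q\<^sup>2"
      using xy by (simp add: power2_eq_square algebra_simps)
    also have "\<dots> = (y - x) * (1 + y * C) / E"
      unfolding q2 using E by (simp add: E_def field_simps)
    finally have "(sqrt y - q) * (sqrt y + q) / (sqrt y + q) = (y - x) * (1 + y * C) / E / (sqrt y + q)"
      by (rule arg_cong)
    then show ?thesis using sy q by simp
  qed
  have rate: "(y - x) * last_zero_rate \<alpha> x y w = Z * ((\<kappa> * sqrt y - \<kappa> * q) / (1 + \<kappa>\<^sup>2 * w))" for w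
  proof -
    have k2: "\<kappa>\<^sup>2 = S\<^sup>2 / B" using B by (simp add: \<kappa>_def power_divide)
    have "Z * ((\<kappa> * sqrt y - \<kappa> * q) / (1 + \<kappa>\<^sup>2 * w)) = Z * (\<kappa> * (sqrt y - q) / (1 + \<kappa>\<^sup>2 * w))"
      by (simp add: algebra_simps)
    also have "\<dots> = (y - x) * (Z * \<kappa> * (1 + y * C) / (E * (sqrt y + q) * (1 + S\<^sup>2 / B * w)))"
      unfolding diff k2 by simp
    also have "\<dots> = (y - x) * last_zero_rate \<alpha> x y w"
      unfolding last_zero_rate_def C_def [symmetric] S_def [symmetric] B_def [symmetric] E_def [symmetric]
        q_def [symmetric] Z_def [symmetric] \<kappa>_def [symmetric] by (simp only: mult.assoc)
    finally show ?thesis ..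
  qed
  have le: "0 \<le> \<kappa> * q" "\<kappa> * q \<le> \<kappa> * sqrt y" using q \<kappa> by (auto intro: mult_left_mono)
  have "(\<kappa> * sqrt y)\<^sup>2 = \<kappa>\<^sup>2 * y" "(\<kappa> * q)\<^sup>2 = \<kappa>\<^sup>2 * (x / E)"
    using xy q2 by (simp_all add: power_mult_distrib)
  then have b: "(\<kappa> * sqrt y - \<kappa> * q) / (1 + \<kappa>\<^sup>2 * y) \<le> arctan (\<kappa> * sqrt y) - arctan (\<kappa> * q)"
    "arctan (\<kappa> * sqrt y) - arctan (\<kappa> * q) \<le> (\<kappa> * sqrt y - \<kappa> * q) / (1 + \<kappa>\<^sup>2 * (x / E))"
    using arctan_diff_bounds [OF le] by simp_all
  show ?lower
    using mult_left_mono [OF b(1) Z] unfolding rate svy svx by (simp only: right_diff_distrib)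
  show ?upper
    using mult_left_mono [OF b(2) Z]
    unfolding C_def [symmetric] E_def [symmetric] rate svy svx by (simp only: right_diff_distrib)
qed

text \<open>The scaling \<alpha> = l / (1 - r) keeps \<alpha> (1 - r) = l, so that C and S are
  functions of l divided by 1 - r. Since C^2 = S^2 + \<alpha>^2, the last factor of the denominator
  equals C (1 + r C) / B; then B and 1 + r C cancel, and what is left separates into a function of l
  and the arcsine density in r.\<close>

lemma last_zero_rate_diagonal:
  fixes l r :: real
  assumes l: "l > 0" and r: "0 < r" "r < 1"
  shows "last_zero_rate (l / (1 - r)) r r r = sqrt (l / sinh l) / cosh l * (1 / (pi * sqrt (r * (1 - r))))"
proof -
  define \<alpha> where "\<alpha> = l / (1 - r)"
  have \<alpha>: "\<alpha> > 0" "\<alpha> * (1 - r) = l" using l r by (simp_all add: \<alpha>_def)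
  define C where "C = mehler_coth \<alpha> r"
  define S where "S = mehler_csch \<alpha> r"
  define B where "B = C + \<alpha>\<^sup>2 * r"
  have CS: "C > 0" "S > 0" "C\<^sup>2 = S\<^sup>2 + \<alpha>\<^sup>2"
    using mehler_coth_csch_pos [OF \<alpha>(1) r(2)] by (simp_all add: C_def S_def)
  have B: "B > 0" using CS \<alpha> r by (simp add: B_def add_pos_pos)
  have sh: "sinh l > 0" using l by simp
  have id: "1 + S\<^sup>2 / B * r = C * (1 + r * C) / B"
  proof -
    have "B + S\<^sup>2 * r = C * (1 + r * C)"
      using CS(3) unfolding B_def by algebra
    then show ?thesis using B by (simp add: field_simps)
  qed
  have rC: "1 + r * C > 0" using r CS by (simp add: add_pos_pos)
  have sqB: "sqrt (S / B) * (S / sqrt B) = S * sqrt S / B"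
    using B by (simp add: real_sqrt_divide field_simps)
  have cancel: "2 / pi * u * m / (1 * (v + v) * (C * m / B)) = u * B / (pi * v * C)" if "m > 0" "v > 0" for u v m :: real
    using that by simp
  have "last_zero_rate \<alpha> r r r = 2 / pi * (sqrt (S / B) * (S / sqrt B)) * (1 + r * C) / (1 * (sqrt r + sqrt r) * (1 + S\<^sup>2 / B * r))"
    unfolding last_zero_rate_def C_def [symmetric] S_def [symmetric] B_def [symmetric]
    by (simp add: mult.assoc)
  also have "\<dots> = S * sqrt S / B * B / (pi * sqrt r * C)"
    unfolding id sqB by (rule cancel [OF rC]) (use r in simp)
  also have "\<dots> = sqrt S * (S / C) / (pi * sqrt r)"
    using B by (simp add: mult_ac)
  also have "S / C = 1 / cosh l"
    using \<alpha>(1) sh by (simp add: C_def S_def mehler_coth_def mehler_csch_def \<alpha>(2))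
  also have "sqrt S = sqrt (l / sinh l) / sqrt (1 - r)"
  proof -
    have "S = (l / sinh l) / (1 - r)" unfolding S_def mehler_csch_def \<alpha>(2) by (simp add: \<alpha>_def)
    then show ?thesis by (simp only: real_sqrt_divide)
  qed
  finally show ?thesis by (simp add: \<alpha>_def real_sqrt_mult)
qed

text \<open>The free \<open>w\<close> covers both mean value bounds; the second claim is the
  continuity of the \<open>w\<close> that the upper bound needs. The frequency moves with the left
  end of the cell.\<close>

lemma continuous_on_last_zero_rate:
  fixes l a b :: real
  assumes l: "l > 0" and ab: "0 < a" "a < b" "b < 1"
    and w: "continuous_on {p \<in> {a..b} \<times> {a..b}. fst p \<le> snd p} w" "\<And>p. p \<in> {p \<in> {a..b} \<times> {a..b}. fst p \<le> snd p} \<Longrightarrow> 0 \<le> w p"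
  shows "continuous_on {p \<in> {a..b} \<times> {a..b}. fst p \<le> snd p} (\<lambda>p. last_zero_rate (l / (1 - fst p)) (fst p) (snd p) (w p))"
    and "continuous_on {p \<in> {a..b} \<times> {a..b}. fst p \<le> snd p} (\<lambda>p. fst p / (1 + (snd p - fst p) * mehler_coth (l / (1 - fst p)) (snd p)))"
proof -
  let ?T = "{p \<in> {a..b} \<times> {a..b}. fst p \<le> snd p}"
  let ?\<alpha> = "\<lambda>p. l / (1 - fst p)"
  have facts: "1 - fst p \<noteq> 0" "?\<alpha> p > 0" "sinh (?\<alpha> p * (1 - snd p)) \<noteq> 0"
    "mehler_coth (?\<alpha> p) (snd p) > 0" "mehler_csch (?\<alpha> p) (snd p) > 0" "snd p > 0" "fst p > 0" "fst p \<le> snd p"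
    if "p \<in> ?T" for p
  proof -
    have p: "fst p < 1" "snd p < 1" "fst p > 0" "snd p > 0" "fst p \<le> snd p" using that ab by auto
    then show "1 - fst p \<noteq> 0" and al: "?\<alpha> p > 0" using l by simp_all
    show "sinh (?\<alpha> p * (1 - snd p)) \<noteq> 0" using l p by simp
    show "mehler_coth (?\<alpha> p) (snd p) > 0" "mehler_csch (?\<alpha> p) (snd p) > 0"
      using mehler_coth_csch_pos [OF al p(2)] by simp_all
    show "snd p > 0" "fst p > 0" "fst p \<le> snd p" using p by simp_all
  qed
  have c\<alpha>: "continuous_on ?T ?\<alpha>"
    using facts(1) by (intro continuous_intros) auto
  have cC: "continuous_on ?T (\<lambda>p. mehler_coth (?\<alpha> p) (snd p))"
    unfolding mehler_coth_def using facts(3) by (intro continuous_intros c\<alpha>) auto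
  have cS: "continuous_on ?T (\<lambda>p. mehler_csch (?\<alpha> p) (snd p))"
    unfolding mehler_csch_def using facts(3) by (intro continuous_intros c\<alpha>) auto
  have E: "1 + (snd p - fst p) * mehler_coth (?\<alpha> p) (snd p) > 0" if "p \<in> ?T" for p
    using facts(4,8) [OF that] by (simp add: add_pos_nonneg)
  have B: "mehler_coth (?\<alpha> p) (snd p) + (?\<alpha> p)\<^sup>2 * snd p > 0" if "p \<in> ?T" for p
    using facts(2,4,6) [OF that] by (intro add_pos_pos mult_pos_pos) auto
  have q: "sqrt (snd p) + sqrt (fst p / (1 + (snd p - fst p) * mehler_coth (?\<alpha> p) (snd p))) > 0" if "p \<in> ?T" for p
    using facts(6,7) [OF that] E [OF that] by (intro add_pos_pos) auto
  have k: "1 + (mehler_csch (?\<alpha> p) (snd p))\<^sup>2 / (mehler_coth (?\<alpha> p) (snd p) + (?\<alpha> p)\<^sup>2 * snd p) * w p > 0" if "p \<in> ?T" for p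
    using less_imp_le [OF B [OF that]]
    by (intro add_pos_nonneg mult_nonneg_nonneg divide_nonneg_nonneg w(2) [OF that])
      (rule zero_less_one, rule zero_le_power2, assumption)
  have cE: "continuous_on ?T (\<lambda>p. 1 + (snd p - fst p) * mehler_coth (?\<alpha> p) (snd p))"
    by (intro continuous_on_add continuous_on_mult continuous_on_diff continuous_on_const cC continuous_on_fst
        continuous_on_snd continuous_on_id)
  have nz: "\<forall>p\<in>?T. f p \<noteq> 0" if "\<And>p. p \<in> ?T \<Longrightarrow> f p > 0" for f :: "real \<times> real \<Rightarrow> real"
    using that by (metis less_irrefl)
  show cq: "continuous_on ?T (\<lambda>p. fst p / (1 + (snd p - fst p) * mehler_coth (?\<alpha> p) (snd p)))"
    by (rule continuous_on_divide [OF continuous_on_fst [OF continuous_on_id] cE nz [OF E]])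
  note Bnz = nz [OF B] nz [OF real_sqrt_gt_zero [OF B]]
  have den: "\<forall>p\<in>?T. (1 + (snd p - fst p) * mehler_coth (?\<alpha> p) (snd p)) *
      (sqrt (snd p) + sqrt (fst p / (1 + (snd p - fst p) * mehler_coth (?\<alpha> p) (snd p)))) *
      (1 + (mehler_csch (?\<alpha> p) (snd p))\<^sup>2 / (mehler_coth (?\<alpha> p) (snd p) + (?\<alpha> p)\<^sup>2 * snd p) * w p) \<noteq> 0"
    by (rule nz [OF mult_pos_pos [OF mult_pos_pos [OF E q] k]])
  have cB: "continuous_on ?T (\<lambda>p. mehler_coth (?\<alpha> p) (snd p) + (?\<alpha> p)\<^sup>2 * snd p)"
    by (intro continuous_on_add cC continuous_on_mult continuous_on_power c\<alpha> continuous_on_snd continuous_on_id)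
  show "continuous_on ?T (\<lambda>p. last_zero_rate (?\<alpha> p) (fst p) (snd p) (w p))"
    unfolding last_zero_rate_def
    by (intro continuous_on_divide [OF _ _ den] continuous_on_mult continuous_on_add continuous_on_diff continuous_on_const
        continuous_on_real_sqrt continuous_on_divide [OF _ _ Bnz(1)] continuous_on_divide [OF _ _ Bnz(2)]
        continuous_on_power cS cC cB cq w(1) continuous_on_fst continuous_on_snd continuous_on_id)
qed

lemma arcsine_integral:
  fixes a b :: real
  assumes "0 < a" "a < b" "b < 1"
  shows "integral {a..b} (\<lambda>r. 1 / (pi * sqrt (r * (1 - r)))) = 2 / pi * (arcsin (sqrt b) - arcsin (sqrt a))"
proof -
  have "((\<lambda>r. 1 / (pi * sqrt (r * (1 - r)))) has_integral (2 / pi * arcsin (sqrt b) - 2 / pi * arcsin (sqrt a))) {a..b}"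
  proof (rule fundamental_theorem_of_calculus)
    fix r assume "r \<in> {a..b}"
    then have r: "0 < r" "r < 1" using assms by auto
    then have s: "- 1 < sqrt r" "sqrt r < 1" "0 < sqrt r" by (auto intro: less_trans [of _ 0])
    have "((\<lambda>r. 2 / pi * arcsin (sqrt r)) has_real_derivative 2 / pi * (inverse (sqrt (1 - (sqrt r)\<^sup>2)) * (inverse (sqrt r) / 2))) (at r)"
      by (intro DERIV_cmult DERIV_chain2 [OF DERIV_arcsin [OF s(1,2)] DERIV_real_sqrt [OF r(1)]])
    moreover have "2 / pi * (inverse (sqrt (1 - (sqrt r)\<^sup>2)) * (inverse (sqrt r) / 2)) = 1 / (pi * sqrt (r * (1 - r)))"
      using r by (simp add: real_sqrt_mult inverse_eq_divide)
    ultimately show "((\<lambda>r. 2 / pi * arcsin (sqrt r)) has_vector_derivative 1 / (pi * sqrt (r * (1 - r)))) (at r within {a..b})"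
      by (simp add: has_real_derivative_iff_has_vector_derivative [symmetric] has_field_derivative_at_within)
  qed (use assms in simp)
  then show ?thesis by (simp add: integral_unique right_diff_distrib)
qed

text \<open>Within a cell the frequency is frozen at its left end, so that both members of a
  difference weigh the path by the same functional. The two mean value bounds are Riemann sums with
  the same diagonal, since both choices of \<open>w\<close> reduce to r there, and they squeeze the
  sum.\<close>

lemma sign_value_sum_tendsto:
  fixes l a b :: real
  assumes l: "l > 0" and ab: "0 < a" "a < b" "b < 1"
  defines "x \<equiv> \<lambda>N k. a + real k * ((b - a) / real N)"
  shows "(\<lambda>N. \<Sum>k<N. sign_value (x N (Suc k)) (x N (Suc k)) (l / (1 - x N k)) (l / (1 - x N k) * (1 - x N (Suc k)))
      - sign_value (x N k) (x N (Suc k)) (l / (1 - x N k)) (l / (1 - x N k) * (1 - x N (Suc k))))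
    \<longlonglongrightarrow> sqrt (l / sinh l) / cosh l * (2 / pi * (arcsin (sqrt b) - arcsin (sqrt a)))"
proof -
  let ?T = "{p \<in> {a..b} \<times> {a..b}. fst p \<le> snd p}"
  let ?q = "\<lambda>x y. x / (1 + (y - x) * mehler_coth (l / (1 - x)) y)"
  let ?I = "sqrt (l / sinh l) / cosh l * (2 / pi * (arcsin (sqrt b) - arcsin (sqrt a)))"
  have T0: "continuous_on ?T (\<lambda>p. snd p)" "\<And>p. p \<in> ?T \<Longrightarrow> 0 \<le> snd p"
    using ab by (auto intro!: continuous_intros)
  have q0: "0 \<le> ?q (fst p) (snd p)" if "p \<in> ?T" for p
  proof -
    have "mehler_coth (l / (1 - fst p)) (snd p) > 0"
      using that ab l by (intro mehler_coth_csch_pos) auto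
    then show ?thesis using that ab by (intro divide_nonneg_nonneg add_nonneg_nonneg mult_nonneg_nonneg) auto
  qed
  have int: "integral {a..b} (\<lambda>r. last_zero_rate (l / (1 - r)) r r (w r)) = ?I" if w: "\<And>r. r \<in> {a..b} \<Longrightarrow> w r = r" for w
  proof -
    have "integral {a..b} (\<lambda>r. last_zero_rate (l / (1 - r)) r r (w r))
      = integral {a..b} (\<lambda>r. sqrt (l / sinh l) / cosh l * (1 / (pi * sqrt (r * (1 - r)))))"
      using ab by (intro Henstock_Kurzweil_Integration.integral_cong) (subst w, simp, rule last_zero_rate_diagonal [OF l], auto)
    also have "\<dots> = sqrt (l / sinh l) / cosh l * integral {a..b} (\<lambda>r. 1 / (pi * sqrt (r * (1 - r))))"
      by (rule Henstock_Kurzweil_Integration.integral_mult_right)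
    finally show ?thesis by (simp only: arcsine_integral [OF ab])
  qed
  have lim1: "(\<lambda>N. \<Sum>k<N. (b - a) / real N * last_zero_rate (l / (1 - x N k)) (x N k) (x N (Suc k)) (x N (Suc k))) \<longlonglongrightarrow> ?I"
    using riemann_sum_diagonal [OF ab(2) continuous_on_last_zero_rate(1) [OF l ab T0, unfolded fst_conv]]
    by (simp only: x_def int)
  have lim2: "(\<lambda>N. \<Sum>k<N. (b - a) / real N * last_zero_rate (l / (1 - x N k)) (x N k) (x N (Suc k)) (?q (x N k) (x N (Suc k)))) \<longlonglongrightarrow> ?I"
    using riemann_sum_diagonal [OF ab(2) continuous_on_last_zero_rate(1) [OF l ab continuous_on_last_zero_rate(2) [OF l ab T0] q0]]
    by (simp only: x_def int) (simp add: int)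
  have bounds: "(b - a) / real N * last_zero_rate (l / (1 - x N k)) (x N k) (x N (Suc k)) (x N (Suc k))
      \<le> sign_value (x N (Suc k)) (x N (Suc k)) (l / (1 - x N k)) (l / (1 - x N k) * (1 - x N (Suc k)))
      - sign_value (x N k) (x N (Suc k)) (l / (1 - x N k)) (l / (1 - x N k) * (1 - x N (Suc k)))"
    "sign_value (x N (Suc k)) (x N (Suc k)) (l / (1 - x N k)) (l / (1 - x N k) * (1 - x N (Suc k)))
      - sign_value (x N k) (x N (Suc k)) (l / (1 - x N k)) (l / (1 - x N k) * (1 - x N (Suc k)))
      \<le> (b - a) / real N * last_zero_rate (l / (1 - x N k)) (x N k) (x N (Suc k)) (?q (x N k) (x N (Suc k)))"
    if "k < N" for N k
  proof -
    have h: "0 < (b - a) / real N" using ab that by simp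
    have d: "x N (Suc k) - x N k = (b - a) / real N"
      by (simp add: x_def distrib_right add_divide_distrib diff_divide_distrib)
    have "real (Suc k) * ((b - a) / real N) \<le> real N * ((b - a) / real N)"
      using that h by (intro mult_right_mono) auto
    then have "x N (Suc k) \<le> b" using that by (simp add: x_def)
    moreover have "0 \<le> real k * ((b - a) / real N)"
      by (intro mult_nonneg_nonneg of_nat_0_le_iff less_imp_le [OF h])
    then have "a \<le> x N k" by (simp add: x_def)
    ultimately have r: "0 < x N k" "x N k \<le> x N (Suc k)" "x N (Suc k) < 1" "l / (1 - x N k) > 0"
      using d h ab l by auto
    show "(b - a) / real N * last_zero_rate (l / (1 - x N k)) (x N k) (x N (Suc k)) (x N (Suc k))
      \<le> sign_value (x N (Suc k)) (x N (Suc k)) (l / (1 - x N k)) (l / (1 - x N k) * (1 - x N (Suc k)))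
      - sign_value (x N k) (x N (Suc k)) (l / (1 - x N k)) (l / (1 - x N k) * (1 - x N (Suc k)))"
      "sign_value (x N (Suc k)) (x N (Suc k)) (l / (1 - x N k)) (l / (1 - x N k) * (1 - x N (Suc k)))
      - sign_value (x N k) (x N (Suc k)) (l / (1 - x N k)) (l / (1 - x N k) * (1 - x N (Suc k)))
      \<le> (b - a) / real N * last_zero_rate (l / (1 - x N k)) (x N k) (x N (Suc k)) (?q (x N k) (x N (Suc k)))"
      using sign_value_diff_bounds [OF r] unfolding d by auto
  qed
  show ?thesis
    by (rule tendsto_sandwich [OF _ _ lim1 lim2]) (rule always_eventually, rule allI, rule sum_mono, rule bounds, simp)+
qed

section \<open>Grids that approximate a continuous path\<close>

lemma uniform_grid_near:
  fixes a b r :: real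
  assumes "a \<le> r" "r \<le> b" "N > 0"
  shows "\<exists>i\<le>N. \<bar>a + real i * ((b - a) / real N) - r\<bar> \<le> (b - a) / real N"
proof (cases "a = b")
  case False
  define h where "h = (b - a) / real N"
  have h: "h > 0" using assms False by (simp add: h_def)
  define i where "i = nat \<lfloor>(r - a) / h\<rfloor>"
  have "0 \<le> (r - a) / h" using assms h by simp
  then have i: "real i \<le> (r - a) / h" "(r - a) / h < real i + 1"
    by (simp_all add: i_def)
  have "(r - a) / h \<le> real N"
    using assms h False by (simp add: h_def field_simps mult_left_mono)
  then have "i \<le> N" using i(1) by linarith
  moreover have "\<bar>a + real i * h - r\<bar> \<le> h"
    using i h by (simp add: field_simps abs_le_iff)
  ultimately show ?thesis by (auto simp: h_def)
qed (use assms in auto)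

text \<open>Replaces an infimum over a continuum of times by minima over finitely many, both for
  measurability and to reach independent increments.\<close>

lemma grid_Min_tendsto_INF:
  fixes g :: "real \<Rightarrow> real"
  assumes s: "s \<le> 1" and g: "continuous_on {s..1} g"
  shows "(\<lambda>N. Min ((\<lambda>i. g (s + real i * ((1 - s) / real (Suc N)))) ` {..Suc N})) \<longlonglongrightarrow> (INF r\<in>{s..1}. g r)"
proof -
  let ?x = "\<lambda>N i. s + real i * ((1 - s) / real (Suc N))"
  let ?Z = "\<lambda>N. Min ((\<lambda>i. g (?x N i)) ` {..Suc N})"
  have cpt: "compact (g ` {s..1})" by (rule compact_continuous_image [OF g compact_Icc])
  then have bdd: "bdd_below (g ` {s..1})" by (simp add: bounded_imp_bdd_below compact_imp_bounded)
  obtain r0 where r0: "r0 \<in> {s..1}" "\<And>r. r \<in> {s..1} \<Longrightarrow> g r0 \<le> g r"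
    using continuous_attains_inf [OF compact_Icc _ g] s by auto
  have INF: "(INF r\<in>{s..1}. g r) = g r0"
    using r0 s by (intro antisym cINF_lower [OF bdd] cINF_greatest) auto
  have x_range: "?x N i \<in> {s..1}" if "i \<le> Suc N" for N i
  proof -
    have "real i * ((1 - s) / real (Suc N)) \<le> real (Suc N) * ((1 - s) / real (Suc N))"
      using s that by (intro mult_right_mono) auto
    then show ?thesis using s by simp
  qed
  show ?thesis
    unfolding INF
  proof (rule metric_LIMSEQ_I)
    fix e :: real assume e: "e > 0"
    obtain d where d: "d > 0" "\<And>r. r \<in> {s..1} \<Longrightarrow> dist r r0 < d \<Longrightarrow> dist (g r) (g r0) < e"
      using g r0(1) e unfolding continuous_on_iff by blast
    obtain N0 :: nat where N0: "(1 - s) / d < real N0" using reals_Archimedean2 by blast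
    show "\<exists>N0. \<forall>N\<ge>N0. dist (?Z N) (g r0) < e"
    proof (intro exI [of _ N0] allI impI)
      fix N assume "N \<ge> N0"
      then have "(1 - s) / d < real (Suc N)" using N0 by simp
      then have small: "(1 - s) / real (Suc N) < d" using d(1) by (simp add: field_simps)
      obtain i where i: "i \<le> Suc N" "\<bar>?x N i - r0\<bar> \<le> (1 - s) / real (Suc N)"
        using uniform_grid_near [of s r0 1 "Suc N"] r0 by auto
      have "?Z N \<le> g (?x N i)" using i by (intro Min_le) auto
      also have "\<dots> < g r0 + e"
        using d(2) [OF x_range [OF i(1)]] i(2) small by (simp add: dist_real_def abs_if split: if_splits)
      finally have "?Z N < g r0 + e" .
      moreover have "g r0 \<le> ?Z N"
        using r0(2) x_range by (intro Min.boundedI) auto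
      ultimately show "dist (?Z N) (g r0) < e" by (simp add: dist_real_def)
    qed
  qed
qed

lemma trapezoid_tendsto:
  assumes t: "t < 1" and f: "continuous_on {t..1} f"
  shows "(\<lambda>N. trapezoid f t N) \<longlonglongrightarrow> integral {t..1} f"
proof -
  have cont: "continuous_on {p \<in> {t..1} \<times> {t..1}. fst p \<le> snd p} (\<lambda>p. (f (fst p) + f (snd p)) / 2)"
    by (intro continuous_intros continuous_on_compose2 [OF f]) auto
  have "(\<lambda>N. \<Sum>k<N. (1 - t) / real N * ((f (t + real k * ((1 - t) / real N)) + f (t + real (Suc k) * ((1 - t) / real N))) / 2))
    \<longlonglongrightarrow> integral {t..1} (\<lambda>r. (f r + f r) / 2)"
    by (rule riemann_sum_diagonal [OF t cont])
  then show ?thesis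
    by (simp add: trapezoid_def sum_distrib_left)
qed

text \<open>
  The grid \<open>0, s, \<dots>, t, \<dots>, 1\<close> with \<open>N\<close> equal steps in each of \<open>[s,t]\<close> and \<open>[t,1]\<close>. Index 1 is \<open>s\<close>,
  so that index 0 only serves to make \<open>W s\<close> an increment.
\<close>

definition two_grid :: "real \<Rightarrow> real \<Rightarrow> nat \<Rightarrow> nat \<Rightarrow> real" where
  "two_grid s t N j = (if j = 0 then 0 else if j \<le> N then s + real (j - 1) * ((t - s) / real N)
     else t + real (j - 1 - N) * ((1 - t) / real N))"

lemma two_grid_values:
  assumes "N > 0"
  shows "two_grid s t N 0 = 0" "two_grid s t N 1 = s" "two_grid s t N (N + 1 + i) = t + real i * ((1 - t) / real N)"
    "two_grid s t N (2 * N + 1) = 1" "i \<le> N \<Longrightarrow> two_grid s t N (1 + i) = s + real i * ((t - s) / real N)"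
proof -
  show "two_grid s t N 0 = 0" "two_grid s t N 1 = s" "two_grid s t N (N + 1 + i) = t + real i * ((1 - t) / real N)"
    "two_grid s t N (2 * N + 1) = 1"
    using assms by (auto simp: two_grid_def)
  show "two_grid s t N (1 + i) = s + real i * ((t - s) / real N)" if "i \<le> N"
  proof (cases "i = N")
    case False
    then show ?thesis using that by (simp add: two_grid_def)
  qed (use assms in \<open>simp add: two_grid_def\<close>)
qed

text \<open>Index 0 is excluded: the first step has length s and does not shrink with the
  mesh.\<close>

lemma two_grid_step:
  assumes st: "0 < s" "s \<le> t" "t < 1" and N: "N > 0" and j: "1 \<le> j" "j < 2 * N + 1"
  shows "two_grid s t N j \<le> two_grid s t N (Suc j)" "two_grid s t N (Suc j) - two_grid s t N j \<le> 1 / real N"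
proof -
  have d: "0 \<le> (t - s) / real N" "(t - s) / real N \<le> 1 / real N" "0 \<le> (1 - t) / real N" "(1 - t) / real N \<le> 1 / real N"
    using st N by (simp_all add: divide_right_mono)
  have "two_grid s t N (Suc j) - two_grid s t N j = (t - s) / real N \<or> two_grid s t N (Suc j) - two_grid s t N j = (1 - t) / real N"
  proof (cases "j \<le> N")
    case True
    then obtain i where i: "j = 1 + i" "Suc i \<le> N" using j by (cases j) auto
    have "two_grid s t N (Suc j) = s + real (Suc i) * ((t - s) / real N)"
      unfolding i using two_grid_values(5) [OF N i(2), of s t] by simp
    moreover have "two_grid s t N j = s + real i * ((t - s) / real N)"
      unfolding i using two_grid_values(5) [OF N, of i s t] i(2) by simp
    ultimately show ?thesis by (simp add: distrib_right add_divide_distrib diff_divide_distrib)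
  next
    case False
    then obtain i where i: "j = N + 1 + i" using j le_Suc_ex [of "N + 1" j] by auto
    have "two_grid s t N (Suc j) = t + real (Suc i) * ((1 - t) / real N)"
      using two_grid_values(3) [OF N, of s t "Suc i"] by (simp add: i)
    moreover have "two_grid s t N j = t + real i * ((1 - t) / real N)"
      unfolding i by (rule two_grid_values(3) [OF N])
    ultimately show ?thesis by (simp add: distrib_right add_divide_distrib diff_divide_distrib)
  qed
  then show "two_grid s t N j \<le> two_grid s t N (Suc j)" "two_grid s t N (Suc j) - two_grid s t N j \<le> 1 / real N"
    using d by auto
qed

lemma two_grid_mono:
  assumes st: "0 < s" "s \<le> t" "t < 1" and N: "N > 0"
  shows "mono_on {..2 * N + 1} (two_grid s t N)"
proof (rule mono_onI)
  fix i j assume ij: "i \<in> {..2 * N + 1}" "j \<in> {..2 * N + 1}" "i \<le> j"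
  have step: "two_grid s t N k \<le> two_grid s t N (Suc k)" if "k < 2 * N + 1" for k
  proof (cases "k = 0")
    case True
    then show ?thesis using two_grid_values(1,2) [OF N, of s t] st by simp
  qed (use two_grid_step(1) [OF st N] that in auto)
  show "two_grid s t N i \<le> two_grid s t N j"
    using ij(3,2)
  proof (induction rule: dec_induct)
    case (step k)
    have "two_grid s t N k \<le> two_grid s t N (Suc k)"
      by (rule \<open>\<And>k. k < 2 * N + 1 \<Longrightarrow> two_grid s t N k \<le> two_grid s t N (Suc k)\<close>) (use step.prems step.hyps in auto)
    then show ?case using step by auto
  qed simp
qed

lemma two_grid_range:
  assumes st: "0 < s" "s \<le> t" "t < 1" and N: "N > 0" and j: "1 \<le> j" "j \<le> 2 * N + 1"
  shows "two_grid s t N j \<in> {s..1}"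
  using mono_onD [OF two_grid_mono [OF st N], of 1 j] mono_onD [OF two_grid_mono [OF st N], of j "2 * N + 1"] j
    two_grid_values(2,4) [OF N, of s t] by auto

lemma two_grid_near:
  assumes st: "0 < s" "s \<le> t" "t < 1" and N: "N > 0" and r: "r \<in> {s..1}"
  shows "\<exists>j\<in>{1..2 * N + 1}. \<bar>two_grid s t N j - r\<bar> \<le> 1 / real N"
proof (cases "r \<le> t")
  case True
  obtain i where i: "i \<le> N" "\<bar>s + real i * ((t - s) / real N) - r\<bar> \<le> (t - s) / real N"
    using uniform_grid_near [of s r t N] r True N by auto
  moreover have "(t - s) / real N \<le> 1 / real N" using st N by (simp add: divide_right_mono)
  ultimately show ?thesis
    using two_grid_values(5) [OF N i(1), of s t] by (intro bexI [of _ "1 + i"]) auto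
next
  case False
  obtain i where i: "i \<le> N" "\<bar>t + real i * ((1 - t) / real N) - r\<bar> \<le> (1 - t) / real N"
    using uniform_grid_near [of t r 1 N] r False N by auto
  moreover have "(1 - t) / real N \<le> 1 / real N" using st N by (simp add: divide_right_mono)
  ultimately show ?thesis
    using two_grid_values(3) [OF N, of s t i] by (intro bexI [of _ "N + 1 + i"]) auto
qed

lemma measurable_crossing_term:
  assumes P: "\<And>j. j \<le> n \<Longrightarrow> (\<lambda>x. P x j) \<in> borel_measurable N" and n: "n = b + m" "1 \<le> n" and k: "k \<le> n"
  shows "(\<lambda>x. crossing_term c b m n k (P x)) \<in> borel_measurable N"
    and "(\<lambda>x. of_bool (same_sign n (P x)) * energy_weight c b m (P x)) \<in> borel_measurable N"
proof -
  have [measurable]: "(\<lambda>x. P x 1) \<in> borel_measurable N" "(\<lambda>x. P x n) \<in> borel_measurable N" "(\<lambda>x. P x k) \<in> borel_measurable N"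
    using P n k by auto
  have [measurable]: "(\<lambda>x. energy_weight c b m (P x)) \<in> borel_measurable N"
    unfolding energy_weight_def using n
    by (intro borel_measurable_exp [THEN measurable_compose [rotated]] borel_measurable_uminus borel_measurable_times
        borel_measurable_const borel_measurable_sum borel_measurable_add borel_measurable_power P) auto
  have "Measurable.pred N (\<lambda>x. first_sign_change k (P x))"
  proof -
    have A: "Measurable.pred N (\<lambda>x. \<forall>j\<in>{1..<k}. 0 < P x 1 * P x j)"
    proof (intro pred_intros_finite)
      fix j assume "j \<in> {1..<k}"
      then have [measurable]: "(\<lambda>x. P x j) \<in> borel_measurable N" using P k by auto
      show "Measurable.pred N (\<lambda>x. 0 < P x 1 * P x j)" by measurable
    qed simp
    have B: "Measurable.pred N (\<lambda>x. P x 1 * P x k \<le> 0)" by measurable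
    show ?thesis unfolding first_sign_change_def by (rule pred_intros_logic(3) [OF A B])
  qed
  then have "(\<lambda>x. if first_sign_change k (P x) then sgn (P x 1) * sgn (P x n) * energy_weight c b m (P x) else 0) \<in> borel_measurable N"
    by measurable
  moreover have "crossing_term c b m n k (P x) = (if first_sign_change k (P x) then sgn (P x 1) * sgn (P x n) * energy_weight c b m (P x) else 0)" for x
    by (simp add: crossing_term_def)
  ultimately show "(\<lambda>x. crossing_term c b m n k (P x)) \<in> borel_measurable N"
    by simp
  have "Measurable.pred N (\<lambda>x. same_sign n (P x))"
    unfolding same_sign_def
  proof (intro pred_intros_finite)
    fix j assume "j \<in> {1..n}"
    then have [measurable]: "(\<lambda>x. P x j) \<in> borel_measurable N" using P by auto
    show "Measurable.pred N (\<lambda>x. 0 < P x 1 * P x j)" by measurable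
  qed auto
  then have "(\<lambda>x. if same_sign n (P x) then energy_weight c b m (P x) else 0) \<in> borel_measurable N"
    by measurable
  moreover have "of_bool (same_sign n (P x)) * energy_weight c b m (P x) = (if same_sign n (P x) then energy_weight c b m (P x) else 0)" for x
    by simp
  ultimately show "(\<lambda>x. of_bool (same_sign n (P x)) * energy_weight c b m (P x)) \<in> borel_measurable N"
    by simp
qed

lemma crossing_term_cong:
  assumes "\<And>j. j \<le> n \<Longrightarrow> p j = q j" "n = b + m" "1 \<le> n" "k \<le> n"
  shows "crossing_term c b m n k p = crossing_term c b m n k q"
proof -
  have "(\<Sum>i<m. (p (b + i))\<^sup>2 + (p (b + Suc i))\<^sup>2) = (\<Sum>i<m. (q (b + i))\<^sup>2 + (q (b + Suc i))\<^sup>2)"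
    using assms by (intro sum.cong) auto
  moreover have "first_sign_change k p = first_sign_change k q"
    using assms unfolding first_sign_change_def by (intro conj_cong ball_cong) auto
  ultimately show ?thesis
    using assms by (simp add: crossing_term_def energy_weight_def)
qed

lemma sum_first_sign_change_le:
  "(\<Sum>k=1..n. of_bool (first_sign_change k p) :: real) \<le> 1"
proof (cases "\<exists>l\<in>{1..n}. first_sign_change l p")
  case True
  then obtain l where l: "l \<in> {1..n}" "first_sign_change l p" by auto
  have "(\<Sum>k=1..n. of_bool (first_sign_change k p) :: real) = (\<Sum>k=1..n. if k = l then 1 else 0)"
    using l by (intro sum.cong refl) (auto dest: first_sign_change_unique [OF l(2)])
  then show ?thesis using l by simp
next
  case False
  then have "(\<Sum>k=1..n. of_bool (first_sign_change k p) :: real) = (\<Sum>k=1..n. 0)"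
    by (intro sum.cong refl) auto
  then show ?thesis by simp
qed

text \<open>A crude bound that holds for every path; summed over \<open>k\<close> it provides the
  constant for dominated convergence, whereas \<open>crossing_term_reflect_bound\<close> provides
  the limit.\<close>

lemma crossing_term_reflect_le:
  assumes c: "c \<ge> 0" and k: "1 \<le> k"
  shows "\<bar>crossing_term c b m n k p + crossing_term c b m n k (reflect_after k p)\<bar> \<le> of_bool (first_sign_change k p) * 2"
proof -
  have fs: "first_sign_change k (reflect_after k p) = first_sign_change k p"
    using k unfolding first_sign_change_def reflect_after_def by (intro conj_cong ball_cong) auto
  have *: "\<bar>sgn x * sgn y * energy_weight c b m q\<bar> \<le> 1" for x y :: real and q
    using energy_weight_bounds [OF c, of b m q] by (auto simp: abs_mult abs_sgn_eq)
  show ?thesis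
  proof (cases "first_sign_change k p")
    case True
    then show ?thesis
      using *[of "p 1" "p n" p] *[of "reflect_after k p 1" "reflect_after k p n" "reflect_after k p"] fs
      by (simp add: crossing_term_def)
  qed (simp add: crossing_term_def fs)
qed

section \<open>Zeros of the path and their almost sure crossings\<close>

context std_brownian_motion
begin

lemma measurable_W [measurable]: "0 \<le> t \<Longrightarrow> W t \<in> borel_measurable M"
  by (rule measurable_at)

lemma continuous_path: "\<omega> \<in> space M \<Longrightarrow> 0 \<le> a \<Longrightarrow> continuous_on {a..b} (\<lambda>t. W t \<omega>)"
  by (rule continuous_on_subset [OF continuous_paths]) auto

lemma AE_W_nonzero:
  assumes "0 < s"
  shows "AE \<omega> in M. W s \<omega> \<noteq> 0"
proof -
  have [measurable]: "W s \<in> borel_measurable M" using assms by simp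
  have "(\<integral>\<^sup>+\<omega>. indicator {0} (W s \<omega>) \<partial>M) = (\<integral>\<^sup>+x. ennreal (normal_density 0 (sqrt s) x) * indicator {0} x \<partial>lborel)"
    by (rule nn_integral_W [OF assms]) simp
  also have "\<dots> = (\<integral>\<^sup>+x. 0 \<partial>(lborel :: real measure))"
  proof (rule nn_integral_cong_AE, rule AE_mp [OF AE_lborel_singleton [of 0]], rule AE_I2, rule impI)
    fix x :: real assume "x \<noteq> 0"
    then show "ennreal (normal_density 0 (sqrt s) x) * indicator {0} x = 0" by simp
  qed
  also have "\<dots> = 0" by simp
  finally have "AE \<omega> in M. indicator {0} (W s \<omega>) = (0 :: ennreal)"
    by (subst (asm) nn_integral_0_iff_AE) auto
  then show ?thesis by eventually_elim (auto simp: indicator_def split: if_splits)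
qed

lemma measurable_INF_path:
  fixes f :: "real \<Rightarrow> real"
  assumes s: "0 \<le> s" "s \<le> 1" and f: "continuous_on UNIV f"
  shows "(\<lambda>\<omega>. INF r\<in>{s..1}. f (W r \<omega>)) \<in> borel_measurable M"
proof (rule borel_measurable_LIMSEQ_real)
  have [measurable]: "f \<in> borel_measurable borel" using f by (rule borel_measurable_continuous_onI)
  show "(\<lambda>N. Min ((\<lambda>i. f (W (s + real i * ((1 - s) / real (Suc N))) \<omega>)) ` {..Suc N})) \<longlonglongrightarrow> (INF r\<in>{s..1}. f (W r \<omega>))"
    if "\<omega> \<in> space M" for \<omega>
    using s continuous_path [OF that s(1), of 1]
    by (intro grid_Min_tendsto_INF continuous_on_compose2 [OF f]) auto
  show "(\<lambda>\<omega>. Min ((\<lambda>i. f (W (s + real i * ((1 - s) / real (Suc N))) \<omega>)) ` {..Suc N})) \<in> borel_measurable M" for N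
  proof (rule borel_measurable_Min)
    fix i
    have "W (s + real i * ((1 - s) / real (Suc N))) \<in> borel_measurable M"
      using s by (intro measurable_at) simp
    then show "(\<lambda>\<omega>. f (W (s + real i * ((1 - s) / real (Suc N))) \<omega>)) \<in> borel_measurable M"
      by measurable
  qed simp
qed

definition no_zero :: "real \<Rightarrow> 'a \<Rightarrow> bool" where
  "no_zero s \<omega> \<longleftrightarrow> (\<forall>r\<in>{s..1}. W r \<omega> \<noteq> 0)"

text \<open>By compactness a continuous path avoids 0 on [s, 1] exactly if the infimum of its
  absolute value is positive, and this infimum is a limit of minima over finite grids.\<close>

lemma measurable_no_zero:
  assumes s: "0 \<le> s" "s \<le> 1"
  shows "Measurable.pred M (no_zero s)"
proof -
  have "no_zero s \<omega> \<longleftrightarrow> 0 < (INF r\<in>{s..1}. \<bar>W r \<omega>\<bar>)" if \<omega>: "\<omega> \<in> space M" for \<omega>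
  proof -
    have c: "continuous_on {s..1} (\<lambda>r. \<bar>W r \<omega>\<bar>)"
      by (intro continuous_intros continuous_path \<omega> s)
    obtain r0 where r0: "r0 \<in> {s..1}" "\<And>r. r \<in> {s..1} \<Longrightarrow> \<bar>W r0 \<omega>\<bar> \<le> \<bar>W r \<omega>\<bar>"
      using continuous_attains_inf [OF compact_Icc _ c] s by auto
    have "(INF r\<in>{s..1}. \<bar>W r \<omega>\<bar>) = \<bar>W r0 \<omega>\<bar>"
      using r0 s by (intro antisym cINF_lower cINF_greatest bdd_belowI2 [of _ 0]) auto
    moreover have "no_zero s \<omega> \<longleftrightarrow> W r0 \<omega> \<noteq> 0"
      using r0 unfolding no_zero_def by (metis abs_0 abs_le_zero_iff)
    ultimately show ?thesis by simp
  qed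
  moreover have [measurable]: "(\<lambda>\<omega>. INF r\<in>{s..1}. \<bar>W r \<omega>\<bar>) \<in> borel_measurable M"
    using s by (intro measurable_INF_path continuous_intros) auto
  ultimately show ?thesis
    by (subst measurable_cong) (assumption, measurable)
qed

text \<open>The minimum over a grid starting at s is c W(s) plus a function of the later increments,
  which are independent of W(s). As the density of W(s) is at most 1 / sqrt (2 pi s), the minimum
  lies in [- \<eta>, \<eta>] with probability at most 2 \<eta> / sqrt (2 pi s), uniformly in the
  grid, so the infimum inherits this bound. The factor \<open>c\<close> treats maxima as minima of -
  W.\<close>

lemma AE_signed_INF_nonzero:
  fixes c :: real
  assumes s: "0 < s" "s \<le> 1" and c: "c \<in> {1, - 1}"
  shows "AE \<omega> in M. (INF r\<in>{s..1}. c * W r \<omega>) \<noteq> 0"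
proof -
  define Z where "Z N \<omega> = Min ((\<lambda>i. c * W (s + real i * ((1 - s) / real (Suc N))) \<omega>) ` {..Suc N})" for N \<omega>
  define I where "I \<omega> = (INF r\<in>{s..1}. c * W r \<omega>)" for \<omega>
  have Im [measurable]: "I \<in> borel_measurable M"
    unfolding I_def using s by (intro measurable_INF_path continuous_intros) auto
  have Wm: "W (s + real i * ((1 - s) / real (Suc N))) \<in> borel_measurable M" for i N
    using s by (intro measurable_at) simp
  have Zm [measurable]: "Z N \<in> borel_measurable M" for N
    unfolding Z_def using Wm by (intro borel_measurable_Min) auto
  have lim: "(\<lambda>N. Z N \<omega>) \<longlonglongrightarrow> I \<omega>" if "\<omega> \<in> space M" for \<omega>
    unfolding Z_def I_def using s that by (intro grid_Min_tendsto_INF continuous_intros continuous_path) auto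
  have Zbound: "(\<integral>\<^sup>+\<omega>. indicator {- \<eta>..\<eta>} (Z N \<omega>) \<partial>M) \<le> ennreal (2 * \<eta> / sqrt (2 * pi * s))" if \<eta>: "\<eta> > 0" for \<eta> N
  proof -
    define \<tau> where "\<tau> j = (if j = 0 then 0 else s + real (j - 1) * ((1 - s) / real (Suc N)))" for j :: nat
    have \<tau>0: "\<tau> 0 = 0" and \<tau>1: "\<tau> 0 < \<tau> (Suc 0)" using s by (simp_all add: \<tau>_def)
    have mono: "mono_on {..Suc (Suc N)} \<tau>"
    proof (rule mono_onI)
      fix i j :: nat assume ij: "i \<le> j"
      have h: "0 \<le> (1 - s) / real (Suc N)" using s by simp
      have r: "real (i - 1) \<le> real (j - 1)" using ij by simp
      have "0 \<le> real (j - 1) * ((1 - s) / real (Suc N))"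
        by (rule mult_nonneg_nonneg [OF of_nat_0_le_iff h])
      with mult_right_mono [OF r h] show "\<tau> i \<le> \<tau> j" using ij s unfolding \<tau>_def by auto
    qed
    \<comment> \<open>All increments but the first. Increment 0 is W(s) itself, the variable whose
      density is integrated.\<close>
    define A where "A = {1..<Suc (Suc N)}"
    define y where "y x = Min ((\<lambda>i. c * (\<Sum>k\<in>{1..<Suc i}. x k)) ` {..Suc N})" for x :: "nat \<Rightarrow> real"
    have ym [measurable]: "y \<in> borel_measurable (PiM A (\<lambda>_. borel))"
      unfolding y_def
      by (intro borel_measurable_Min borel_measurable_times borel_measurable_const borel_measurable_sum measurable_component_singleton)
        (auto simp: A_def)
    have Zy: "Z N \<omega> = c * grid_incr \<tau> 0 \<omega> + y (\<lambda>i\<in>A. grid_incr \<tau> i \<omega>)" if \<omega>: "\<omega> \<in> space M" for \<omega>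
    proof -
      have "c * W (s + real i * ((1 - s) / real (Suc N))) \<omega> = c * grid_incr \<tau> 0 \<omega> + c * (\<Sum>k\<in>{1..<Suc i}. (\<lambda>i\<in>A. grid_incr \<tau> i \<omega>) k)"
        if i: "i \<le> Suc N" for i
      proof -
        have "s + real i * ((1 - s) / real (Suc N)) = \<tau> (Suc i)" by (simp add: \<tau>_def)
        then have "W (s + real i * ((1 - s) / real (Suc N))) \<omega> = (\<Sum>k<Suc i. grid_incr \<tau> k \<omega>)"
          by (simp only: W_eq_sum_grid_incr [of \<tau>, OF \<tau>0 \<omega>, of "Suc i"])
        also have "\<dots> = grid_incr \<tau> 0 \<omega> + (\<Sum>k\<in>{1..<Suc i}. grid_incr \<tau> k \<omega>)"
          by (simp only: lessThan_atLeast0 sum.atLeast_Suc_lessThan [OF zero_less_Suc] One_nat_def)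
        also have "(\<Sum>k\<in>{1..<Suc i}. grid_incr \<tau> k \<omega>) = (\<Sum>k\<in>{1..<Suc i}. (\<lambda>i\<in>A. grid_incr \<tau> i \<omega>) k)"
          using i by (intro sum.cong) (auto simp: A_def)
        finally show ?thesis by (simp only: distrib_left)
      qed
      then have "Z N \<omega> = Min ((\<lambda>i. c * grid_incr \<tau> 0 \<omega> + c * (\<Sum>k\<in>{1..<Suc i}. (\<lambda>i\<in>A. grid_incr \<tau> i \<omega>) k)) ` {..Suc N})"
        unfolding Z_def by (intro arg_cong [where f = Min] image_cong refl) auto
      also have "\<dots> = c * grid_incr \<tau> 0 \<omega> + y (\<lambda>i\<in>A. grid_incr \<tau> i \<omega>)"
      proof -
        have "Min ((\<lambda>i. K + f i) ` {..Suc N}) = K + Min (f ` {..Suc N})" for K and f :: "nat \<Rightarrow> real"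
          using mono_Min_commute [of "\<lambda>x. K + x" "f ` {..Suc N}"] by (simp add: mono_def image_image)
        then show ?thesis unfolding y_def .
      qed
      finally show ?thesis .
    qed
    have "(\<integral>\<^sup>+\<omega>. indicator {- \<eta>..\<eta>} (Z N \<omega>) \<partial>M)
      = (\<integral>\<^sup>+\<omega>. (\<lambda>(x, z). indicator {- \<eta>..\<eta>} (c * z + y x) :: ennreal) (\<lambda>i\<in>A. grid_incr \<tau> i \<omega>, grid_incr \<tau> 0 \<omega>) \<partial>M)"
      by (intro nn_integral_cong) (simp only: Zy prod.case)
    also have "\<dots> = (\<integral>\<^sup>+\<omega>. \<integral>\<^sup>+z. (\<lambda>(x, z). indicator {- \<eta>..\<eta>} (c * z + y x) :: ennreal) (\<lambda>i\<in>A. grid_incr \<tau> i \<omega>, z) * ennreal (normal_density 0 (sqrt (\<tau> (Suc 0) - \<tau> 0)) z) \<partial>lborel \<partial>M)"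
    proof (rule indep_increment_nn_integral [OF \<tau>0 mono])
      show "(\<lambda>(x, z). indicator {- \<eta>..\<eta>} (c * z + y x) :: ennreal) \<in> borel_measurable (PiM A (\<lambda>_. borel) \<Otimes>\<^sub>M borel)"
        by measurable
    qed (use \<tau>1 in \<open>auto simp: A_def\<close>)
    also have "\<dots> \<le> (\<integral>\<^sup>+\<omega>. ennreal (2 * \<eta> / sqrt (2 * pi * s)) \<partial>M)"
    proof (rule nn_integral_mono)
      fix \<omega> assume \<omega>: "\<omega> \<in> space M"
      define q where "q = y (\<lambda>i\<in>A. grid_incr \<tau> i \<omega>)"
      have ts: "\<tau> (Suc 0) - \<tau> 0 = s" by (simp add: \<tau>_def)
      have "normal_density 0 (sqrt s) z \<le> 1 / sqrt (2 * pi * s)" for z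
        using s by (auto simp: normal_density_def divide_simps)
      then have "(\<integral>\<^sup>+z. indicator {- \<eta>..\<eta>} (c * z + q) * ennreal (normal_density 0 (sqrt s) z) \<partial>lborel)
        \<le> (\<integral>\<^sup>+z. indicator {- \<eta>..\<eta>} (c * z + q) * ennreal (1 / sqrt (2 * pi * s)) \<partial>lborel)"
        by (intro nn_integral_mono mult_left_mono ennreal_leI) auto
      also have "\<dots> = (\<integral>\<^sup>+z. indicator {- \<eta>..\<eta>} (q + c * z) \<partial>lborel) * ennreal (1 / sqrt (2 * pi * s))"
        by (subst nn_integral_multc) (measurable, simp add: add.commute)
      also have "(\<integral>\<^sup>+z. indicator {- \<eta>..\<eta>} (q + c * z) \<partial>lborel) = (\<integral>\<^sup>+z. indicator {- \<eta>..\<eta>} z \<partial>lborel)"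
        using c by (subst (2) nn_integral_real_affine [where c = c and t = q]) auto
      also have "\<dots> = ennreal (2 * \<eta>)" using \<eta> by simp
      also have "ennreal (2 * \<eta>) * ennreal (1 / sqrt (2 * pi * s)) = ennreal (2 * \<eta> / sqrt (2 * pi * s))"
        using \<eta> by (subst ennreal_mult' [symmetric]) auto
      finally show "(\<integral>\<^sup>+z. (\<lambda>(x, z). indicator {- \<eta>..\<eta>} (c * z + y x) :: ennreal) (\<lambda>i\<in>A. grid_incr \<tau> i \<omega>, z) * ennreal (normal_density 0 (sqrt (\<tau> (Suc 0) - \<tau> 0)) z) \<partial>lborel)
        \<le> ennreal (2 * \<eta> / sqrt (2 * pi * s))"
        by (simp only: ts q_def prod.case)
    qed
    also have "\<dots> = ennreal (2 * \<eta> / sqrt (2 * pi * s))"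
      by (simp add: emeasure_space_1)
    finally show ?thesis .
  qed
  have "prob {\<omega> \<in> space M. I \<omega> = 0} \<le> 2 * \<eta> / sqrt (2 * pi * s)" if \<eta>: "\<eta> > 0" for \<eta>
  proof -
    have "emeasure M {\<omega> \<in> space M. I \<omega> = 0} = (\<integral>\<^sup>+\<omega>. indicator {\<omega> \<in> space M. I \<omega> = 0} \<omega> \<partial>M)"
      by simp
    \<comment> \<open>Fatou's lemma carries the uniform bound to the limit: where the infimum is 0,
      the grid minima lie in [- \<eta>, \<eta>] eventually.\<close>
    also have "\<dots> \<le> (\<integral>\<^sup>+\<omega>. liminf (\<lambda>N. indicator {- \<eta>..\<eta>} (Z N \<omega>)) \<partial>M)"
    proof (rule nn_integral_mono)
      fix \<omega> assume \<omega>: "\<omega> \<in> space M"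
      show "indicator {\<omega> \<in> space M. I \<omega> = 0} \<omega> \<le> liminf (\<lambda>N. indicator {- \<eta>..\<eta>} (Z N \<omega>) :: ennreal)"
      proof (cases "I \<omega> = 0")
        case True
        then have "\<forall>\<^sub>F N in sequentially. \<bar>Z N \<omega>\<bar> < \<eta>"
          using lim [OF \<omega>] \<eta> by (auto simp: tendsto_iff dist_real_def)
        then have "\<forall>\<^sub>F N in sequentially. (1 :: ennreal) \<le> indicator {- \<eta>..\<eta>} (Z N \<omega>)"
          by eventually_elim (auto simp: indicator_def)
        then have "1 \<le> liminf (\<lambda>N. indicator {- \<eta>..\<eta>} (Z N \<omega>) :: ennreal)"
          by (rule Liminf_bounded)
        then show ?thesis using \<omega> True by simp
      qed simp
    qed
    also have "\<dots> \<le> liminf (\<lambda>N. \<integral>\<^sup>+\<omega>. indicator {- \<eta>..\<eta>} (Z N \<omega>) \<partial>M)"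
      by (rule nn_integral_liminf) measurable
    also have "\<dots> \<le> ennreal (2 * \<eta> / sqrt (2 * pi * s))"
      using Zbound [OF \<eta>] by (intro Liminf_le) auto
    finally have "ennreal (prob {\<omega> \<in> space M. I \<omega> = 0}) \<le> ennreal (2 * \<eta> / sqrt (2 * pi * s))"
      by (simp add: emeasure_eq_measure)
    moreover have "0 \<le> 2 * \<eta> / sqrt (2 * pi * s)" using \<eta> s by simp
    ultimately show ?thesis by (simp only: ennreal_le_iff)
  qed
  note bound = this
  have "prob {\<omega> \<in> space M. I \<omega> = 0} \<le> 0 + e" if "e > 0" for e
    using bound [of "e * sqrt (2 * pi * s) / 2"] that s by simp
  then have "prob {\<omega> \<in> space M. I \<omega> = 0} \<le> 0" by (rule field_le_epsilon)
  then have "prob {\<omega> \<in> space M. I \<omega> = 0} = 0" by (simp add: antisym)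
  then have "AE \<omega> in M. I \<omega> \<noteq> 0"
    using AE_iff_measurable [of "{\<omega> \<in> space M. I \<omega> = 0}" M "\<lambda>\<omega>. I \<omega> \<noteq> 0"] by (simp add: emeasure_eq_measure)
  then show ?thesis by (simp add: I_def)
qed

text \<open>If W(s) > 0 and the path has a zero, its infimum is at most 0 and almost surely not 0,
  hence some value is negative; for W(s) < 0 the same applies to - W. This excludes paths that touch
  0 without crossing, which no grid could detect.\<close>

lemma AE_zero_crosses:
  assumes s: "0 < s" "s \<le> 1"
  shows "AE \<omega> in M. \<not> no_zero s \<omega> \<longrightarrow> (\<exists>r\<in>{s..1}. W s \<omega> * W r \<omega> < 0)"
proof -
  have "AE \<omega> in M. (INF r\<in>{s..1}. 1 * W r \<omega>) \<noteq> 0" "AE \<omega> in M. (INF r\<in>{s..1}. - 1 * W r \<omega>) \<noteq> 0"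
    by (rule AE_signed_INF_nonzero [OF s], simp)+
  then show ?thesis
    using AE_W_nonzero [OF s(1)] AE_space
  proof eventually_elim
    case (elim \<omega>)
    have neg: "\<exists>r\<in>{s..1}. c * W r \<omega> < 0" if c: "(INF r\<in>{s..1}. c * W r \<omega>) \<noteq> 0" and z: "r0 \<in> {s..1}" "W r0 \<omega> = 0" for c r0 :: real
    proof -
      have "compact ((\<lambda>r. c * W r \<omega>) ` {s..1})"
        using s elim(4) by (intro compact_continuous_image continuous_intros continuous_path) auto
      then have bdd: "bdd_below ((\<lambda>r. c * W r \<omega>) ` {s..1})"
        by (simp add: bounded_imp_bdd_below compact_imp_bounded)
      have "(INF r\<in>{s..1}. c * W r \<omega>) \<le> 0"
        using cINF_lower [OF bdd z(1)] z(2) by simp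
      then have "(INF r\<in>{s..1}. c * W r \<omega>) < 0" using c by simp
      then show ?thesis using cINF_less_iff [OF _ bdd, of 0] z(1) by auto
    qed
    show ?case
    proof
      assume "\<not> no_zero s \<omega>"
      then obtain r0 where r0: "r0 \<in> {s..1}" "W r0 \<omega> = 0" by (auto simp: no_zero_def)
      show "\<exists>r\<in>{s..1}. W s \<omega> * W r \<omega> < 0"
      proof (cases "W s \<omega> > 0")
        case True
        then show ?thesis using neg [of 1 r0] elim(1) r0 by (auto simp: mult_less_0_iff)
      next
        case False
        then have "W s \<omega> < 0" using elim(3) by simp
        then show ?thesis using neg [of "- 1" r0] elim(2) r0 by (auto simp: mult_less_0_iff)
      qed
    qed
  qed
qed

end

lemma abs_crossing_term_le:
  assumes "c \<ge> 0"
  shows "\<bar>crossing_term c b m n k p\<bar> \<le> 1"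
proof -
  have "\<bar>sgn (p 1) * sgn (p n)\<bar> * \<bar>energy_weight c b m p\<bar> \<le> 1 * 1"
    using energy_weight_bounds [OF assms, of b m p] by (intro mult_mono) (auto simp: abs_mult abs_sgn_eq)
  then show ?thesis by (simp add: crossing_term_def abs_mult)
qed

lemma sign_value_tendsto:
  assumes a: "(a \<longlongrightarrow> a0) F" "a0 > 0" and \<Theta>: "(\<Theta> \<longlongrightarrow> \<Theta>0) F" "\<Theta>0 > 0"
    and st: "0 < s" "s \<le> t"
  shows "((\<lambda>N. sign_value s t (a N) (\<Theta> N)) \<longlongrightarrow> sign_value s t a0 \<Theta>0) F"
proof -
  have sh: "sinh \<Theta>0 > 0" using \<Theta>(2) by simp
  have C: "a0 * cosh \<Theta>0 / sinh \<Theta>0 > 0" using a(2) sh by simp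
  have "a0 * cosh \<Theta>0 / sinh \<Theta>0 + a0\<^sup>2 * t > 0" using C a(2) st by (simp add: add_pos_pos)
  moreover have "1 + (t - s) * (a0 * cosh \<Theta>0 / sinh \<Theta>0) > 0"
    by (intro add_pos_nonneg mult_nonneg_nonneg less_imp_le [OF C]) (use st in simp_all)
  ultimately have "a0 * cosh \<Theta>0 / sinh \<Theta>0 + a0\<^sup>2 * t \<noteq> 0" "1 + (t - s) * (a0 * cosh \<Theta>0 / sinh \<Theta>0) \<noteq> 0" "sinh \<Theta>0 \<noteq> 0"
    using sh by linarith+
  then show ?thesis
    unfolding sign_value_def
    by (intro tendsto_intros a(1) \<Theta>(1)) (simp_all only: mult_eq_0_iff de_Morgan_disj, simp_all)
qed

lemma tendsto_mehler_step:
  fixes \<alpha> T :: real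
  assumes "\<alpha> > 0" "T > 0"
  shows "(\<lambda>N. sinh (2 * arsinh (\<alpha> * (T / real (Suc N)) / 2)) / (T / real (Suc N))) \<longlonglongrightarrow> \<alpha>"
    and "(\<lambda>N. real (Suc N) * (2 * arsinh (\<alpha> * (T / real (Suc N)) / 2))) \<longlonglongrightarrow> \<alpha> * T"
proof -
  have sh: "sinh (2 * arsinh x) = 2 * x * sqrt (x\<^sup>2 + 1)" for x :: real
    by (simp add: sinh_double cosh_arsinh_real)
  show "(\<lambda>N. sinh (2 * arsinh (\<alpha> * (T / real (Suc N)) / 2)) / (T / real (Suc N))) \<longlonglongrightarrow> \<alpha>"
    unfolding sh using assms by real_asymp
  show "(\<lambda>N. real (Suc N) * (2 * arsinh (\<alpha> * (T / real (Suc N)) / 2))) \<longlonglongrightarrow> \<alpha> * T"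
    unfolding arsinh_real_def using assms by real_asymp
qed

section \<open>From the reflected grid to the continuous path\<close>

context std_brownian_motion
begin

lemma no_zero_same_sign:
  assumes \<omega>: "\<omega> \<in> space M" and s: "0 \<le> s" and nz: "no_zero s \<omega>" and r: "r \<in> {s..1}"
  shows "W s \<omega> * W r \<omega> > 0"
proof (rule ccontr)
  assume "\<not> W s \<omega> * W r \<omega> > 0"
  moreover have "W s \<omega> \<noteq> 0" "W r \<omega> \<noteq> 0" using nz r by (auto simp: no_zero_def)
  ultimately have "W s \<omega> < 0 \<and> 0 < W r \<omega> \<or> W r \<omega> < 0 \<and> 0 < W s \<omega>"
    by (auto simp: zero_less_mult_iff not_less)
  moreover have "continuous_on {s..r} (\<lambda>t. W t \<omega>)" by (rule continuous_path [OF \<omega> s])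
  ultimately obtain x where "s \<le> x" "x \<le> r" "W x \<omega> = 0"
    using IVT' [of "\<lambda>t. W t \<omega>" s 0 r] IVT2' [of "\<lambda>t. W t \<omega>" r 0 s] r by auto
  then show False using nz r by (auto simp: no_zero_def)
qed

lemma measurable_path_energy:
  assumes t: "0 \<le> t" "t \<le> 1"
  shows "(\<lambda>\<omega>. integral {t..1} (\<lambda>u. (W u \<omega>)\<^sup>2)) \<in> borel_measurable M"
proof (cases "t = 1")
  case False
  show ?thesis
  proof (rule borel_measurable_LIMSEQ_real)
    show "(\<lambda>N. trapezoid (\<lambda>u. (W u \<omega>)\<^sup>2) t N) \<longlonglongrightarrow> integral {t..1} (\<lambda>u. (W u \<omega>)\<^sup>2)" if "\<omega> \<in> space M" for \<omega>
      using t False that by (intro trapezoid_tendsto continuous_intros continuous_path) auto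
    show "(\<lambda>\<omega>. trapezoid (\<lambda>u. (W u \<omega>)\<^sup>2) t N) \<in> borel_measurable M" for N
      by (rule measurable_trapezoid [OF t])
  qed
qed simp

lemma path_energy_nonneg: "0 \<le> integral {t..1} (\<lambda>u. (W u \<omega>)\<^sup>2)"
proof (cases "(\<lambda>u. (W u \<omega>)\<^sup>2) integrable_on {t..1}")
  case True
  then show ?thesis by (rule Henstock_Kurzweil_Integration.integral_nonneg) simp
qed (simp add: not_integrable_integral)

text \<open>On a fixed path only one index \<open>k\<close> contributes, and its error is c N times
  the number of weighted steps times the oscillation over one mesh. The first two multiply to
  \<alpha>^2 (1 - t) / 4 for every N, while the oscillation tends to 0 by uniform
  continuity.\<close>

lemma crossing_sum_tendsto_0:
  fixes s t \<alpha> :: real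
  assumes st: "0 < s" "s \<le> t" "t < 1" and \<omega>: "\<omega> \<in> space M" and W1: "W 1 \<omega> \<noteq> 0"
  defines "P \<equiv> \<lambda>N j. W (two_grid s t (Suc N) j) \<omega>"
    and "c \<equiv> \<lambda>N. \<alpha>\<^sup>2 / 4 * ((1 - t) / real (Suc N))"
    and "n \<equiv> \<lambda>N. 2 * Suc N + 1"
  shows "(\<lambda>N. \<Sum>k=1..n N. crossing_term (c N) (Suc N + 1) (Suc N) (n N) k (P N) +
      crossing_term (c N) (Suc N + 1) (Suc N) (n N) k (reflect_after k (P N))) \<longlonglongrightarrow> 0"
proof (rule metric_LIMSEQ_I)
  fix e :: real assume e: "e > 0"
  have cont: "continuous_on {0..1} (\<lambda>u. W u \<omega>)" by (rule continuous_path [OF \<omega>]) simp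
  then have "bounded ((\<lambda>u. W u \<omega>) ` {0..1})"
    by (intro compact_imp_bounded compact_continuous_image) auto
  then obtain K where "K > 0" "\<forall>y\<in>(\<lambda>u. W u \<omega>) ` {0..1}. norm y \<le> K"
    unfolding bounded_pos by blast
  then have K: "\<bar>W u \<omega>\<bar> \<le> K" "K > 0" if "u \<in> {0..1}" for u
    using that by auto
  have K0: "K > 0" by (rule K(2) [of 0]) simp
  define X where "X = 16 * (\<alpha>\<^sup>2 / 4 * (1 - t)) * K"
  have X: "X \<ge> 0" using K0 st by (simp add: X_def)
  \<comment> \<open>The first bound ensures 2 \<epsilon> < |W(1)|, as the reversal of the final sign
    requires; the second makes the error X \<epsilon> less than e, with X + 1 in the denominator
    since X may vanish.\<close>
  define \<epsilon> where "\<epsilon> = min (\<bar>W 1 \<omega>\<bar> / 3) (e / (X + 1))"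
  have "\<epsilon> \<le> \<bar>W 1 \<omega>\<bar> / 3" unfolding \<epsilon>_def by (rule min.cobounded1)
  moreover have "0 < \<bar>W 1 \<omega>\<bar>" using W1 by simp
  ultimately have \<epsilon>: "\<epsilon> > 0" "2 * \<epsilon> < \<bar>W 1 \<omega>\<bar>" using e X by (simp_all add: \<epsilon>_def)
  have "X * \<epsilon> \<le> X * (e / (X + 1))" using X by (intro mult_left_mono) (simp_all add: \<epsilon>_def)
  also have "\<dots> < e" using X e by (simp add: field_simps)
  finally have Xe: "X * \<epsilon> < e" .
  have "uniformly_continuous_on {0..1} (\<lambda>u. W u \<omega>)"
    using cont by (rule compact_uniformly_continuous) simp
  then obtain d where d: "d > 0" "\<And>u v. u \<in> {0..1} \<Longrightarrow> v \<in> {0..1} \<Longrightarrow> dist v u < d \<Longrightarrow> dist (W v \<omega>) (W u \<omega>) < \<epsilon>"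
    unfolding uniformly_continuous_on_def using \<epsilon>(1) by metis
  obtain N0 :: nat where N0: "1 / d < real N0" using reals_Archimedean2 by blast
  show "\<exists>N0. \<forall>N\<ge>N0. dist (\<Sum>k=1..n N. crossing_term (c N) (Suc N + 1) (Suc N) (n N) k (P N) +
      crossing_term (c N) (Suc N + 1) (Suc N) (n N) k (reflect_after k (P N))) 0 < e"
  proof (intro exI [of _ N0] allI impI)
    fix N assume "N \<ge> N0"
    then have "1 / d < real (Suc N)" using N0 by simp
    then have mesh: "1 / real (Suc N) < d" using d(1) by (simp add: field_simps)
    have c0: "c N \<ge> 0" using st by (simp add: c_def)
    have range: "two_grid s t (Suc N) j \<in> {0..1}" if "j \<le> n N" for j
    proof (cases "j = 0")
      case False
      then show ?thesis using two_grid_range [OF st, of "Suc N" j] that st by (auto simp: n_def)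
    qed (simp add: two_grid_def)
    have each: "\<bar>crossing_term (c N) (Suc N + 1) (Suc N) (n N) k (P N) +
      crossing_term (c N) (Suc N + 1) (Suc N) (n N) k (reflect_after k (P N))\<bar>
      \<le> of_bool (first_sign_change k (P N)) * (X * \<epsilon>)" if k: "k \<in> {1..n N}" for k
    proof -
      have "\<bar>crossing_term (c N) (Suc N + 1) (Suc N) (n N) k (P N) +
        crossing_term (c N) (Suc N + 1) (Suc N) (n N) k (reflect_after k (P N))\<bar>
        \<le> of_bool (first_sign_change k (P N)) * (16 * c N * real (Suc N) * \<epsilon> * K)"
      proof (rule crossing_term_reflect_bound [OF _ c0 _ k])
        show "0 \<le> \<epsilon>" using \<epsilon> by simp
        show "n N = Suc N + 1 + Suc N" by (simp add: n_def)
        show "\<bar>P N j\<bar> \<le> K" if "j \<le> n N" for j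
          unfolding P_def by (rule K(1) [OF range [OF that]])
        show "2 * \<epsilon> < \<bar>P N (n N)\<bar>"
          using \<epsilon>(2) two_grid_values(4) [of "Suc N" s t] by (simp only: P_def n_def zero_less_Suc)
        fix j assume j: "1 \<le> j" "j < n N"
        have "\<bar>two_grid s t (Suc N) (Suc j) - two_grid s t (Suc N) j\<bar> < d"
          using two_grid_step [OF st, of "Suc N" j] j mesh by (simp add: n_def)
        then have "dist (W (two_grid s t (Suc N) (Suc j)) \<omega>) (W (two_grid s t (Suc N) j) \<omega>) < \<epsilon>"
          using j by (intro d range) (auto simp: dist_real_def)
        then show "\<bar>P N (Suc j) - P N j\<bar> \<le> \<epsilon>"
          by (simp add: P_def dist_real_def)
      qed
      also have "16 * c N * real (Suc N) * \<epsilon> * K = X * \<epsilon>"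
      proof -
        have "c N * real (Suc N) = \<alpha>\<^sup>2 / 4 * (1 - t)"
          unfolding c_def by (simp del: of_nat_Suc)
        then have "16 * (c N * real (Suc N)) * K * \<epsilon> = X * \<epsilon>" by (simp only: X_def)
        then show ?thesis by (simp only: mult_ac)
      qed
      finally show ?thesis .
    qed
    have "\<bar>\<Sum>k=1..n N. crossing_term (c N) (Suc N + 1) (Suc N) (n N) k (P N) +
      crossing_term (c N) (Suc N + 1) (Suc N) (n N) k (reflect_after k (P N))\<bar>
      \<le> (\<Sum>k=1..n N. of_bool (first_sign_change k (P N)) * (X * \<epsilon>))"
      by (intro order_trans [OF sum_abs] sum_mono each)
    also have "\<dots> = (\<Sum>k=1..n N. of_bool (first_sign_change k (P N))) * (X * \<epsilon>)"
      by (rule sum_distrib_right [symmetric])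
    also have "\<dots> \<le> 1 * (X * \<epsilon>)"
      using X \<epsilon> by (intro mult_right_mono sum_first_sign_change_le) auto
    finally show "dist (\<Sum>k=1..n N. crossing_term (c N) (Suc N + 1) (Suc N) (n N) k (P N) +
      crossing_term (c N) (Suc N + 1) (Suc N) (n N) k (reflect_after k (P N))) 0 < e"
      using Xe by (simp only: dist_real_def diff_zero)
  qed
qed

text \<open>A strict change of sign persists on a neighbourhood of its time, so every sufficiently
  fine grid sees it; conversely a path without zeros keeps its sign by the intermediate value
  theorem.\<close>

lemma same_sign_eventually:
  fixes s t :: real
  assumes st: "0 < s" "s \<le> t" "t < 1" and \<omega>: "\<omega> \<in> space M"
    and cross: "\<not> no_zero s \<omega> \<longrightarrow> (\<exists>r\<in>{s..1}. W s \<omega> * W r \<omega> < 0)"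
  shows "\<forall>\<^sub>F N in sequentially. same_sign (2 * Suc N + 1) (\<lambda>j. W (two_grid s t (Suc N) j) \<omega>) \<longleftrightarrow> no_zero s \<omega>"
proof (cases "no_zero s \<omega>")
  case True
  have "same_sign (2 * Suc N + 1) (\<lambda>j. W (two_grid s t (Suc N) j) \<omega>)" for N
    unfolding same_sign_def
  proof
    fix j assume "j \<in> {1..2 * Suc N + 1}"
    then have "two_grid s t (Suc N) j \<in> {s..1}"
      using two_grid_range [OF st, of "Suc N" j] by simp
    then show "0 < W (two_grid s t (Suc N) 1) \<omega> * W (two_grid s t (Suc N) j) \<omega>"
      unfolding two_grid_values(2) [OF zero_less_Suc] using st True by (intro no_zero_same_sign [OF \<omega>]) auto
  qed
  then show ?thesis using True by simp
next
  case False
  then obtain r where r: "r \<in> {s..1}" "W s \<omega> * W r \<omega> < 0" using cross by auto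
  have "continuous_on {s..1} (\<lambda>u. W s \<omega> * W u \<omega>)"
    using st by (intro continuous_intros continuous_path [OF \<omega>]) auto
  then obtain d where d: "d > 0" "\<And>u. u \<in> {s..1} \<Longrightarrow> dist u r < d \<Longrightarrow> dist (W s \<omega> * W u \<omega>) (W s \<omega> * W r \<omega>) < - (W s \<omega> * W r \<omega>)"
    using r unfolding continuous_on_iff by (metis neg_0_less_iff_less)
  obtain N0 :: nat where N0: "1 / d < real N0" using reals_Archimedean2 by blast
  have "\<not> same_sign (2 * Suc N + 1) (\<lambda>j. W (two_grid s t (Suc N) j) \<omega>)" if "N \<ge> N0" for N
  proof -
    have "1 / d < real (Suc N)" using N0 that by simp
    then have mesh: "1 / real (Suc N) < d" using d(1) by (simp add: field_simps)
    obtain j where j: "j \<in> {1..2 * Suc N + 1}" "\<bar>two_grid s t (Suc N) j - r\<bar> \<le> 1 / real (Suc N)"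
      using two_grid_near [OF st zero_less_Suc r(1)] by blast
    have "two_grid s t (Suc N) j \<in> {s..1}"
      using two_grid_range [OF st, of "Suc N" j] j by simp
    then have "dist (W s \<omega> * W (two_grid s t (Suc N) j) \<omega>) (W s \<omega> * W r \<omega>) < - (W s \<omega> * W r \<omega>)"
      using j mesh by (intro d) (auto simp: dist_real_def)
    then have "W s \<omega> * W (two_grid s t (Suc N) j) \<omega> < 0"
      unfolding dist_real_def abs_less_iff by linarith
    then show ?thesis
      unfolding same_sign_def two_grid_values(2) [OF zero_less_Suc] using j(1) by force
  qed
  then show ?thesis using False by (auto simp: eventually_sequentially)
qed

text \<open>Each crossing term has the same expectation as its reflection and is replaced by the
  mean of the two. Hence the signed expectation is that of \<open>S\<close> + \<open>R\<close> / 2,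
  where \<open>R\<close> tends to 0 along almost every path and \<open>S\<close>, supported on the
  paths of constant sign, tends to the indicator of \<open>no_zero\<close> times the weight.\<close>

lemma expectation_no_zero_limit:
  fixes s t \<alpha> :: real
  assumes st: "0 < s" "s \<le> t" "t < 1"
  shows "(\<lambda>N. expectation (\<lambda>\<omega>. sgn (W s \<omega>) * sgn (W 1 \<omega>) * exp (- (\<alpha>\<^sup>2 / 2) * trapezoid (\<lambda>u. (W u \<omega>)\<^sup>2) t (Suc N))))
    \<longlonglongrightarrow> expectation (\<lambda>\<omega>. of_bool (no_zero s \<omega>) * exp (- (\<alpha>\<^sup>2 / 2) * integral {t..1} (\<lambda>u. (W u \<omega>)\<^sup>2)))"
proof -
  define P where "P N \<omega> j = W (two_grid s t (Suc N) j) \<omega>" for N \<omega> j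
  define c where "c N = \<alpha>\<^sup>2 / 4 * ((1 - t) / real (Suc N))" for N
  define n where "n N = 2 * Suc N + 1" for N
  define ct where "ct N k p = crossing_term (c N) (Suc N + 1) (Suc N) (n N) k p" for N k p
  define R where "R N \<omega> = (\<Sum>k=1..n N. ct N k (P N \<omega>) + ct N k (reflect_after k (P N \<omega>)))" for N \<omega>
  define S where "S N \<omega> = of_bool (same_sign (n N) (P N \<omega>)) * energy_weight (c N) (Suc N + 1) (Suc N) (P N \<omega>)" for N \<omega>
  have c0: "c N \<ge> 0" for N using st by (simp add: c_def)
  have n: "n N = Suc N + 1 + Suc N" "1 \<le> n N" for N by (simp_all add: n_def)
  have tg0: "two_grid s t (Suc N) 0 = 0" for N by (simp add: two_grid_def)
  have mono: "mono_on {..n N} (two_grid s t (Suc N))" for N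
    unfolding n_def by (rule two_grid_mono [OF st]) simp
  have Pm: "(\<lambda>\<omega>. P N \<omega> j) \<in> borel_measurable M" if "j \<le> n N" for N j
    unfolding P_def by (rule measurable_at [OF grid_nonneg [OF tg0 mono that]])
  have Prm: "(\<lambda>\<omega>. reflect_after k (P N \<omega>) j) \<in> borel_measurable M" if "j \<le> n N" "k \<le> n N" for N j k
  proof (cases "j \<le> k")
    case False
    have [measurable]: "(\<lambda>\<omega>. P N \<omega> j) \<in> borel_measurable M" "(\<lambda>\<omega>. P N \<omega> k) \<in> borel_measurable M" using Pm that by auto
    show ?thesis using False by (simp add: reflect_after_def)
  qed (use Pm that in \<open>simp add: reflect_after_def\<close>)
  have ctm: "(\<lambda>\<omega>. ct N k (P N \<omega>)) \<in> borel_measurable M" "(\<lambda>\<omega>. ct N k (reflect_after k (P N \<omega>))) \<in> borel_measurable M"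
    if "k \<in> {1..n N}" for N k
  proof -
    have k: "k \<le> n N" using that by simp
    show "(\<lambda>\<omega>. ct N k (P N \<omega>)) \<in> borel_measurable M"
      unfolding ct_def by (rule measurable_crossing_term(1) [OF Pm n k])
    show "(\<lambda>\<omega>. ct N k (reflect_after k (P N \<omega>))) \<in> borel_measurable M"
      unfolding ct_def by (rule measurable_crossing_term(1) [OF Prm [OF _ k] n k])
  qed
  have Sm: "S N \<in> borel_measurable M" for N
    unfolding S_def by (rule measurable_crossing_term(2) [OF Pm n order.refl])
  have Rm: "R N \<in> borel_measurable M" for N
    unfolding R_def using ctm by (intro borel_measurable_sum borel_measurable_add) auto
  have cti: "integrable M (\<lambda>\<omega>. ct N k (P N \<omega>))" "integrable M (\<lambda>\<omega>. ct N k (reflect_after k (P N \<omega>)))"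
    if "k \<in> {1..n N}" for N k
    using ctm [OF that] abs_crossing_term_le [OF c0] unfolding ct_def
    by (auto intro!: integrable_const_bound [of _ 1])
  have S01: "0 \<le> S N \<omega>" "S N \<omega> \<le> 1" for N \<omega>
    using energy_weight_bounds [OF c0 [of N], of "Suc N + 1" "Suc N" "P N \<omega>"] by (simp_all add: S_def)
  have Si: "integrable M (S N)" for N
    using Sm S01 by (intro integrable_const_bound [of _ 1]) auto
  have Rb: "\<bar>R N \<omega>\<bar> \<le> 2" for N \<omega>
  proof -
    have "\<bar>R N \<omega>\<bar> \<le> (\<Sum>k=1..n N. of_bool (first_sign_change k (P N \<omega>)) * 2)"
      unfolding R_def ct_def by (intro order_trans [OF sum_abs] sum_mono crossing_term_reflect_le c0) auto
    also have "\<dots> = (\<Sum>k=1..n N. of_bool (first_sign_change k (P N \<omega>))) * 2"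
      by (rule sum_distrib_right [symmetric])
    also have "\<dots> \<le> 1 * 2" by (intro mult_right_mono sum_first_sign_change_le) auto
    finally show ?thesis by simp
  qed
  have energy: "energy_weight (c N) (Suc N + 1) (Suc N) (P N \<omega>) = exp (- (\<alpha>\<^sup>2 / 2) * trapezoid (\<lambda>u. (W u \<omega>)\<^sup>2) t (Suc N))" for N \<omega>
  proof -
    have p: "P N \<omega> (Suc N + 1 + i) = W (t + real i * ((1 - t) / real (Suc N))) \<omega>" for i
      unfolding P_def by (subst two_grid_values(3)) simp_all
    show ?thesis
      unfolding energy_weight_def p trapezoid_def c_def by simp
  qed
  have decomp: "expectation (\<lambda>\<omega>. sgn (W s \<omega>) * sgn (W 1 \<omega>) * exp (- (\<alpha>\<^sup>2 / 2) * trapezoid (\<lambda>u. (W u \<omega>)\<^sup>2) t (Suc N)))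
    = expectation (\<lambda>\<omega>. S N \<omega> + R N \<omega> / 2)" for N
  proof -
    have p: "P N \<omega> 1 = W s \<omega>" "P N \<omega> (n N) = W 1 \<omega>" for \<omega>
      unfolding P_def n_def by (simp_all only: two_grid_values(2,4) [OF zero_less_Suc])
    have "expectation (\<lambda>\<omega>. sgn (W s \<omega>) * sgn (W 1 \<omega>) * exp (- (\<alpha>\<^sup>2 / 2) * trapezoid (\<lambda>u. (W u \<omega>)\<^sup>2) t (Suc N)))
      = expectation (\<lambda>\<omega>. S N \<omega> + (\<Sum>k=1..n N. ct N k (P N \<omega>)))"
      unfolding energy [symmetric] p [symmetric] S_def ct_def by (subst sign_decomposition [OF n(2)]) simp
    also have "\<dots> = expectation (S N) + (\<Sum>k=1..n N. expectation (\<lambda>\<omega>. ct N k (P N \<omega>)))"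
      using Si cti by (subst Bochner_Integration.integral_add) (auto intro!: Bochner_Integration.integrable_sum Bochner_Integration.integral_sum)
    also have "(\<Sum>k=1..n N. expectation (\<lambda>\<omega>. ct N k (P N \<omega>)))
      = (\<Sum>k=1..n N. expectation (\<lambda>\<omega>. ct N k (P N \<omega>) + ct N k (reflect_after k (P N \<omega>))) / 2)"
    proof (rule sum.cong [OF refl])
      fix k assume k: "k \<in> {1..n N}"
      have "expectation (\<lambda>\<omega>. ct N k (reflect_after k (\<lambda>j. W (two_grid s t (Suc N) j) \<omega>))) = expectation (\<lambda>\<omega>. ct N k (\<lambda>j. W (two_grid s t (Suc N) j) \<omega>))"
      proof (rule expectation_reflect [OF tg0 mono n(2)])
        show "(\<lambda>x. ct N k (\<lambda>j. \<Sum>i<j. x i)) \<in> borel_measurable (PiM {..<n N} (\<lambda>_. borel :: real measure))"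
          unfolding ct_def using k
          by (intro measurable_crossing_term(1) [OF _ n] borel_measurable_sum measurable_component_singleton) auto
        show "ct N k p = ct N k q" if "\<And>j. j \<le> n N \<Longrightarrow> p j = q j" for p q
          unfolding ct_def using that k by (intro crossing_term_cong [OF _ n]) auto
      qed
      then have "expectation (\<lambda>\<omega>. ct N k (reflect_after k (P N \<omega>))) = expectation (\<lambda>\<omega>. ct N k (P N \<omega>))"
        by (simp add: P_def [abs_def])
      then show "expectation (\<lambda>\<omega>. ct N k (P N \<omega>)) = expectation (\<lambda>\<omega>. ct N k (P N \<omega>) + ct N k (reflect_after k (P N \<omega>))) / 2"
        using cti [OF k] by (subst Bochner_Integration.integral_add) auto
    qed
    also have "\<dots> = expectation (\<lambda>\<omega>. R N \<omega> / 2)"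
      unfolding R_def sum_divide_distrib [symmetric] using cti
      by (subst Bochner_Integration.integral_divide_zero, subst Bochner_Integration.integral_sum) auto
    also have "expectation (S N) + \<dots> = expectation (\<lambda>\<omega>. S N \<omega> + R N \<omega> / 2)"
    proof (rule Bochner_Integration.integral_add [symmetric, OF Si])
      show "integrable M (\<lambda>\<omega>. R N \<omega> / 2)"
        using Rm Rb by (intro Bochner_Integration.integrable_divide integrable_const_bound [of _ 2]) auto
    qed
    finally show ?thesis .
  qed
  show ?thesis
    unfolding decomp
  \<comment> \<open>\<open>S\<close> lies in [0, 1], and |\<open>R\<close>| is at most 2 because at
    most one crossing term of each path differs from 0.\<close>
  proof (rule integral_dominated_convergence [where w = "\<lambda>_. 2"])
    have [measurable]: "Measurable.pred M (no_zero s)" using st by (intro measurable_no_zero) auto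
    have [measurable]: "(\<lambda>\<omega>. integral {t..1} (\<lambda>u. (W u \<omega>)\<^sup>2)) \<in> borel_measurable M"
      using st by (intro measurable_path_energy) auto
    have "(\<lambda>\<omega>. (if no_zero s \<omega> then 1 else 0) * exp (- (\<alpha>\<^sup>2 / 2) * integral {t..1} (\<lambda>u. (W u \<omega>)\<^sup>2))) \<in> borel_measurable M"
      by measurable
    then show "(\<lambda>\<omega>. of_bool (no_zero s \<omega>) * exp (- (\<alpha>\<^sup>2 / 2) * integral {t..1} (\<lambda>u. (W u \<omega>)\<^sup>2))) \<in> borel_measurable M"
      by (simp only: of_bool_def)
    show "(\<lambda>\<omega>. S N \<omega> + R N \<omega> / 2) \<in> borel_measurable M" for N
      using Sm Rm by (intro borel_measurable_add borel_measurable_divide) auto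
    show "AE \<omega> in M. norm (S N \<omega> + R N \<omega> / 2) \<le> 2" for N
    proof (rule AE_I2)
      fix \<omega>
      show "norm (S N \<omega> + R N \<omega> / 2) \<le> 2"
        using S01 [of N \<omega>] Rb [of N \<omega>] unfolding real_norm_def abs_le_iff by linarith
    qed
    show "AE \<omega> in M. (\<lambda>N. S N \<omega> + R N \<omega> / 2) \<longlonglongrightarrow> of_bool (no_zero s \<omega>) * exp (- (\<alpha>\<^sup>2 / 2) * integral {t..1} (\<lambda>u. (W u \<omega>)\<^sup>2))"
      using AE_zero_crosses [OF st(1) less_imp_le [OF order_le_less_trans [OF st(2,3)]]] AE_W_nonzero [of 1, OF zero_less_one] AE_space
    proof eventually_elim
      case (elim \<omega>)
      have "(\<lambda>N. R N \<omega>) \<longlonglongrightarrow> 0"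
        unfolding R_def ct_def P_def [abs_def] c_def n_def
        by (rule crossing_sum_tendsto_0 [OF st elim(3,2)])
      then have 1: "(\<lambda>N. R N \<omega> / 2) \<longlonglongrightarrow> 0 / 2" by (intro tendsto_divide tendsto_const) auto
      have "(\<lambda>N. trapezoid (\<lambda>u. (W u \<omega>)\<^sup>2) t (Suc N)) \<longlonglongrightarrow> integral {t..1} (\<lambda>u. (W u \<omega>)\<^sup>2)"
        using st by (intro LIMSEQ_Suc trapezoid_tendsto continuous_intros continuous_path elim(3)) auto
      then have 2: "(\<lambda>N. energy_weight (c N) (Suc N + 1) (Suc N) (P N \<omega>)) \<longlonglongrightarrow> exp (- (\<alpha>\<^sup>2 / 2) * integral {t..1} (\<lambda>u. (W u \<omega>)\<^sup>2))"
        unfolding energy by (intro tendsto_intros)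
      have "\<forall>\<^sub>F N in sequentially. same_sign (n N) (P N \<omega>) = no_zero s \<omega>"
        using same_sign_eventually [OF st elim(3,1)] by (simp add: n_def P_def [abs_def])
      then have "\<forall>\<^sub>F N in sequentially. (of_bool (same_sign (n N) (P N \<omega>)) :: real) = of_bool (no_zero s \<omega>)"
        by eventually_elim simp
      then have 3: "(\<lambda>N. of_bool (same_sign (n N) (P N \<omega>)) :: real) \<longlonglongrightarrow> of_bool (no_zero s \<omega>)"
        by (rule tendsto_eventually)
      show ?case
        using tendsto_add [OF tendsto_mult [OF 3 2] 1] by (simp add: S_def)
    qed
  qed auto
qed

text \<open>The same grid expectations have two limits: one by reflection, the other from their
  exact value as the frequency tends to \<alpha> and the total angle to \<alpha> (1 - t).\<close>

lemma expectation_no_zero_energy: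
  fixes s t \<alpha> :: real
  assumes st: "0 < s" "s \<le> t" "t < 1" and \<alpha>: "\<alpha> > 0"
  shows "expectation (\<lambda>\<omega>. of_bool (no_zero s \<omega>) * exp (- (\<alpha>\<^sup>2 / 2) * integral {t..1} (\<lambda>u. (W u \<omega>)\<^sup>2)))
    = sign_value s t \<alpha> (\<alpha> * (1 - t))"
proof (rule LIMSEQ_unique [OF expectation_no_zero_limit [OF st]])
  have "(\<lambda>N. sign_value s t (sinh (2 * arsinh (\<alpha> * ((1 - t) / real (Suc N)) / 2)) / ((1 - t) / real (Suc N)))
      (real (Suc N) * (2 * arsinh (\<alpha> * ((1 - t) / real (Suc N)) / 2)))) \<longlonglongrightarrow> sign_value s t \<alpha> (\<alpha> * (1 - t))"
    using st \<alpha> by (intro sign_value_tendsto tendsto_mehler_step) auto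
  then show "(\<lambda>N. expectation (\<lambda>\<omega>. sgn (W s \<omega>) * sgn (W 1 \<omega>) * exp (- (\<alpha>\<^sup>2 / 2) * trapezoid (\<lambda>u. (W u \<omega>)\<^sup>2) t (Suc N))))
    \<longlonglongrightarrow> sign_value s t \<alpha> (\<alpha> * (1 - t))"
    by (subst expectation_sign_trapezoid [OF st \<alpha>]) simp_all
qed

end

text \<open>Serves the explicit primitive in \<open>laplace_hit_density\<close>. The distribution
  function is expanded from x - 1, so that an integral over a compact interval is
  differentiated.\<close>

lemma DERIV_std_normal_cdf:
  "(cdf std_normal_distribution has_real_derivative std_normal_density x) (at x)"
proof -
  interpret real_distribution std_normal_distribution
    by (rule real_dist_normal_dist)
  have eq: "cdf std_normal_distribution y = cdf std_normal_distribution (x - 1) + integral {x - 1..y} std_normal_density"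
    if "y \<in> {x - 1..x + 1}" for y
  proof (cases "y = x - 1")
    case False
    with that have y: "x - 1 < y" by simp
    have int: "set_integrable lborel {x - 1<..y} std_normal_density"
      unfolding set_integrable_def by (rule integrable_mult_indicator) auto
    have "cdf std_normal_distribution y - cdf std_normal_distribution (x - 1)
       = measure std_normal_distribution {x - 1<..y}"
      by (rule cdf_diff_eq [OF y])
    also have "\<dots> = (LINT z:{x - 1<..y}|lborel. std_normal_density z)"
    proof -
      have "emeasure std_normal_distribution {x - 1<..y} = ennreal (LINT z:{x - 1<..y}|lborel. std_normal_density z)"
        using int by (simp add: emeasure_density set_integrable_def set_lebesgue_integral_def
            nn_integral_eq_integral [symmetric] nn_integral_set_ennreal mult.commute)
      then show ?thesis
        by (simp add: measure_def set_lebesgue_integral_def integral_nonneg_AE)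
    qed
    also have "\<dots> = integral {x - 1<..y} std_normal_density"
      by (rule set_borel_integral_eq_integral(2) [OF int])
    also have "\<dots> = integral {x - 1..y} std_normal_density"
      by (rule integral_subset_negligible) (auto intro: negligible_subset [of "{x - 1}"])
    finally show ?thesis by simp
  qed auto
  have "((\<lambda>y. integral {x - 1..y} std_normal_density) has_real_derivative std_normal_density x) (at x within {x - 1..x + 1})"
    by (rule integral_has_real_derivative) (auto simp: normal_density_def intro!: continuous_intros)
  then have "((\<lambda>y. cdf std_normal_distribution (x - 1) + integral {x - 1..y} std_normal_density) has_real_derivative std_normal_density x) (at x within {x - 1..x + 1})"
    by (auto intro!: derivative_eq_intros)
  then have "(cdf std_normal_distribution has_real_derivative std_normal_density x) (at x within {x - 1..x + 1})"
    by (rule has_field_derivative_transform_within [where d = 1]) (simp, simp, rule eq [symmetric])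
  moreover have "at x within {x - 1..x + 1} = at x"
    by (rule at_within_interior) (simp add: interior_atLeastAtMost_real)
  ultimately show ?thesis by simp
qed

section \<open>Inversion of the Laplace transform\<close>

definition hit_density :: "real \<Rightarrow> real \<Rightarrow> real" where
  "hit_density b v = (if v > 0 then b / sqrt (2 * pi * v ^ 3) * exp (- b\<^sup>2 / (2 * v)) else 0)"

lemma measurable_hit_density [measurable (raw)]:
  assumes [measurable]: "f \<in> borel_measurable N" "g \<in> borel_measurable N"
  shows "(\<lambda>w. hit_density (f w) (g w)) \<in> borel_measurable N"
  unfolding hit_density_def by measurable

text \<open>The primitive \<open>F\<close> comes from Brownian motion with drift c: exp (b c) times
  F is the distribution function of its hitting time of level b. Its limits at 0 and at infinity
  give the integral; in the derivative both exponentials combine to the same factor, and the terms c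
  / (2 s) cancel.\<close>

lemma laplace_hit_density:
  fixes b c :: real
  assumes b: "b > 0" and c: "c > 0"
  shows "(\<integral>\<^sup>+v. ennreal (hit_density b v) * ennreal (exp (- (c\<^sup>2 / 2) * v)) \<partial>lborel) = ennreal (exp (- b * c))"
proof -
  interpret real_distribution std_normal_distribution
    by (rule real_dist_normal_dist)
  let ?N = "cdf std_normal_distribution"
  define F where "F v = exp (- b * c) * ?N (c * sqrt v - b / sqrt v) + exp (b * c) * ?N (- (c * sqrt v) - b / sqrt v)" for v
  define f where "f v = b / sqrt (2 * pi * v ^ 3) * exp (- b\<^sup>2 / (2 * v)) * exp (- (c\<^sup>2 / 2) * v)" for v
  have deriv: "(F has_real_derivative f v) (at v)" if v: "v > 0" for v
  proof -
    define s where "s = sqrt v"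
    have s: "s > 0" "s * s = v" using v by (simp_all add: s_def)
    have d1: "((\<lambda>v. c * sqrt v - b / sqrt v) has_real_derivative (c / (2 * s) + b / (2 * s ^ 3))) (at v)"
      unfolding s_def using v
      by (auto intro!: derivative_eq_intros simp: field_simps power3_eq_cube)
    have d2: "((\<lambda>v. - (c * sqrt v) - b / sqrt v) has_real_derivative (- c / (2 * s) + b / (2 * s ^ 3))) (at v)"
      unfolding s_def using v
      by (auto intro!: derivative_eq_intros simp: field_simps power3_eq_cube)
    have D: "(F has_real_derivative
        exp (- b * c) * (std_normal_density (c * sqrt v - b / sqrt v) * (c / (2 * s) + b / (2 * s ^ 3))) +
        exp (b * c) * (std_normal_density (- (c * sqrt v) - b / sqrt v) * (- c / (2 * s) + b / (2 * s ^ 3)))) (at v)"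
      unfolding F_def
      by (intro DERIV_add DERIV_cmult DERIV_chain2 [OF DERIV_std_normal_cdf d1] DERIV_chain2 [OF DERIV_std_normal_cdf d2])
    define E where "E = exp (- (c\<^sup>2 * s\<^sup>2 + b\<^sup>2 / s\<^sup>2) / 2)"
    have e1: "exp (- b * c) * std_normal_density (c * sqrt v - b / sqrt v) = 1 / sqrt (2 * pi) * E"
    proof -
      have "- b * c + - (c * s - b / s)\<^sup>2 / 2 = - (c\<^sup>2 * s\<^sup>2 + b\<^sup>2 / s\<^sup>2) / 2"
        using s(1) by (simp add: power2_eq_square field_simps)
      then show ?thesis
        unfolding std_normal_density_def s_def [symmetric] E_def by (simp add: exp_add [symmetric])
    qed
    have e2: "exp (b * c) * std_normal_density (- (c * sqrt v) - b / sqrt v) = 1 / sqrt (2 * pi) * E"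
    proof -
      have "b * c + - (- (c * s) - b / s)\<^sup>2 / 2 = - (c\<^sup>2 * s\<^sup>2 + b\<^sup>2 / s\<^sup>2) / 2"
        using s(1) by (simp add: power2_eq_square field_simps)
      then show ?thesis
        unfolding std_normal_density_def s_def [symmetric] E_def by (simp add: exp_add [symmetric])
    qed
    have e3: "f v = 1 / sqrt (2 * pi) * E * (b / s ^ 3)"
    proof -
      have "sqrt (v ^ 3) = s ^ 3" by (simp add: s_def real_sqrt_power)
      moreover have "- b\<^sup>2 / (2 * v) + - (c\<^sup>2 / 2) * v = - (c\<^sup>2 * s\<^sup>2 + b\<^sup>2 / s\<^sup>2) / 2"
        using s(1) unfolding s(2) [symmetric] by (simp add: power2_eq_square field_simps)
      then have "exp (- b\<^sup>2 / (2 * v)) * exp (- (c\<^sup>2 / 2) * v) = E"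
        unfolding E_def exp_add [symmetric] by simp
      ultimately show ?thesis
        unfolding f_def by (simp add: real_sqrt_mult mult.assoc)
    qed
    have "exp (- b * c) * (std_normal_density (c * sqrt v - b / sqrt v) * (c / (2 * s) + b / (2 * s ^ 3))) +
        exp (b * c) * (std_normal_density (- (c * sqrt v) - b / sqrt v) * (- c / (2 * s) + b / (2 * s ^ 3)))
      = 1 / sqrt (2 * pi) * E * (c / (2 * s) + b / (2 * s ^ 3)) + 1 / sqrt (2 * pi) * E * (- c / (2 * s) + b / (2 * s ^ 3))"
      unfolding mult.assoc [symmetric] e1 e2 ..
    also have "\<dots> = f v"
      unfolding e3 distrib_left [symmetric] by simp
    finally show ?thesis using D by simp
  qed
  have lim0: "((F \<circ> real_of_ereal) \<longlongrightarrow> 0) (at_right (ereal 0))"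
  proof -
    have "filterlim (\<lambda>v::real. c * sqrt v - b / sqrt v) at_bot (at_right 0)"
      "filterlim (\<lambda>v::real. - (c * sqrt v) - b / sqrt v) at_bot (at_right 0)"
      using b c by real_asymp+
    then have "(F \<longlongrightarrow> exp (- b * c) * 0 + exp (b * c) * 0) (at_right 0)"
      unfolding F_def
      by (intro tendsto_intros filterlim_compose [OF cdf_lim_at_bot])
    then show ?thesis by (simp add: ereal_tendsto_simps)
  qed
  have liminf: "((F \<circ> real_of_ereal) \<longlongrightarrow> exp (- b * c)) (at_left \<infinity>)"
  proof -
    have "filterlim (\<lambda>v::real. c * sqrt v - b / sqrt v) at_top at_top"
      "filterlim (\<lambda>v::real. - (c * sqrt v) - b / sqrt v) at_bot at_top"
      using b c by real_asymp+
    then have "(F \<longlongrightarrow> exp (- b * c) * 1 + exp (b * c) * 0) at_top"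
      unfolding F_def
      by (intro tendsto_intros filterlim_compose [OF cdf_lim_at_bot] filterlim_compose [OF cdf_lim_at_top_prob])
    then show ?thesis by (simp add: ereal_tendsto_simps)
  qed
  have cont: "isCont f v" if "v > 0" for v
    unfolding f_def using that by (auto intro!: continuous_intros)
  have nn: "0 \<le> f v" if "v > 0" for v
    using that b by (simp add: f_def)
  have int: "set_integrable lborel (einterval (ereal 0) \<infinity>) f" "(LBINT x=ereal 0..\<infinity>. f x) = exp (- b * c) - 0"
    using deriv cont nn lim0 liminf
    by (intro interval_integral_FTC_nonneg [of "ereal 0" \<infinity> F f]; auto)+
  have "(\<integral>\<^sup>+v. ennreal (hit_density b v) * ennreal (exp (- (c\<^sup>2 / 2) * v)) \<partial>lborel)
      = (\<integral>\<^sup>+v. ennreal (indicator {0<..} v * f v) \<partial>lborel)"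
    using b by (intro nn_integral_cong)
      (simp add: hit_density_def f_def indicator_def ennreal_mult' [symmetric] less_imp_le)
  also have "\<dots> = ennreal (exp (- b * c))"
    using int nn unfolding set_integrable_def interval_lebesgue_integral_def set_lebesgue_integral_def
    by (subst nn_integral_eq_integral) (auto simp: indicator_def split: if_splits)
  finally show ?thesis .
qed

lemma nn_integral_powr_exp:
  fixes a s :: real
  assumes a: "a > 0" and s: "s > 0"
  shows "(\<integral>\<^sup>+x. ennreal (indicator {0..} x * (x powr (s - 1) * exp (- a * x))) \<partial>lborel) = ennreal (Gamma s * a powr - s)"
proof -
  have "ennreal (Gamma s) = \<bar>a\<bar> * (\<integral>\<^sup>+x. ennreal (indicator {0..} (0 + a * x) * (0 + a * x) powr (s - 1) / exp (0 + a * x)) \<partial>lborel)"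
    unfolding Gamma_conv_nn_integral_real [OF s]
    using a by (intro nn_integral_real_affine) auto
  also have "\<dots> = (\<integral>\<^sup>+x. ennreal a * ennreal (indicator {0..} (0 + a * x) * (0 + a * x) powr (s - 1) / exp (0 + a * x)) \<partial>lborel)"
    using a by (simp add: nn_integral_cmult)
  also have "\<dots> = (\<integral>\<^sup>+x. ennreal (a powr s) * ennreal (indicator {0..} x * (x powr (s - 1) * exp (- a * x))) \<partial>lborel)"
  proof (rule nn_integral_cong)
    fix x :: real
    have "a * (a * x) powr (s - 1) / exp (a * x) = a powr s * (x powr (s - 1) * exp (- a * x))" if "x \<ge> 0"
      using a that by (simp add: powr_mult powr_diff exp_minus field_simps)
    then show "ennreal a * ennreal (indicator {0..} (0 + a * x) * (0 + a * x) powr (s - 1) / exp (0 + a * x))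
      = ennreal (a powr s) * ennreal (indicator {0..} x * (x powr (s - 1) * exp (- a * x)))"
      using a by (auto simp: indicator_def ennreal_mult' [symmetric] zero_le_mult_iff)
  qed
  also have "\<dots> = ennreal (a powr s) * (\<integral>\<^sup>+x. ennreal (indicator {0..} x * (x powr (s - 1) * exp (- a * x))) \<partial>lborel)"
    by (rule nn_integral_cmult) measurable
  finally have G: "ennreal (Gamma s) = ennreal (a powr s) * (\<integral>\<^sup>+x. ennreal (indicator {0..} x * (x powr (s - 1) * exp (- a * x))) \<partial>lborel)"
    (is "_ = _ * ?I") .
  have one: "ennreal (a powr - s) * ennreal (a powr s) = 1"
    using a by (simp add: ennreal_mult' [symmetric] powr_add [symmetric])
  have "ennreal (Gamma s * a powr - s) = ennreal (a powr - s) * ennreal (Gamma s)"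
    using Gamma_real_pos [OF s] by (subst mult.commute) (rule ennreal_mult', simp)
  also have "\<dots> = ennreal (a powr - s) * ennreal (a powr s) * ?I"
    unfolding G mult.assoc ..
  finally show ?thesis unfolding one by simp
qed

text \<open>
  Pushing the measures \<open>f v exp (- v) dv\<close> and \<open>g v exp (- v) dv\<close> forward under \<open>v \<mapsto> exp (- v)\<close> turns the
  hypothesis into equality of all moments of two measures on the unit interval.
\<close>

lemma laplace_transform_unique:
  fixes f g :: "real \<Rightarrow> ennreal"
  assumes [measurable]: "f \<in> borel_measurable borel" "g \<in> borel_measurable borel"
    and supp: "\<And>v. v \<le> 0 \<Longrightarrow> f v = 0" "\<And>v. v \<le> 0 \<Longrightarrow> g v = 0"
    and eq: "\<And>n::nat. n \<ge> 1 \<Longrightarrow> (\<integral>\<^sup>+v. f v * ennreal (exp (- real n * v)) \<partial>lborel) = (\<integral>\<^sup>+v. g v * ennreal (exp (- real n * v)) \<partial>lborel)"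
    and fin: "(\<integral>\<^sup>+v. f v * ennreal (exp (- v)) \<partial>lborel) < \<infinity>"
  shows "AE v in lborel. f v = g v"
proof -
  define m where "m = (\<integral>\<^sup>+v. f v * ennreal (exp (- v)) \<partial>lborel)"
  have m2: "m = (\<integral>\<^sup>+v. g v * ennreal (exp (- v)) \<partial>lborel)"
    using eq [of 1] by (simp add: m_def)
  show ?thesis
  \<comment> \<open>A total mass of 0 cannot be normalised to a probability; in that case both
    functions vanish almost everywhere.\<close>
  proof (cases "m = 0")
    case True
    then have "(\<integral>\<^sup>+v. f v * ennreal (exp (- v)) \<partial>lborel) = 0" "(\<integral>\<^sup>+v. g v * ennreal (exp (- v)) \<partial>lborel) = 0"
      unfolding m2 [symmetric] m_def [symmetric] by assumption+
    moreover have "AE v in lborel. h v = 0"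
      if [measurable]: "h \<in> borel_measurable borel" and "(\<integral>\<^sup>+v. h v * ennreal (exp (- v)) \<partial>lborel) = 0" for h
      using that(2) nn_integral_0_iff_AE [of "\<lambda>v. h v * ennreal (exp (- v))" lborel] by simp
    ultimately have "AE v in lborel. f v = 0" "AE v in lborel. g v = 0"
      by simp_all
    then show ?thesis by eventually_elim simp
  next
    case False
    define D where "D h = density lborel (\<lambda>v. h v * ennreal (exp (- v)) / m)" for h :: "real \<Rightarrow> ennreal"
    define R where "R h = distr (D h) borel (\<lambda>v. exp (- v))" for h :: "real \<Rightarrow> ennreal"
    have mfin: "m \<noteq> \<infinity>" using fin by (simp add: m_def)
    have nnD: "(\<integral>\<^sup>+x. k x \<partial>D h) = (\<integral>\<^sup>+v. h v * ennreal (exp (- v)) * k v \<partial>lborel) / m"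
      if [measurable]: "h \<in> borel_measurable borel" "k \<in> borel_measurable borel" for h k :: "real \<Rightarrow> ennreal"
    proof -
      have "(\<integral>\<^sup>+x. k x \<partial>D h) = (\<integral>\<^sup>+v. h v * ennreal (exp (- v)) * k v / m \<partial>lborel)"
        unfolding D_def by (subst nn_integral_density) (auto simp: divide_ennreal_def mult_ac)
      then show ?thesis by (simp add: nn_integral_divide)
    qed
    have facts: "real_distribution (R h)" "\<And>n. integrable (R h) (\<lambda>x. x ^ n)"
      "\<And>n. ennreal (integral\<^sup>L (R h) (\<lambda>x. x ^ n)) = (\<integral>\<^sup>+v. h v * ennreal (exp (- real (Suc n) * v)) \<partial>lborel) / m"
      "\<And>n. 0 \<le> integral\<^sup>L (R h) (\<lambda>x. x ^ n)" "\<And>n. integral\<^sup>L (R h) (\<lambda>x. \<bar>x\<bar> ^ n) \<le> 1"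
      if [measurable]: "h \<in> borel_measurable borel" and h0: "\<forall>v\<le>0. h v = 0"
        and mh: "m = (\<integral>\<^sup>+v. h v * ennreal (exp (- v)) \<partial>lborel)" for h
    proof -
      have setsD [measurable_cong]: "sets (D h) = sets borel" by (simp add: D_def)
      have "prob_space (D h)"
      proof
        have "emeasure (D h) (space (D h)) = (\<integral>\<^sup>+x. 1 \<partial>D h)" by simp
        also have "\<dots> = m / m" by (subst nnD) (simp_all add: mh)
        finally show "emeasure (D h) (space (D h)) = 1"
          using False mfin by (simp add: ennreal_divide_self less_top)
      qed
      then interpret D: prob_space "D h" .
      show rd: "real_distribution (R h)"
        unfolding R_def by (rule D.real_distribution_distr) measurable
      interpret R: real_distribution "R h" by (rule rd)
      have "AE v in D h. v > 0"
        unfolding D_def by (subst AE_density, simp, intro AE_I2 impI, rule ccontr, simp add: h0 not_less)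
      then have "AE v in D h. exp (- v) \<in> {0..1}"
        by eventually_elim auto
      then have AE: "AE x in R h. x \<in> {0..1}"
        unfolding R_def by (subst AE_distr_iff) auto
      have AEn: "AE x in R h. \<bar>x ^ n\<bar> \<le> 1" "AE x in R h. 0 \<le> x ^ n" "AE x in R h. \<bar>x\<bar> ^ n \<le> 1" for n
        using AE by (eventually_elim, auto simp: power_le_one power_abs [symmetric])+
      show int: "integrable (R h) (\<lambda>x. x ^ n)" for n
        using AEn(1) [of n] by (intro R.integrable_const_bound [of _ 1]) auto
      show "0 \<le> integral\<^sup>L (R h) (\<lambda>x. x ^ n)" for n
        using AEn(2) [of n] by (rule integral_nonneg_AE)
      show "integral\<^sup>L (R h) (\<lambda>x. \<bar>x\<bar> ^ n) \<le> 1" for n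
      proof -
        have "integrable (R h) (\<lambda>x. \<bar>x\<bar> ^ n)"
          using integrable_abs [OF int [of n]] by (simp only: power_abs)
        then have "integral\<^sup>L (R h) (\<lambda>x. \<bar>x\<bar> ^ n) \<le> integral\<^sup>L (R h) (\<lambda>_. 1)"
          using AEn(3) [of n] by (rule integral_mono_AE [OF _ R.integrable_const])
        then show ?thesis using R.prob_space by simp
      qed
      show "ennreal (integral\<^sup>L (R h) (\<lambda>x. x ^ n)) = (\<integral>\<^sup>+v. h v * ennreal (exp (- real (Suc n) * v)) \<partial>lborel) / m" for n
      proof -
        have "ennreal (integral\<^sup>L (R h) (\<lambda>x. x ^ n)) = (\<integral>\<^sup>+x. ennreal (x ^ n) \<partial>R h)"
          using int AEn(2) by (rule nn_integral_eq_integral [symmetric])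
        also have "\<dots> = (\<integral>\<^sup>+v. ennreal (exp (- v) ^ n) \<partial>D h)"
          unfolding R_def by (rule nn_integral_distr) auto
        also have "\<dots> = (\<integral>\<^sup>+v. h v * ennreal (exp (- v)) * ennreal (exp (- v) ^ n) \<partial>lborel) / m"
          by (rule nnD) auto
        also have "(\<lambda>v. h v * ennreal (exp (- v)) * ennreal (exp (- v) ^ n)) = (\<lambda>v. h v * ennreal (exp (- real (Suc n) * v)))"
          by (rule ext) (simp add: mult.assoc ennreal_mult' [symmetric] exp_of_nat_mult [symmetric] exp_add [symmetric] algebra_simps)
        finally show ?thesis .
      qed
    qed
    have supp': "\<forall>v\<le>0. f v = 0" "\<forall>v\<le>0. g v = 0"
      using supp by simp_all
    note ff = facts [OF assms(1) supp'(1) m_def] and gg = facts [OF assms(2) supp'(2) m2]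
    have mom: "integral\<^sup>L (R f) (\<lambda>x. x ^ n) = integral\<^sup>L (R g) (\<lambda>x. x ^ n)" for n
    proof -
      have "(\<integral>\<^sup>+v. f v * ennreal (exp (- real (Suc n) * v)) \<partial>lborel) = (\<integral>\<^sup>+v. g v * ennreal (exp (- real (Suc n) * v)) \<partial>lborel)"
        by (rule eq) simp
      then have "ennreal (integral\<^sup>L (R f) (\<lambda>x. x ^ n)) = ennreal (integral\<^sup>L (R g) (\<lambda>x. x ^ n))"
        unfolding ff(3) gg(3) by (rule arg_cong)
      then show ?thesis using ff(4) [of n] gg(4) [of n] by simp
    qed
    have "R f = R g"
    proof (rule Levy_uniqueness [OF ff(1) gg(1) ext])
      fix t :: real
      \<comment> \<open>Equal moments give equal Taylor polynomials of the characteristic functions.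
        Each remainder is at most 2 |t|^n / n!, because the absolute moments on the unit interval
        are at most 1.\<close>
      have bound: "cmod (char (R f) t - char (R g) t) \<le> 4 * \<bar>t\<bar> ^ n / fact n" for n
      proof -
        have *: "2 * \<bar>t\<bar> ^ n / fact n * integral\<^sup>L (R h) (\<lambda>x. \<bar>x\<bar> ^ n) \<le> 2 * \<bar>t\<bar> ^ n / fact n"
          if "integral\<^sup>L (R h) (\<lambda>x. \<bar>x\<bar> ^ n) \<le> 1" for h
          using that by (intro mult_left_le) auto
        show ?thesis
          using norm_triangle_ineq4 [of "char (R f) t - (\<Sum>k\<le>n. ((\<i> * t)^k / fact k) * integral\<^sup>L (R f) (\<lambda>x. x^k))"
              "char (R g) t - (\<Sum>k\<le>n. ((\<i> * t)^k / fact k) * integral\<^sup>L (R g) (\<lambda>x. x^k))"]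
            real_distribution.char_approx1 [where n = n and t = t, OF ff(1) ff(2)] * [OF ff(5) [of n]]
            real_distribution.char_approx1 [where n = n and t = t, OF gg(1) gg(2)] * [OF gg(5) [of n]]
          by (simp add: mom)
      qed
      have "(\<lambda>n. 4 * (\<bar>t\<bar> ^ n / fact n)) \<longlonglongrightarrow> 4 * 0"
        using summable_LIMSEQ_zero [OF summable_exp [of "\<bar>t\<bar>"]]
        by (intro tendsto_mult_left) (simp add: divide_inverse mult.commute)
      then have "cmod (char (R f) t - char (R g) t) \<le> 0"
        using bound by (intro Lim_bounded2 [where f = "\<lambda>n. 4 * (\<bar>t\<bar> ^ n / fact n)" and N = 0]) auto
      then show "char (R f) t = char (R g) t" by simp
    qed
    \<comment> \<open>Minus the logarithm undoes the push-forward, so the weighted densities on the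
      line agree as well.\<close>
    moreover have "distr (R h) borel (\<lambda>x. - ln x) = D h" for h
    proof -
      have "distr (R h) borel (\<lambda>x. - ln x) = distr (D h) borel (\<lambda>v. v)"
        unfolding R_def by (subst distr_distr) (auto simp: D_def comp_def)
      also have "\<dots> = D h" by (rule distr_id2) (simp add: D_def)
      finally show ?thesis .
    qed
    ultimately have "D f = D g" by metis
    then have "AE v in lborel. f v * ennreal (exp (- v)) / m = g v * ennreal (exp (- v)) / m"
      unfolding D_def by (intro sigma_finite_measure.density_unique [OF lborel.sigma_finite_measure_axioms]) measurable
    then show ?thesis
    proof eventually_elim
      case (elim v)
      have "x * ennreal (exp (- v)) / m * (m * ennreal (exp v)) = x" for x
      proof -
        have "x * ennreal (exp (- v)) / m * (m * ennreal (exp v)) = x * (ennreal (exp (- v)) * ennreal (exp v)) * (m / m)"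
          by (simp add: divide_ennreal_def mult_ac)
        then show ?thesis
          using False mfin by (simp add: ennreal_divide_self less_top ennreal_mult' [symmetric] exp_add [symmetric])
      qed
      then show ?case using elim by metis
    qed
  qed
qed

text \<open>The Taylor coefficients of (1 - q)^(-1/2), that is binom(2k, k) / 4^k.\<close>

definition pole_coeff :: "nat \<Rightarrow> real" where
  "pole_coeff k = pochhammer (1 / 2) k / fact k"

lemma pole_coeff_0 [simp]: "pole_coeff 0 = 1"
  by (simp add: pole_coeff_def)

lemma pole_coeff_nonneg [simp]: "0 \<le> pole_coeff k"
  by (simp add: pole_coeff_def pochhammer_nonneg)

lemma pole_coeff_sums:
  assumes "\<bar>q\<bar> < 1"
  shows "(\<lambda>k. pole_coeff k * q ^ k) sums (1 - q) powr (- 1 / 2)"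
proof -
  have "(\<lambda>k. ((- 1 / 2) gchoose k) * (- q) ^ k) sums (1 + - q) powr (- 1 / 2)"
    using assms by (intro gen_binomial_real) simp
  moreover have "((- 1 / 2) gchoose k) * (- q) ^ k = pole_coeff k * q ^ k" for k
  proof -
    have "(- 1) ^ k * (- q) ^ k = q ^ k" by (simp add: power_mult_distrib [symmetric])
    then show ?thesis by (simp add: gbinomial_pochhammer pole_coeff_def mult_ac)
  qed
  ultimately show ?thesis by simp
qed

text \<open>Inverts the power of c: averaging exp (- (a + u) c) against u^(1/2) du over u \<ge> 0
  gives Gamma(3/2) c^(-3/2) exp (- a c).\<close>

definition hit_mixture :: "real \<Rightarrow> real \<Rightarrow> ennreal" where
  "hit_mixture a v = (\<integral>\<^sup>+u. ennreal (indicator {0..} u * u powr (1 / 2)) * ennreal (hit_density (a + u) v) \<partial>lborel)"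

lemma measurable_hit_mixture [measurable]: "hit_mixture a \<in> borel_measurable borel"
  unfolding hit_mixture_def by measurable

lemma hit_mixture_nonpos: "v \<le> 0 \<Longrightarrow> hit_mixture a v = 0"
  by (simp add: hit_mixture_def hit_density_def)

lemma laplace_hit_mixture:
  fixes a c :: real
  assumes "a > 0" "c > 0"
  shows "(\<integral>\<^sup>+v. hit_mixture a v * ennreal (exp (- (c\<^sup>2 / 2) * v)) \<partial>lborel)
    = ennreal (Gamma (3 / 2) * c powr (- 3 / 2) * exp (- a * c))"
proof -
  have "(\<integral>\<^sup>+v. hit_mixture a v * ennreal (exp (- (c\<^sup>2 / 2) * v)) \<partial>lborel)
    = (\<integral>\<^sup>+v. \<integral>\<^sup>+u. ennreal (indicator {0..} u * u powr (1 / 2)) * (ennreal (hit_density (a + u) v) * ennreal (exp (- (c\<^sup>2 / 2) * v))) \<partial>lborel \<partial>lborel)"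
    unfolding hit_mixture_def mult.assoc [symmetric]
    by (intro nn_integral_cong nn_integral_multc [symmetric]) measurable
  also have "\<dots> = (\<integral>\<^sup>+u. \<integral>\<^sup>+v. ennreal (indicator {0..} u * u powr (1 / 2)) * (ennreal (hit_density (a + u) v) * ennreal (exp (- (c\<^sup>2 / 2) * v))) \<partial>lborel \<partial>lborel)"
    by (rule lborel_pair.Fubini') measurable
  also have "\<dots> = (\<integral>\<^sup>+u. ennreal (indicator {0..} u * u powr (1 / 2)) * (\<integral>\<^sup>+v. ennreal (hit_density (a + u) v) * ennreal (exp (- (c\<^sup>2 / 2) * v)) \<partial>lborel) \<partial>lborel)"
    by (intro nn_integral_cong nn_integral_cmult) measurable
  also have "\<dots> = (\<integral>\<^sup>+u. ennreal (exp (- a * c)) * ennreal (indicator {0..} u * (u powr (3 / 2 - 1) * exp (- c * u))) \<partial>lborel)"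
  proof (rule nn_integral_cong)
    fix u :: real
    show "ennreal (indicator {0..} u * u powr (1 / 2)) * (\<integral>\<^sup>+v. ennreal (hit_density (a + u) v) * ennreal (exp (- (c\<^sup>2 / 2) * v)) \<partial>lborel)
      = ennreal (exp (- a * c)) * ennreal (indicator {0..} u * (u powr (3 / 2 - 1) * exp (- c * u)))"
    proof (cases "u \<ge> 0")
      case True
      then have "a + u > 0" using assms by simp
      have e: "exp (- (a + u) * c) = exp (- a * c) * exp (- c * u)"
        by (simp add: exp_add [symmetric] algebra_simps)
      show ?thesis
        unfolding laplace_hit_density [OF \<open>a + u > 0\<close> \<open>c > 0\<close>] e
        using True by (simp add: ennreal_mult' [symmetric] mult_ac)
    qed simp
  qed
  also have "\<dots> = ennreal (exp (- a * c)) * (\<integral>\<^sup>+u. ennreal (indicator {0..} u * (u powr (3 / 2 - 1) * exp (- c * u))) \<partial>lborel)"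
    by (rule nn_integral_cmult) measurable
  also have "\<dots> = ennreal (exp (- a * c)) * ennreal (Gamma (3 / 2) * c powr - (3 / 2))"
    by (subst nn_integral_powr_exp [OF \<open>c > 0\<close>]) simp_all
  also have "\<dots> = ennreal (Gamma (3 / 2) * c powr (- 3 / 2) * exp (- a * c))"
    by (subst ennreal_mult' [symmetric]) (simp_all add: mult_ac)
  finally show ?thesis .
qed

text \<open>The levels 3/2 + 2 k are the exponents in the expansion of exp (- (3/2) c) (1 - exp (- 2
  c))^(-1/2) in powers of exp (- 2 c).\<close>

definition hit_series :: "real \<Rightarrow> ennreal" where
  "hit_series v = (\<Sum>k. ennreal (pole_coeff k) * hit_mixture (3 / 2 + 2 * real k) v)"

lemma measurable_hit_series [measurable]: "hit_series \<in> borel_measurable borel"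
  unfolding hit_series_def by measurable

lemma laplace_hit_series:
  fixes c :: real
  assumes c: "c > 0"
  shows "(\<integral>\<^sup>+v. hit_series v * ennreal (exp (- (c\<^sup>2 / 2) * v)) \<partial>lborel)
    = ennreal (Gamma (3 / 2) * c powr (- 3 / 2) * exp (- (3 / 2) * c) * (1 - exp (- 2 * c)) powr (- 1 / 2))"
proof -
  have G: "Gamma (3 / 2 :: real) > 0" by (rule Gamma_real_pos) simp
  have "(\<integral>\<^sup>+v. hit_series v * ennreal (exp (- (c\<^sup>2 / 2) * v)) \<partial>lborel)
    = (\<integral>\<^sup>+v. (\<Sum>k. ennreal (pole_coeff k) * (hit_mixture (3 / 2 + 2 * real k) v * ennreal (exp (- (c\<^sup>2 / 2) * v)))) \<partial>lborel)"
    unfolding hit_series_def mult.assoc [symmetric] by (simp only: ennreal_suminf_multc)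
  also have "\<dots> = (\<Sum>k. \<integral>\<^sup>+v. ennreal (pole_coeff k) * (hit_mixture (3 / 2 + 2 * real k) v * ennreal (exp (- (c\<^sup>2 / 2) * v))) \<partial>lborel)"
    by (rule nn_integral_suminf) measurable
  also have "\<dots> = (\<Sum>k. ennreal (Gamma (3 / 2) * c powr (- 3 / 2) * exp (- (3 / 2) * c) * (pole_coeff k * exp (- 2 * c) ^ k)))"
  proof (rule suminf_cong)
    fix k
    have "(\<integral>\<^sup>+v. ennreal (pole_coeff k) * (hit_mixture (3 / 2 + 2 * real k) v * ennreal (exp (- (c\<^sup>2 / 2) * v))) \<partial>lborel)
      = ennreal (pole_coeff k) * ennreal (Gamma (3 / 2) * c powr (- 3 / 2) * exp (- (3 / 2 + 2 * real k) * c))"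
      using c by (subst nn_integral_cmult, measurable) (subst laplace_hit_mixture, simp_all)
    also have "exp (- (3 / 2 + 2 * real k) * c) = exp (- (3 / 2) * c) * exp (- 2 * c) ^ k"
      by (simp add: exp_of_nat_mult [symmetric] exp_add [symmetric] algebra_simps)
    also have "ennreal (pole_coeff k) * ennreal (Gamma (3 / 2) * c powr (- 3 / 2) * (exp (- (3 / 2) * c) * exp (- 2 * c) ^ k))
      = ennreal (Gamma (3 / 2) * c powr (- 3 / 2) * exp (- (3 / 2) * c) * (pole_coeff k * exp (- 2 * c) ^ k))"
      by (subst ennreal_mult' [symmetric]) (simp_all add: mult_ac)
    finally show "(\<integral>\<^sup>+v. ennreal (pole_coeff k) * (hit_mixture (3 / 2 + 2 * real k) v * ennreal (exp (- (c\<^sup>2 / 2) * v))) \<partial>lborel)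
      = ennreal (Gamma (3 / 2) * c powr (- 3 / 2) * exp (- (3 / 2) * c) * (pole_coeff k * exp (- 2 * c) ^ k))" .
  qed
  also have "\<dots> = ennreal (Gamma (3 / 2) * c powr (- 3 / 2) * exp (- (3 / 2) * c) * (1 - exp (- 2 * c)) powr (- 1 / 2))"
    using c G by (intro suminf_ennreal_eq sums_mult pole_coeff_sums) auto
  finally show ?thesis .
qed

text \<open>A Laplace expansion with explicit error. The substitution u = v x splits off exp (- a^2
  / (2 v)) and leaves x^(1/2) (a + v x) exp (- a x - v x^2 / 2), whose leading part integrates to
  Gamma(3/2) a^(-1/2). Above, the factor exp (- v x^2 / 2) is dropped, and v x gives the term with
  Gamma(5/2). Below, v x is dropped and that factor is bounded by 1 - v x^2 / 2, which gives the
  term with Gamma(7/2).\<close>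

lemma hit_mixture_le:
  assumes a: "a > 0" and v: "v > 0"
  shows "hit_mixture a v \<le> ennreal (exp (- a\<^sup>2 / (2 * v)) / sqrt (2 * pi) *
    (Gamma (3 / 2) * a powr (- 1 / 2) + v * (Gamma (5 / 2) * a powr (- 5 / 2))))"
    (is "_ \<le> ennreal (?e * _)")
  and hit_mixture_ge:
  "hit_mixture a v \<ge> ennreal (exp (- a\<^sup>2 / (2 * v)) / sqrt (2 * pi) *
    (Gamma (3 / 2) * a powr (- 1 / 2) - v / 2 * (Gamma (7 / 2) * a powr (- 5 / 2))))"
proof -
  let ?g = "\<lambda>x. indicator {0..} x * x powr (1 / 2) * (a + v * x) * exp (- a * x - v * x\<^sup>2 / 2)"
  have eq: "hit_mixture a v = ennreal ?e * (\<integral>\<^sup>+x. ennreal (?g x) \<partial>lborel)"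
  proof -
    have "hit_mixture a v = ennreal v * (\<integral>\<^sup>+x. ennreal (indicator {0..} (v * x) * (v * x) powr (1 / 2)) * ennreal (hit_density (a + v * x) v) \<partial>lborel)"
      unfolding hit_mixture_def using v by (subst nn_integral_real_affine [where c = v and t = 0]) simp_all
    also have "\<dots> = (\<integral>\<^sup>+x. ennreal v * (ennreal (indicator {0..} (v * x) * (v * x) powr (1 / 2)) * ennreal (hit_density (a + v * x) v)) \<partial>lborel)"
      by (rule nn_integral_cmult [symmetric]) measurable
    also have "\<dots> = (\<integral>\<^sup>+x. ennreal ?e * ennreal (?g x) \<partial>lborel)"
    proof (rule nn_integral_cong)
      fix x :: real
      show "ennreal v * (ennreal (indicator {0..} (v * x) * (v * x) powr (1 / 2)) * ennreal (hit_density (a + v * x) v)) = ennreal ?e * ennreal (?g x)"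
      proof (cases "x \<ge> 0")
        case True
        have s: "sqrt (2 * pi * v ^ 3) = sqrt (2 * pi) * (v * sqrt v)"
          using v by (simp add: real_sqrt_mult power3_eq_cube)
        have "- (a + v * x)\<^sup>2 / (2 * v) = - a\<^sup>2 / (2 * v) + (- a * x - v * x\<^sup>2 / 2)"
          using v by (simp add: power2_eq_square field_simps)
        then have e: "exp (- (a + v * x)\<^sup>2 / (2 * v)) = exp (- a\<^sup>2 / (2 * v)) * exp (- a * x - v * x\<^sup>2 / 2)"
          by (simp only: exp_add)
        have "v * ((v * x) powr (1 / 2) * hit_density (a + v * x) v) = ?e * (x powr (1 / 2) * (a + v * x) * exp (- a * x - v * x\<^sup>2 / 2))"
          using v True unfolding hit_density_def s e
          by (simp add: powr_mult powr_half_sqrt)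
        then show ?thesis
          using True v by (simp add: ennreal_mult' [symmetric])
      qed (use v in \<open>simp add: zero_le_mult_iff\<close>)
    qed
    also have "\<dots> = ennreal ?e * (\<integral>\<^sup>+x. ennreal (?g x) \<partial>lborel)"
      by (rule nn_integral_cmult) measurable
    finally show ?thesis .
  qed
  have G1: "(\<integral>\<^sup>+x. ennreal a * ennreal (indicator {0..} x * (x powr (3 / 2 - 1) * exp (- a * x))) \<partial>lborel) = ennreal (Gamma (3 / 2) * a powr (- 1 / 2))"
  proof -
    have "(\<integral>\<^sup>+x. ennreal a * ennreal (indicator {0..} x * (x powr (3 / 2 - 1) * exp (- a * x))) \<partial>lborel) = ennreal a * ennreal (Gamma (3 / 2) * a powr - (3 / 2))"
      using a by (subst nn_integral_cmult, measurable) (subst nn_integral_powr_exp, simp_all)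
    also have "\<dots> = ennreal (Gamma (3 / 2) * (a * a powr - (3 / 2)))"
      using a by (subst ennreal_mult' [symmetric]) (simp_all add: mult_ac)
    also have "a * a powr - (3 / 2) = a powr (- 1 / 2)"
      using a powr_add [of a 1 "- (3 / 2)"] by simp
    finally show ?thesis .
  qed
  have up: "(\<integral>\<^sup>+x. ennreal (?g x) \<partial>lborel) \<le> ennreal (Gamma (3 / 2) * a powr (- 1 / 2) + v * (Gamma (5 / 2) * a powr (- 5 / 2)))"
  proof -
    have "(\<integral>\<^sup>+x. ennreal (?g x) \<partial>lborel) \<le> (\<integral>\<^sup>+x. ennreal a * ennreal (indicator {0..} x * (x powr (3 / 2 - 1) * exp (- a * x)))
        + ennreal v * ennreal (indicator {0..} x * (x powr (5 / 2 - 1) * exp (- a * x))) \<partial>lborel)"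
    proof (rule nn_integral_mono)
      fix x :: real
      show "ennreal (?g x) \<le> ennreal a * ennreal (indicator {0..} x * (x powr (3 / 2 - 1) * exp (- a * x)))
        + ennreal v * ennreal (indicator {0..} x * (x powr (5 / 2 - 1) * exp (- a * x)))"
      proof (cases "x \<ge> 0")
        case True
        have x: "x powr (3 / 2) = x powr (1 / 2) * x" using True by (cases "x = 0") (simp_all add: powr_mult_base mult.commute)
        have "exp (- a * x - v * x\<^sup>2 / 2) \<le> exp (- a * x)" using v by simp
        then have "x powr (1 / 2) * (a + v * x) * exp (- a * x - v * x\<^sup>2 / 2) \<le> x powr (1 / 2) * (a + v * x) * exp (- a * x)"
          using True a v by (intro mult_left_mono) auto
        also have "\<dots> = a * (x powr (1 / 2) * exp (- a * x)) + v * (x powr (3 / 2) * exp (- a * x))"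
          unfolding x by (simp add: algebra_simps)
        finally show ?thesis using True a v
          by (simp add: ennreal_mult' [symmetric] ennreal_plus [symmetric] del: ennreal_plus)
      qed simp
    qed
    also have "\<dots> = ennreal (Gamma (3 / 2) * a powr (- 1 / 2)) + ennreal v * ennreal (Gamma (5 / 2) * a powr - (5 / 2))"
      using a by (subst nn_integral_add, measurable)
        (subst G1, subst nn_integral_cmult, measurable, subst nn_integral_powr_exp, simp_all)
    also have "\<dots> = ennreal (Gamma (3 / 2) * a powr (- 1 / 2) + v * (Gamma (5 / 2) * a powr (- 5 / 2)))"
      using a v Gamma_real_pos [of "3 / 2"] Gamma_real_pos [of "5 / 2"]
      by (simp add: ennreal_mult' [symmetric] ennreal_plus [symmetric] del: ennreal_plus)
    finally show ?thesis .
  qed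
  have lo: "ennreal (Gamma (3 / 2) * a powr (- 1 / 2) - v / 2 * (Gamma (7 / 2) * a powr (- 5 / 2))) \<le> (\<integral>\<^sup>+x. ennreal (?g x) \<partial>lborel)"
  proof -
    have "ennreal (Gamma (3 / 2) * a powr (- 1 / 2)) \<le> (\<integral>\<^sup>+x. ennreal (?g x) + ennreal (v / 2 * a) * ennreal (indicator {0..} x * (x powr (7 / 2 - 1) * exp (- a * x))) \<partial>lborel)"
      unfolding G1 [symmetric]
    proof (rule nn_integral_mono)
      fix x :: real
      show "ennreal a * ennreal (indicator {0..} x * (x powr (3 / 2 - 1) * exp (- a * x)))
        \<le> ennreal (?g x) + ennreal (v / 2 * a) * ennreal (indicator {0..} x * (x powr (7 / 2 - 1) * exp (- a * x)))"
      proof (cases "x \<ge> 0")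
        case True
        have x: "x powr (5 / 2) = x powr (1 / 2) * x\<^sup>2"
          using True powr_add [of x "1 / 2" 2] by (cases "x = 0") simp_all
        have "1 - v * x\<^sup>2 / 2 \<le> exp (- (v * x\<^sup>2 / 2))"
          using exp_ge_add_one_self [of "- (v * x\<^sup>2 / 2)"] by simp
        then have "x powr (1 / 2) * a * exp (- a * x) * (1 - v * x\<^sup>2 / 2) \<le> x powr (1 / 2) * a * exp (- a * x) * exp (- (v * x\<^sup>2 / 2))"
          using a by (intro mult_left_mono) auto
        also have "\<dots> = x powr (1 / 2) * a * exp (- a * x - v * x\<^sup>2 / 2)"
          by (simp add: mult.assoc exp_add [symmetric])
        also have "\<dots> \<le> x powr (1 / 2) * (a + v * x) * exp (- a * x - v * x\<^sup>2 / 2)"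
          using a v True by (intro mult_right_mono mult_left_mono) auto
        finally have "a * (x powr (1 / 2) * exp (- a * x)) \<le> x powr (1 / 2) * (a + v * x) * exp (- a * x - v * x\<^sup>2 / 2)
           + v / 2 * a * (x powr (5 / 2) * exp (- a * x))"
          unfolding x by (simp add: algebra_simps)
        then show ?thesis using True a v
          by (simp add: ennreal_mult' [symmetric] ennreal_plus [symmetric] del: ennreal_plus)
      qed simp
    qed
    also have "\<dots> = (\<integral>\<^sup>+x. ennreal (?g x) \<partial>lborel) + ennreal (v / 2 * a) * ennreal (Gamma (7 / 2) * a powr - (7 / 2))"
      using a by (subst nn_integral_add, measurable)
        (subst nn_integral_cmult, measurable, subst nn_integral_powr_exp, simp_all)
    also have "ennreal (v / 2 * a) * ennreal (Gamma (7 / 2) * a powr - (7 / 2)) = ennreal (v / 2 * (Gamma (7 / 2) * a powr (- 5 / 2)))"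
    proof -
      have "a * a powr - (7 / 2) = a powr (- 5 / 2)"
        using a powr_add [of a 1 "- (7 / 2)"] by simp
      then have "v / 2 * a * (Gamma (7 / 2) * a powr - (7 / 2)) = v / 2 * (Gamma (7 / 2) * a powr (- 5 / 2))"
        using a by (simp add: mult_ac)
      then show ?thesis using a v by (subst ennreal_mult' [symmetric]) simp_all
    qed
    finally have "ennreal (Gamma (3 / 2) * a powr (- 1 / 2)) - ennreal (v / 2 * (Gamma (7 / 2) * a powr (- 5 / 2))) \<le> (\<integral>\<^sup>+x. ennreal (?g x) \<partial>lborel)"
      by (simp add: ennreal_minus_le_iff add.commute)
    then show ?thesis
      using v Gamma_real_pos [of "7 / 2"] by (subst ennreal_minus [symmetric]) simp_all
  qed
  have e0: "?e \<ge> 0" by simp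
  show "hit_mixture a v \<le> ennreal (?e * (Gamma (3 / 2) * a powr (- 1 / 2) + v * (Gamma (5 / 2) * a powr (- 5 / 2))))"
    unfolding eq ennreal_mult' [OF e0] by (rule mult_left_mono [OF up]) simp
  show "ennreal (?e * (Gamma (3 / 2) * a powr (- 1 / 2) - v / 2 * (Gamma (7 / 2) * a powr (- 5 / 2)))) \<le> hit_mixture a v"
    unfolding eq ennreal_mult' [OF e0] by (rule mult_left_mono [OF lo]) simp
qed

lemma AE_lborel_interval_ex:
  fixes a b :: real
  assumes "AE v in lborel. P v" "a < b"
  shows "\<exists>v. a < v \<and> v < b \<and> P v"
proof (rule ccontr)
  assume "\<not> ?thesis"
  then have "AE v in lborel. v \<notin> {a<..<b}"
    using assms(1) by (auto elim!: eventually_mono)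
  moreover have "{a<..<b} = {v \<in> space lborel. \<not> v \<notin> {a<..<b}}" by auto
  ultimately have "emeasure lborel {a<..<b} = 0"
    using AE_iff_measurable [of "{a<..<b}" lborel "\<lambda>v. v \<notin> {a<..<b}"] by simp
  then show False using assms(2) by simp
qed

text \<open>The term k = 0 keeps its precise bound. For k \<ge> 1, (3/2 + 2 k)^2 \<ge> 9/4 + 6 k
  makes the k-th term at most a constant times exp (- 9 / (8 v)) q^k with q = exp (- 3 / v), so the
  tail sums to the binomial series without its first term, which vanishes as v tends to 0.\<close>

lemma hit_series_le:
  assumes v: "0 < v" "v < 1"
  shows "hit_series v \<le> ennreal (exp (- (9 / 8) * (1 / v)) / sqrt (2 * pi) *
    (Gamma (3 / 2) * (3 / 2) powr (- 1 / 2) + v * (Gamma (5 / 2) * (3 / 2) powr (- 5 / 2)) +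
     (Gamma (3 / 2) + Gamma (5 / 2)) * ((1 - exp (- 3 / v)) powr (- 1 / 2) - 1)))"
proof -
  define e where "e = exp (- (9 / 8) * (1 / v)) / sqrt (2 * pi)"
  define A where "A = Gamma (3 / 2) * (3 / 2) powr (- 1 / 2) + v * (Gamma (5 / 2) * (3 / 2) powr (- 5 / 2))"
  define B where "B = Gamma (3 / 2 :: real) + Gamma (5 / 2)"
  define q where "q = exp (- 3 / v)"
  \<comment> \<open>The correction A - B at k = 0 turns the sum into one full binomial series plus a
    single term.\<close>
  define t where "t k = e * ((if k = 0 then A - B else 0) + B * (pole_coeff k * q ^ k))" for k :: nat
  have G: "Gamma (3 / 2 :: real) > 0" "Gamma (5 / 2 :: real) > 0" by (simp_all add: Gamma_real_pos)
  have q: "\<bar>q\<bar> < 1" "q \<ge> 0" using v by (simp_all add: q_def)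
  have pos: "e \<ge> 0" "A \<ge> 0" "B \<ge> 0" using G v by (simp_all add: e_def A_def B_def)
  have "t sums (e * ((A - B) + B * (1 - q) powr (- 1 / 2)))"
    unfolding t_def using sums_single [of 0 "\<lambda>_. A - B"]
    by (intro sums_mult sums_add pole_coeff_sums q) (simp add: if_distrib)
  moreover have "(A - B) + B * (1 - q) powr (- 1 / 2) = A + B * ((1 - q) powr (- 1 / 2) - 1)"
    by (simp add: algebra_simps)
  ultimately have "t sums (e * (A + B * ((1 - q) powr (- 1 / 2) - 1)))"
    by (simp only:)
  moreover have t0: "t k \<ge> 0" for k
    using pos q by (simp add: t_def)
  ultimately have sum: "(\<Sum>k. ennreal (t k)) = ennreal (e * (A + B * ((1 - q) powr (- 1 / 2) - 1)))"
    by (intro suminf_ennreal_eq)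
  have "ennreal (pole_coeff k) * hit_mixture (3 / 2 + 2 * real k) v \<le> ennreal (t k)" for k
  proof (cases "k = 0")
    case True
    have "- (3 / 2)\<^sup>2 / (2 * v) = - (9 / 8) * (1 / v)" by (simp add: power2_eq_square)
    then show ?thesis
      using hit_mixture_le [of "3 / 2" v] v True
      by (simp add: t_def A_def e_def)
  next
    case False
    define a where "a = 3 / 2 + 2 * real k"
    have a: "a \<ge> 1" by (simp add: a_def)
    have le: "a powr - x \<le> 1" if "x \<ge> 0" for x
      using powr_mono [of "- x" 0 a] a that by simp
    have exp_le: "exp (- a\<^sup>2 / (2 * v)) \<le> exp (- (9 / 8) * (1 / v)) * q ^ k"
    proof -
      have "9 / 4 + 6 * real k \<le> a\<^sup>2"
        by (simp add: a_def power2_eq_square algebra_simps)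
      then have "(9 / 4 + 6 * real k) / (2 * v) \<le> a\<^sup>2 / (2 * v)"
        using v by (intro divide_right_mono) auto
      moreover have "(9 / 4 + 6 * real k) / (2 * v) = 9 / 8 * (1 / v) + real k * (3 / v)"
        using v by (simp add: field_simps)
      ultimately have "- a\<^sup>2 / (2 * v) \<le> - (9 / 8) * (1 / v) + real k * (- 3 / v)" by simp
      then show ?thesis
        unfolding q_def exp_of_nat_mult [symmetric] exp_add [symmetric] by simp
    qed
    have "hit_mixture a v \<le> ennreal (exp (- a\<^sup>2 / (2 * v)) / sqrt (2 * pi) *
      (Gamma (3 / 2) * a powr (- 1 / 2) + v * (Gamma (5 / 2) * a powr (- 5 / 2))))"
      using a v by (intro hit_mixture_le) auto
    also have "\<dots> \<le> ennreal (e * q ^ k * B)"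
    proof (rule ennreal_leI)
      have "Gamma (3 / 2) * a powr (- 1 / 2) + v * (Gamma (5 / 2) * a powr (- 5 / 2)) \<le> B"
      proof -
        have "Gamma (3 / 2) * a powr (- 1 / 2) \<le> Gamma (3 / 2) * 1"
          using le [of "1 / 2"] G by (intro mult_left_mono) auto
        moreover have "v * (Gamma (5 / 2) * a powr (- 5 / 2)) \<le> 1 * (Gamma (5 / 2) * 1)"
          using le [of "5 / 2"] G v by (intro mult_mono mult_left_mono) auto
        ultimately show ?thesis unfolding B_def by linarith
      qed
      moreover have "exp (- a\<^sup>2 / (2 * v)) / sqrt (2 * pi) \<le> e * q ^ k"
        unfolding e_def using exp_le by (simp add: divide_right_mono)
      moreover have "0 \<le> Gamma (3 / 2) * a powr (- 1 / 2) + v * (Gamma (5 / 2) * a powr (- 5 / 2))"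
        using G v by simp
      ultimately show "exp (- a\<^sup>2 / (2 * v)) / sqrt (2 * pi) *
        (Gamma (3 / 2) * a powr (- 1 / 2) + v * (Gamma (5 / 2) * a powr (- 5 / 2))) \<le> e * q ^ k * B"
        using pos q by (intro mult_mono) auto
    qed
    finally have "ennreal (pole_coeff k) * hit_mixture a v \<le> ennreal (pole_coeff k) * ennreal (e * q ^ k * B)"
      by (rule mult_left_mono) simp
    also have "\<dots> = ennreal (t k)"
      using False by (simp add: t_def ennreal_mult' [symmetric] mult_ac)
    finally show ?thesis by (simp add: a_def)
  qed
  then have "hit_series v \<le> (\<Sum>k. ennreal (t k))"
    unfolding hit_series_def by (intro suminf_le) auto
  then show ?thesis unfolding sum by (simp add: e_def A_def B_def q_def)
qed

lemma hit_series_ge: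
  assumes v: "0 < v"
  shows "ennreal (exp (- (9 / 8) * (1 / v)) / sqrt (2 * pi) *
    (Gamma (3 / 2) * (3 / 2) powr (- 1 / 2) - v / 2 * (Gamma (7 / 2) * (3 / 2) powr (- 5 / 2)))) \<le> hit_series v"
proof -
  have "- (3 / 2)\<^sup>2 / (2 * v) = - (9 / 8) * (1 / v)" by (simp add: power2_eq_square)
  then have "ennreal (exp (- (9 / 8) * (1 / v)) / sqrt (2 * pi) *
    (Gamma (3 / 2) * (3 / 2) powr (- 1 / 2) - v / 2 * (Gamma (7 / 2) * (3 / 2) powr (- 5 / 2)))) \<le> hit_mixture (3 / 2) v"
    using hit_mixture_ge [of "3 / 2" v] v by simp
  also have "\<dots> = (\<Sum>k<1. ennreal (pole_coeff k) * hit_mixture (3 / 2 + 2 * real k) v)"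
    by simp
  also have "\<dots> \<le> hit_series v"
    unfolding hit_series_def by (rule sum_le_suminf) auto
  finally show ?thesis .
qed

text \<open>With q = exp (- 2 c), sinh c and cosh c are exp c / 2 times 1 - q and 1 + q. Hence 3/2 =
  1 + 1/2: exp (- c) comes from 1 / cosh c and exp (- c / 2) from the root of 1 / sinh c. The rate
  9/8 of the theorem is (3/2)^2 / 2.\<close>

lemma hit_series_laplace_identity:
  fixes c :: real
  assumes c: "c > 0"
  shows "sqrt (c / sinh c) / cosh c / (c\<^sup>2 / 2) * (1 + exp (- 2 * c))
    = 4 * sqrt 2 * (c powr (- 3 / 2) * exp (- (3 / 2) * c) * (1 - exp (- 2 * c)) powr (- 1 / 2))"
proof -
  define q where "q = exp (- 2 * c)"
  have q: "0 < q" "q < 1" using c by (simp_all add: q_def)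
  have e: "exp (- c) = exp c * q" by (simp add: q_def exp_add [symmetric])
  have sh: "sinh c = exp c * (1 - q) / 2" and ch: "cosh c = exp c * (1 + q) / 2"
    by (simp_all add: sinh_def cosh_def e algebra_simps)
  have ec: "exp c = exp (c / 2) * exp (c / 2)" by (simp add: exp_add [symmetric])
  have s: "sqrt (c / sinh c) = sqrt 2 * sqrt c / (exp (c / 2) * sqrt (1 - q))"
    unfolding sh ec by (simp add: real_sqrt_divide real_sqrt_mult)
  have p1: "c powr (- 3 / 2) = sqrt c / c\<^sup>2"
    using c powr_diff [of c "1 / 2" 2] by (simp add: powr_half_sqrt)
  have p2: "(1 - q) powr (- 1 / 2) = 1 / sqrt (1 - q)"
    using q powr_minus_divide [of "1 - q" "1 / 2"] by (simp add: powr_half_sqrt)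
  have p3: "exp (- (3 / 2) * c) = 1 / (exp (c / 2) * exp c)"
  proof -
    have "exp (c / 2) * exp c = exp (3 * c / 2)" by (simp add: exp_add [symmetric])
    then show ?thesis by (simp add: exp_minus inverse_eq_divide)
  qed
  have nz: "1 + q \<noteq> 0" "exp c \<noteq> 0" "c \<noteq> 0" using q c by auto
  have cancel: "x / (y * m / 2) / (z / 2) * m = 4 * x / (y * z)" if "m \<noteq> 0" for x y z m :: real
    using that by simp
  show ?thesis
    unfolding q_def [symmetric] s ch p1 p2 p3 cancel [OF nz(1)] by (simp add: mult_ac)
qed

section \<open>From the Laplace transform to the asymptotics of the distribution function\<close>

context prob_space
begin

text \<open>Tonelli's theorem on the region where V is at most v, which for fixed outcome is a half
  line in v; as V is nonnegative, restricting to v > 0 loses only a null set.\<close>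

lemma laplace_cdf:
  fixes V :: "'a \<Rightarrow> real" and p :: real
  assumes [measurable]: "V \<in> borel_measurable M" and nonneg: "\<And>\<omega>. \<omega> \<in> space M \<Longrightarrow> 0 \<le> V \<omega>" and p: "p > 0"
  shows "(\<integral>\<^sup>+v. ennreal (prob {\<omega> \<in> space M. V \<omega> \<le> v}) * indicator {0<..} v * ennreal (exp (- p * v)) \<partial>lborel)
    = ennreal (expectation (\<lambda>\<omega>. exp (- p * V \<omega>)) / p)"
proof -
  interpret P: pair_sigma_finite lborel M ..
  have "(\<integral>\<^sup>+v. ennreal (prob {\<omega> \<in> space M. V \<omega> \<le> v}) * indicator {0<..} v * ennreal (exp (- p * v)) \<partial>lborel)
    = (\<integral>\<^sup>+v. \<integral>\<^sup>+\<omega>. indicator {\<omega> \<in> space M. V \<omega> \<le> v} \<omega> * (indicator {0<..} v * ennreal (exp (- p * v))) \<partial>M \<partial>lborel)"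
    by (intro nn_integral_cong) (simp add: nn_integral_multc emeasure_eq_measure mult.assoc)
  also have "\<dots> = (\<integral>\<^sup>+v. \<integral>\<^sup>+\<omega>. indicator {V \<omega>..} v * (indicator {0<..} v * ennreal (exp (- p * v))) \<partial>M \<partial>lborel)"
    by (intro nn_integral_cong) (simp add: indicator_def)
  also have "\<dots> = (\<integral>\<^sup>+\<omega>. \<integral>\<^sup>+v. indicator {V \<omega>..} v * (indicator {0<..} v * ennreal (exp (- p * v))) \<partial>lborel \<partial>M)"
    by (rule P.Fubini' [symmetric]) (simp add: indicator_def, measurable)
  also have "\<dots> = (\<integral>\<^sup>+\<omega>. ennreal (exp (- p * V \<omega>) / p) \<partial>M)"
  proof (rule nn_integral_cong)
    fix \<omega> assume \<omega>: "\<omega> \<in> space M"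
    have "(\<integral>\<^sup>+v. indicator {V \<omega>..} v * (indicator {0<..} v * ennreal (exp (- p * v))) \<partial>lborel)
      = (\<integral>\<^sup>+v. ennreal (exp (- p * v)) * indicator {V \<omega>..} v \<partial>lborel)"
    proof (rule nn_integral_cong_AE, rule AE_mp [OF AE_lborel_singleton [of 0]], rule AE_I2, rule impI)
      fix v :: real assume "v \<noteq> 0"
      then show "indicator {V \<omega>..} v * (indicator {0<..} v * ennreal (exp (- p * v))) = ennreal (exp (- p * v)) * indicator {V \<omega>..} v"
        using nonneg [OF \<omega>] by (cases "V \<omega> \<le> v") simp_all
    qed
    also have "\<dots> = ennreal (0 - - exp (- p * V \<omega>) / p)"
    proof (rule nn_integral_FTC_atLeast)
      show "((\<lambda>v. - exp (- p * v) / p) has_real_derivative exp (- p * v)) (at v)" for v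
        using p by (auto intro!: derivative_eq_intros)
      show "((\<lambda>v. - exp (- p * v) / p) \<longlongrightarrow> 0) at_top"
        using p by real_asymp
    qed auto
    finally show "(\<integral>\<^sup>+v. indicator {V \<omega>..} v * (indicator {0<..} v * ennreal (exp (- p * v))) \<partial>lborel) = ennreal (exp (- p * V \<omega>) / p)"
      by simp
  qed
  also have "\<dots> = ennreal (expectation (\<lambda>\<omega>. exp (- p * V \<omega>) / p))"
    using p nonneg by (intro nn_integral_eq_integral integrable_const_bound [of _ "1 / p"] AE_I2)
      (auto simp: divide_right_mono)
  finally show ?thesis by simp
qed

text \<open>Uniqueness of the transform yields the identity only for almost every v. It therefore
  first yields bounds almost everywhere, which monotonicity of \<open>F\<close> and continuity of
  the bounds extend to every v in (0, 1).\<close>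

theorem small_deviation_of_laplace:
  fixes V :: "'a \<Rightarrow> real"
  assumes V [measurable]: "V \<in> borel_measurable M" and nonneg: "\<And>\<omega>. \<omega> \<in> space M \<Longrightarrow> 0 \<le> V \<omega>"
    and laplace: "\<And>c. c > 0 \<Longrightarrow> expectation (\<lambda>\<omega>. exp (- (c\<^sup>2 / 2) * V \<omega>)) = sqrt (c / sinh c) / cosh c"
  shows "(\<lambda>v. prob {\<omega> \<in> space M. V \<omega> \<le> v}) \<sim>[at_right 0] (\<lambda>v. 4 * sqrt (2 / (3 * pi)) * exp (- (9 / 8) * (1 / v)))"
proof -
  define F where "F v = prob {\<omega> \<in> space M. V \<omega> \<le> v}" for v
  have F_mono: "F u \<le> F v" if "u \<le> v" for u v
    unfolding F_def using that by (intro finite_measure_mono) auto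
  have F_nonneg: "0 \<le> F v" for v by (simp add: F_def)
  have F_meas [measurable]: "F \<in> borel_measurable borel"
    by (rule borel_measurable_mono) (simp add: mono_def F_mono)
  define G where "G v = ennreal (F v) * indicator {0<..} v" for v :: real
  have G_meas [measurable]: "G \<in> borel_measurable borel" unfolding G_def by measurable
  define H where "H v = (\<integral>\<^sup>+w. G (v - w) * ennreal (hit_density 2 w) \<partial>lborel)" for v
  have H_meas [measurable]: "H \<in> borel_measurable borel" unfolding H_def by measurable
  \<comment> \<open>The constant of \<open>hit_series_laplace_identity\<close>, freed from the Gamma
    factor that the mixtures contribute.\<close>
  define K where "K = 4 * sqrt 2 / Gamma (3 / 2 :: real)"
  have Gam: "Gamma (3 / 2 :: real) > 0" by (simp add: Gamma_real_pos)
  then have K: "K > 0" by (simp add: K_def)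
  have Gam_nz: "Gamma (3 / 2 :: real) \<noteq> 0" using Gam by linarith
  have lapG: "(\<integral>\<^sup>+v. G v * ennreal (exp (- (c\<^sup>2 / 2) * v)) \<partial>lborel) = ennreal (sqrt (c / sinh c) / cosh c / (c\<^sup>2 / 2))"
    if "c > 0" for c
    unfolding G_def F_def laplace [OF that, symmetric] using that
    by (intro laplace_cdf V nonneg) auto
  have lapH: "(\<integral>\<^sup>+v. H v * ennreal (exp (- (c\<^sup>2 / 2) * v)) \<partial>lborel)
     = ennreal (sqrt (c / sinh c) / cosh c / (c\<^sup>2 / 2)) * ennreal (exp (- 2 * c))"
    if c: "c > 0" for c
  proof -
    let ?p = "c\<^sup>2 / 2"
    have "(\<integral>\<^sup>+v. H v * ennreal (exp (- ?p * v)) \<partial>lborel)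
      = (\<integral>\<^sup>+v. \<integral>\<^sup>+w. G (v - w) * ennreal (hit_density 2 w) * ennreal (exp (- ?p * v)) \<partial>lborel \<partial>lborel)"
      unfolding H_def by (intro nn_integral_cong nn_integral_multc [symmetric]) measurable
    also have "\<dots> = (\<integral>\<^sup>+w. \<integral>\<^sup>+v. G (v - w) * ennreal (hit_density 2 w) * ennreal (exp (- ?p * v)) \<partial>lborel \<partial>lborel)"
      by (rule lborel_pair.Fubini') measurable
    also have "\<dots> = (\<integral>\<^sup>+w. ennreal (hit_density 2 w) * ennreal (exp (- ?p * w)) * (\<integral>\<^sup>+v. G v * ennreal (exp (- ?p * v)) \<partial>lborel) \<partial>lborel)"
    proof (rule nn_integral_cong)
      fix w :: real
      have "(\<integral>\<^sup>+v. G (v - w) * ennreal (hit_density 2 w) * ennreal (exp (- ?p * v)) \<partial>lborel)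
        = (\<integral>\<^sup>+v. G v * ennreal (hit_density 2 w) * ennreal (exp (- ?p * (w + v))) \<partial>lborel)"
        by (subst nn_integral_real_affine [where c = 1 and t = w]) simp_all
      also have "\<dots> = (\<integral>\<^sup>+v. ennreal (hit_density 2 w) * ennreal (exp (- ?p * w)) * (G v * ennreal (exp (- ?p * v))) \<partial>lborel)"
      proof (rule nn_integral_cong)
        fix v :: real
        have "ennreal (exp (- ?p * (w + v))) = ennreal (exp (- ?p * w)) * ennreal (exp (- ?p * v))"
          by (simp add: ennreal_mult' [symmetric] exp_add [symmetric] algebra_simps)
        then show "G v * ennreal (hit_density 2 w) * ennreal (exp (- ?p * (w + v)))
          = ennreal (hit_density 2 w) * ennreal (exp (- ?p * w)) * (G v * ennreal (exp (- ?p * v)))"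
          by (simp only: mult_ac)
      qed
      finally show "(\<integral>\<^sup>+v. G (v - w) * ennreal (hit_density 2 w) * ennreal (exp (- ?p * v)) \<partial>lborel)
        = ennreal (hit_density 2 w) * ennreal (exp (- ?p * w)) * (\<integral>\<^sup>+v. G v * ennreal (exp (- ?p * v)) \<partial>lborel)"
        by (simp only: nn_integral_cmult [OF borel_measurable_times_ennreal] G_meas measurable_lborel1
            measurable_compose_rev) (subst nn_integral_cmult, measurable)
    qed
    also have "\<dots> = (\<integral>\<^sup>+w. ennreal (hit_density 2 w) * ennreal (exp (- ?p * w)) \<partial>lborel) * (\<integral>\<^sup>+v. G v * ennreal (exp (- ?p * v)) \<partial>lborel)"
      by (rule nn_integral_multc) measurable
    finally show ?thesis
      unfolding lapG [OF c] laplace_hit_density [OF zero_less_numeral c] by (simp only: mult.commute)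
  qed
  have AE_eq: "AE v in lborel. G v + H v = ennreal K * hit_series v"
  proof (rule laplace_transform_unique)
    have lap: "(\<integral>\<^sup>+v. (G v + H v) * ennreal (exp (- (c\<^sup>2 / 2) * v)) \<partial>lborel)
        = (\<integral>\<^sup>+v. ennreal K * hit_series v * ennreal (exp (- (c\<^sup>2 / 2) * v)) \<partial>lborel)"
      "(\<integral>\<^sup>+v. (G v + H v) * ennreal (exp (- (c\<^sup>2 / 2) * v)) \<partial>lborel) < \<infinity>"
      if c: "c > 0" for c
    proof -
      let ?l = "sqrt (c / sinh c) / cosh c / (c\<^sup>2 / 2)"
      have l: "0 \<le> ?l" using c by simp
      have "(\<integral>\<^sup>+v. (G v + H v) * ennreal (exp (- (c\<^sup>2 / 2) * v)) \<partial>lborel)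
         = (\<integral>\<^sup>+v. G v * ennreal (exp (- (c\<^sup>2 / 2) * v)) \<partial>lborel) + (\<integral>\<^sup>+v. H v * ennreal (exp (- (c\<^sup>2 / 2) * v)) \<partial>lborel)"
        unfolding distrib_right by (rule nn_integral_add) measurable
      also have "\<dots> = ennreal (?l * (1 + exp (- 2 * c)))"
        unfolding lapG [OF c] lapH [OF c] distrib_left
        using l by (simp only: ennreal_mult' [symmetric] ennreal_plus mult_nonneg_nonneg exp_ge_zero mult_1_right)
      finally have L: "(\<integral>\<^sup>+v. (G v + H v) * ennreal (exp (- (c\<^sup>2 / 2) * v)) \<partial>lborel) = ennreal (?l * (1 + exp (- 2 * c)))" .
      have "(\<integral>\<^sup>+v. ennreal K * hit_series v * ennreal (exp (- (c\<^sup>2 / 2) * v)) \<partial>lborel)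
        = ennreal K * (\<integral>\<^sup>+v. hit_series v * ennreal (exp (- (c\<^sup>2 / 2) * v)) \<partial>lborel)"
        unfolding mult.assoc by (rule nn_integral_cmult) measurable
      also have "\<dots> = ennreal (K * (Gamma (3 / 2) * c powr (- 3 / 2) * exp (- (3 / 2) * c) * (1 - exp (- 2 * c)) powr (- 1 / 2)))"
        unfolding laplace_hit_series [OF c] using K by (intro ennreal_mult' [symmetric]) simp
      also have "K * (Gamma (3 / 2) * c powr (- 3 / 2) * exp (- (3 / 2) * c) * (1 - exp (- 2 * c)) powr (- 1 / 2))
        = ?l * (1 + exp (- 2 * c))"
        unfolding hit_series_laplace_identity [OF c] K_def using Gam_nz by simp
      finally show "(\<integral>\<^sup>+v. (G v + H v) * ennreal (exp (- (c\<^sup>2 / 2) * v)) \<partial>lborel)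
        = (\<integral>\<^sup>+v. ennreal K * hit_series v * ennreal (exp (- (c\<^sup>2 / 2) * v)) \<partial>lborel)"
        using L by simp
      show "(\<integral>\<^sup>+v. (G v + H v) * ennreal (exp (- (c\<^sup>2 / 2) * v)) \<partial>lborel) < \<infinity>"
        unfolding L by simp
    qed
    show "(\<integral>\<^sup>+v. (G v + H v) * ennreal (exp (- real n * v)) \<partial>lborel)
        = (\<integral>\<^sup>+v. ennreal K * hit_series v * ennreal (exp (- real n * v)) \<partial>lborel)" if "n \<ge> 1" for n
      \<comment> \<open>The choice of c with c^2 / 2 = n.\<close>
      using lap(1) [of "sqrt (2 * real n)"] that by simp
    show "(\<integral>\<^sup>+v. (G v + H v) * ennreal (exp (- v)) \<partial>lborel) < \<infinity>"
      using lap(2) [of "sqrt 2"] by simp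
    show "G v + H v = 0" if "v \<le> 0" for v
    proof -
      have "G (v - w) * ennreal (hit_density 2 w) = 0" for w
        using that by (cases "w > 0") (simp_all add: G_def hit_density_def)
      then have "H v = 0" unfolding H_def by (simp only: nn_integral_const mult_zero_left)
      then show ?thesis using that by (simp add: G_def)
    qed
    show "ennreal K * hit_series v = 0" if "v \<le> 0" for v
      using that by (simp add: hit_series_def hit_mixture_nonpos)
  qed measurable
  \<comment> \<open>An exponential Chebyshev bound. Only w < v contributes; there F (v - w) \<le> F
    v, and exp (1 - w / v) \<ge> 1 may be inserted. Integrated over all w, this is e times the
    transform of \<open>hit_density 2\<close> at 1 / v = c^2 / 2, which is exp (- 2 c) with c = sqrt
    (2 / v).\<close>
  have H_le: "H v \<le> G v * ennreal (exp (1 - 2 * sqrt (2 / v)))" if v: "v > 0" for v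
  proof -
    define c where "c = sqrt (2 / v)"
    have c: "c > 0" "c\<^sup>2 / 2 = 1 / v" using v by (simp_all add: c_def)
    have "H v \<le> (\<integral>\<^sup>+w. G v * ennreal (exp 1) * (ennreal (hit_density 2 w) * ennreal (exp (- (c\<^sup>2 / 2) * w))) \<partial>lborel)"
      unfolding H_def
    proof (rule nn_integral_mono)
      fix w :: real
      show "G (v - w) * ennreal (hit_density 2 w) \<le> G v * ennreal (exp 1) * (ennreal (hit_density 2 w) * ennreal (exp (- (c\<^sup>2 / 2) * w)))"
      proof (cases "0 < w \<and> w < v")
        case True
        have "G (v - w) \<le> G v"
          using True v F_mono [of "v - w" v] by (simp add: G_def ennreal_leI)
        moreover have "1 \<le> ennreal (exp 1) * ennreal (exp (- (c\<^sup>2 / 2) * w))"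
        proof -
          have "1 \<le> exp (1 + - (c\<^sup>2 / 2) * w)"
            unfolding c(2) using True v by (simp add: field_simps)
          then show ?thesis
            unfolding exp_add by (simp add: ennreal_mult' [symmetric])
        qed
        ultimately have "G (v - w) * ennreal (hit_density 2 w) * 1 \<le> G v * ennreal (hit_density 2 w) * (ennreal (exp 1) * ennreal (exp (- (c\<^sup>2 / 2) * w)))"
          by (intro mult_mono) auto
        then show ?thesis by (simp only: mult_ac mult_1_right mult_1_left)
      next
        case False
        then show ?thesis by (cases "0 < w") (simp_all add: G_def hit_density_def)
      qed
    qed
    also have "\<dots> = G v * ennreal (exp 1) * ennreal (exp (- 2 * c))"
      by (subst nn_integral_cmult, measurable) (subst laplace_hit_density [OF _ c(1)], simp_all)
    also have "\<dots> = G v * ennreal (exp (1 - 2 * c))"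
      by (simp add: mult.assoc ennreal_mult' [symmetric] exp_add [symmetric])
    finally show ?thesis by (simp add: c_def)
  qed
  define k0 where "k0 = 4 * sqrt (2 / (3 * pi))"
  have k0: "k0 > 0" by (simp add: k0_def)
  have k0_eq: "K / sqrt (2 * pi) * (Gamma (3 / 2) * (3 / 2) powr (- 1 / 2)) = k0"
  proof -
    have "(3 / 2 :: real) powr (- 1 / 2) = 1 / sqrt (3 / 2)"
      using powr_minus_divide [of "3 / 2 :: real" "1 / 2"] by (simp add: powr_half_sqrt)
    moreover have "sqrt 2 / sqrt (2 * pi) * (1 / sqrt (3 / 2)) = sqrt (2 / (3 * pi))"
      by (simp add: real_sqrt_mult [symmetric] real_sqrt_divide [symmetric])
    ultimately show ?thesis using Gam_nz unfolding K_def k0_def by simp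
  qed
  define a1 where "a1 = K / sqrt (2 * pi) * (Gamma (5 / 2) * (3 / 2) powr (- 5 / 2))"
  define a2 where "a2 = K / sqrt (2 * pi) * (Gamma (3 / 2) + Gamma (5 / 2))"
  define a3 where "a3 = K / sqrt (2 * pi) * (Gamma (7 / 2) * (3 / 2) powr (- 5 / 2)) / 2"
  define E where "E v = exp (- (9 / 8) * (1 / v))" for v :: real
  define U where "U v = E v * (k0 + v * a1 + a2 * ((1 - exp (- 3 / v)) powr (- 1 / 2) - 1))" for v :: real
  \<comment> \<open>Dividing by 1 + exp (...) solves F + H \<ge> E (k0 - v a3) for F after H is
    bounded by F times that exponential.\<close>
  define L where "L v = E v * (k0 - v * a3) / (1 + exp (1 - 2 * sqrt (2 / v)))" for v :: real
  have good: "AE v in lborel. 0 < v \<and> v < 1 \<longrightarrow> L v \<le> F v \<and> F v \<le> U v"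
    using AE_eq
  proof eventually_elim
    case (elim v)
    show ?case
    proof (intro impI)
      assume v: "0 < v \<and> v < 1"
      then have Gv: "G v = ennreal (F v)" by (simp add: G_def)
      have "q < 1 \<Longrightarrow> 0 < q \<Longrightarrow> 1 \<le> (1 - q) powr (- 1 / 2)" for q :: real
        using powr_mono' [of "- 1 / 2" 0 "1 - q"] by simp
      then have "1 \<le> (1 - exp (- 3 / v)) powr (- 1 / 2)"
        using v by simp
      then have U0: "U v \<ge> 0"
        unfolding U_def E_def using v k0 K Gamma_real_pos [of "5 / 2"] Gam
        by (intro mult_nonneg_nonneg add_nonneg_nonneg) (auto simp: a1_def a2_def)
      have "ennreal (F v) \<le> G v + H v" by (simp add: Gv)
      also have "\<dots> \<le> ennreal K * ennreal (E v / sqrt (2 * pi) *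
        (Gamma (3 / 2) * (3 / 2) powr (- 1 / 2) + v * (Gamma (5 / 2) * (3 / 2) powr (- 5 / 2)) +
         (Gamma (3 / 2) + Gamma (5 / 2)) * ((1 - exp (- 3 / v)) powr (- 1 / 2) - 1)))"
        unfolding elim E_def using v by (intro mult_left_mono hit_series_le) auto
      also have "\<dots> = ennreal (K * (E v / sqrt (2 * pi) *
        (Gamma (3 / 2) * (3 / 2) powr (- 1 / 2) + v * (Gamma (5 / 2) * (3 / 2) powr (- 5 / 2)) +
         (Gamma (3 / 2) + Gamma (5 / 2)) * ((1 - exp (- 3 / v)) powr (- 1 / 2) - 1))))"
        using K by (intro ennreal_mult' [symmetric]) simp
      also have "K * (E v / sqrt (2 * pi) *
        (Gamma (3 / 2) * (3 / 2) powr (- 1 / 2) + v * (Gamma (5 / 2) * (3 / 2) powr (- 5 / 2)) +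
         (Gamma (3 / 2) + Gamma (5 / 2)) * ((1 - exp (- 3 / v)) powr (- 1 / 2) - 1))) = U v"
        unfolding U_def k0_eq [symmetric] a1_def a2_def
        by (simp add: algebra_simps add_divide_distrib diff_divide_distrib)
      finally have up: "F v \<le> U v" using U0 by simp
      have "ennreal (E v * (k0 - v * a3)) = ennreal (K * (E v / sqrt (2 * pi) *
        (Gamma (3 / 2) * (3 / 2) powr (- 1 / 2) - v / 2 * (Gamma (7 / 2) * (3 / 2) powr (- 5 / 2)))))"
        unfolding k0_eq [symmetric] a3_def by (simp add: algebra_simps)
      also have "\<dots> = ennreal K * ennreal (E v / sqrt (2 * pi) *
        (Gamma (3 / 2) * (3 / 2) powr (- 1 / 2) - v / 2 * (Gamma (7 / 2) * (3 / 2) powr (- 5 / 2))))"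
        using K by (intro ennreal_mult') simp
      also have "\<dots> \<le> G v + H v"
        unfolding elim E_def using v by (intro mult_left_mono hit_series_ge) auto
      also have "\<dots> \<le> G v + G v * ennreal (exp (1 - 2 * sqrt (2 / v)))"
        using H_le v by (intro add_left_mono) auto
      also have "\<dots> = ennreal (F v * (1 + exp (1 - 2 * sqrt (2 / v))))"
        unfolding Gv distrib_left by (simp add: F_nonneg ennreal_mult')
      finally have "E v * (k0 - v * a3) \<le> F v * (1 + exp (1 - 2 * sqrt (2 / v)))"
        using F_nonneg [of v] by (subst (asm) ennreal_le_iff) (auto intro!: mult_nonneg_nonneg add_nonneg_nonneg)
      then have "L v \<le> F v"
        unfolding L_def by (simp add: pos_divide_le_eq add_pos_pos)
      then show "L v \<le> F v \<and> F v \<le> U v" using up by simp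
    qed
  qed
  have contU: "isCont U v" if "0 < v" for v
    unfolding U_def E_def using that by (auto intro!: continuous_intros)
  have contL: "isCont L v" if "0 < v" for v
  proof -
    have "1 + exp (1 - 2 * sqrt (2 / v)) \<noteq> 0"
      using exp_gt_zero [of "1 - 2 * sqrt (2 / v)"] by linarith
    then show ?thesis
      unfolding L_def E_def using that by (intro continuous_intros) auto
  qed
  \<comment> \<open>If the bound failed at v, continuity of \<open>U\<close> would keep U below F v
    nearby; a good point x just to the right then gives F v \<le> F x \<le> U x < F v. For the lower
    bound the good point is taken to the left.\<close>
  have FU: "F v \<le> U v" if v: "0 < v" "v < 1" for v
  proof (rule ccontr)
    assume "\<not> F v \<le> U v"
    then have "\<forall>\<^sub>F x in at v. U x < F v"
      using contU [OF v(1)] by (intro order_tendstoD(2) [of U "U v"]) (auto simp: isCont_def)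
    then obtain d where d: "d > 0" "\<And>x. x \<noteq> v \<Longrightarrow> dist x v < d \<Longrightarrow> U x < F v"
      unfolding eventually_at by blast
    obtain x where x: "v < x" "x < min 1 (v + d)" "0 < x \<and> x < 1 \<longrightarrow> L x \<le> F x \<and> F x \<le> U x"
      using AE_lborel_interval_ex [OF good, of v "min 1 (v + d)"] d v by auto
    have "F v \<le> F x" using x by (intro F_mono) simp
    also have "\<dots> \<le> U x" using x v by auto
    also have "\<dots> < F v" using x by (intro d) (auto simp: dist_real_def)
    finally show False by simp
  qed
  have FL: "L v \<le> F v" if v: "0 < v" "v < 1" for v
  proof (rule ccontr)
    assume "\<not> L v \<le> F v"
    then have "\<forall>\<^sub>F x in at v. F v < L x"
      using contL [OF v(1)] by (intro order_tendstoD(1) [of L "L v"]) (auto simp: isCont_def)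
    then obtain d where d: "d > 0" "\<And>x. x \<noteq> v \<Longrightarrow> dist x v < d \<Longrightarrow> F v < L x"
      unfolding eventually_at by blast
    obtain x where x: "max 0 (v - d) < x" "x < v" "0 < x \<and> x < 1 \<longrightarrow> L x \<le> F x \<and> F x \<le> U x"
      using AE_lborel_interval_ex [OF good, of "max 0 (v - d)" v] d v by auto
    have "F v < L x" using x by (intro d) (auto simp: dist_real_def)
    also have "\<dots> \<le> F x" using x v by auto
    also have "\<dots> \<le> F v" using x by (intro F_mono) simp
    finally show False by simp
  qed
  have ev: "\<forall>\<^sub>F v in at_right 0. v \<in> {0<..<1::real}"
    by (rule eventually_at_right_real) simp
  have E_pos: "E v > 0" for v by (simp add: E_def)
  have "((\<lambda>v. F v / (k0 * E v)) \<longlongrightarrow> 1) (at_right 0)"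
  proof (rule tendsto_sandwich)
    show "\<forall>\<^sub>F v in at_right 0. (k0 - v * a3) / (1 + exp (1 - 2 * sqrt (2 / v))) / k0 \<le> F v / (k0 * E v)"
      using ev
    proof eventually_elim
      case (elim v)
      have "L v / (k0 * E v) \<le> F v / (k0 * E v)"
        using FL [of v] elim k0 E_pos [of v] by (intro divide_right_mono) auto
      moreover have "L v / (k0 * E v) = (k0 - v * a3) / (1 + exp (1 - 2 * sqrt (2 / v))) / k0"
        using E_pos [of v] unfolding L_def by simp
      ultimately show ?case by simp
    qed
    show "\<forall>\<^sub>F v in at_right 0. F v / (k0 * E v) \<le> (k0 + v * a1 + a2 * ((1 - exp (- 3 / v)) powr (- 1 / 2) - 1)) / k0"
      using ev
    proof eventually_elim
      case (elim v)
      have "F v / (k0 * E v) \<le> U v / (k0 * E v)"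
        using FU [of v] elim k0 E_pos [of v] by (intro divide_right_mono) auto
      moreover have "U v / (k0 * E v) = (k0 + v * a1 + a2 * ((1 - exp (- 3 / v)) powr (- 1 / 2) - 1)) / k0"
        using E_pos [of v] unfolding U_def by simp
      ultimately show ?case by simp
    qed
    have "((\<lambda>v::real. exp (1 - 2 * sqrt (2 / v))) \<longlongrightarrow> 0) (at_right 0)"
      "((\<lambda>v::real. (1 - exp (- 3 / v)) powr (- 1 / 2)) \<longlongrightarrow> 1) (at_right 0)"
      by real_asymp+
    moreover have "((\<lambda>v. (k0 - v * a3) / (1 + f v) / k0) \<longlongrightarrow> (k0 - 0 * a3) / (1 + 0) / k0) (at_right 0)"
      if "(f \<longlongrightarrow> 0) (at_right 0)" for f
      by (intro tendsto_intros that) (use k0 in auto)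
    moreover have "((\<lambda>v. (k0 + v * a1 + a2 * (f v - 1)) / k0) \<longlongrightarrow> (k0 + 0 * a1 + a2 * (1 - 1)) / k0) (at_right 0)"
      if "(f \<longlongrightarrow> 1) (at_right 0)" for f
      by (intro tendsto_intros that) (use k0 in auto)
    ultimately have "((\<lambda>v. (k0 - v * a3) / (1 + exp (1 - 2 * sqrt (2 / v))) / k0) \<longlongrightarrow> (k0 - 0 * a3) / (1 + 0) / k0) (at_right 0)"
      "((\<lambda>v. (k0 + v * a1 + a2 * ((1 - exp (- 3 / v)) powr (- 1 / 2) - 1)) / k0) \<longlongrightarrow> (k0 + 0 * a1 + a2 * (1 - 1)) / k0) (at_right 0)"
      by blast+
    then show "((\<lambda>v. (k0 - v * a3) / (1 + exp (1 - 2 * sqrt (2 / v))) / k0) \<longlongrightarrow> 1) (at_right 0)"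
      "((\<lambda>v. (k0 + v * a1 + a2 * ((1 - exp (- 3 / v)) powr (- 1 / 2) - 1)) / k0) \<longlongrightarrow> 1) (at_right 0)"
      using k0 by simp_all
  qed
  then show ?thesis
    unfolding F_def E_def k0_def by (rule asymp_equivI')
qed

end

section \<open>The energy of the meander\<close>

context std_brownian_motion
begin

abbreviation path_energy :: "real \<Rightarrow> 'a \<Rightarrow> real" where
  "path_energy u \<omega> \<equiv> integral {u..1} (\<lambda>r. (W r \<omega>)\<^sup>2)"

abbreviation meander_energy :: "'a \<Rightarrow> real" where
  "meander_energy \<omega> \<equiv> path_energy (last_zero W \<omega>) \<omega> / (1 - last_zero W \<omega>)\<^sup>2"

lemma last_zero_props:
  assumes \<omega>: "\<omega> \<in> space M"
  shows "0 \<le> last_zero W \<omega>" "last_zero W \<omega> \<le> 1" "W (last_zero W \<omega>) \<omega> = 0"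
    "\<And>r. 0 \<le> r \<Longrightarrow> r \<le> 1 \<Longrightarrow> W r \<omega> = 0 \<Longrightarrow> r \<le> last_zero W \<omega>"
proof -
  let ?Z = "{t. 0 \<le> t \<and> t \<le> 1 \<and> W t \<omega> = 0}"
  have "?Z = {t \<in> {0..1}. W t \<omega> = 0}" by auto
  moreover have "closed {t \<in> {0..1}. W t \<omega> = 0}"
    by (intro continuous_closed_preimage_constant continuous_path [OF \<omega>]) auto
  ultimately have cl: "closed ?Z" by simp
  have bdd: "bdd_above ?Z" by (rule bdd_aboveI [of _ 1]) auto
  have "0 \<in> ?Z" using start [OF \<omega>] by simp
  then have "Sup ?Z \<in> ?Z" using closed_contains_Sup [OF _ bdd cl] by blast
  then show "0 \<le> last_zero W \<omega>" "last_zero W \<omega> \<le> 1" "W (last_zero W \<omega>) \<omega> = 0"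
    by (simp_all add: last_zero_def)
  show "r \<le> last_zero W \<omega>" if "0 \<le> r" "r \<le> 1" "W r \<omega> = 0" for r
    unfolding last_zero_def using that by (intro cSup_upper bdd) simp
qed

lemma last_zero_less_iff:
  assumes \<omega>: "\<omega> \<in> space M" and s: "0 \<le> s" "s \<le> 1"
  shows "last_zero W \<omega> < s \<longleftrightarrow> no_zero s \<omega>"
proof
  assume less: "last_zero W \<omega> < s"
  show "no_zero s \<omega>"
    unfolding no_zero_def
  proof (intro ballI notI)
    fix r assume "r \<in> {s..1}" "W r \<omega> = 0"
    then show False using last_zero_props(4) [OF \<omega>, of r] less s by simp
  qed
next
  assume "no_zero s \<omega>"
  then show "last_zero W \<omega> < s"
    using last_zero_props(2,3) [OF \<omega>] by (auto simp: no_zero_def not_less)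
qed

lemma measurable_last_zero [measurable]: "last_zero W \<in> borel_measurable M"
  unfolding borel_measurable_iff_less
proof
  fix a :: real
  consider "a \<le> 0" | "0 < a" "a \<le> 1" | "1 < a" by linarith
  then show "{\<omega> \<in> space M. last_zero W \<omega> < a} \<in> sets M"
  proof cases
    case 1
    then have eq: "{\<omega> \<in> space M. last_zero W \<omega> < a} = {}" using last_zero_props(1) by force
    show ?thesis unfolding eq by simp
  next
    case 2
    then have "{\<omega> \<in> space M. last_zero W \<omega> < a} = {\<omega> \<in> space M. no_zero a \<omega>}"
      using last_zero_less_iff by auto
    then show ?thesis using measurable_no_zero [of a] 2 by (simp add: pred_def)
  next
    case 3
    then have eq: "{\<omega> \<in> space M. last_zero W \<omega> < a} = space M" using last_zero_props(2) by force
    show ?thesis unfolding eq by simp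
  qed
qed

lemma continuous_on_path_energy:
  assumes "\<omega> \<in> space M"
  shows "continuous_on {0..1} (\<lambda>u. path_energy u \<omega>)"
  by (intro indefinite_integral_continuous_1' integrable_continuous_real continuous_intros continuous_path [OF assms]) simp

text \<open>The lower limit of the integral is random. Rounding it up to multiples of 1 / (n + 1)
  leaves countably many fixed limits, each with a measurable energy, and the energy is continuous in
  its limit. The cap at 1 keeps the rounded time inside the interval.\<close>

lemma measurable_meander_energy [measurable]: "(\<lambda>\<omega>. meander_energy \<omega>) \<in> borel_measurable M"
proof -
  have [measurable]: "(\<lambda>\<omega>. path_energy (last_zero W \<omega>) \<omega>) \<in> borel_measurable M"
  proof (rule borel_measurable_LIMSEQ_real)
    let ?k = "\<lambda>n \<omega>. nat \<lceil>real (Suc n) * last_zero W \<omega>\<rceil>"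
    let ?u = "\<lambda>n k. min 1 (real k / real (Suc n))"
    show "(\<lambda>\<omega>. path_energy (?u n (?k n \<omega>)) \<omega>) \<in> borel_measurable M" for n
    proof (rule measurable_compose_countable [where g = "?k n" and f = "\<lambda>k \<omega>. path_energy (?u n k) \<omega>"])
      show "path_energy (?u n k) \<in> borel_measurable M" for k
        by (rule measurable_path_energy) auto
      show "?k n \<in> measurable M (count_space UNIV)" by measurable
    qed
    fix \<omega> assume \<omega>: "\<omega> \<in> space M"
    note g = last_zero_props [OF \<omega>]
    have near: "\<bar>?u n (?k n \<omega>) - last_zero W \<omega>\<bar> \<le> 1 / real (Suc n)" for n
    proof -
      define m where "m = real (Suc n)"
      have m: "m > 0" by (simp add: m_def)
      have k0: "0 \<le> \<lceil>m * last_zero W \<omega>\<rceil>" using g(1) m by (simp add: less_le_trans [of _ 0])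
      have "m * last_zero W \<omega> \<le> real (nat \<lceil>m * last_zero W \<omega>\<rceil>)" "real (nat \<lceil>m * last_zero W \<omega>\<rceil>) < m * last_zero W \<omega> + 1"
        using k0 by linarith+
      then have "last_zero W \<omega> \<le> real (nat \<lceil>m * last_zero W \<omega>\<rceil>) / m" "real (nat \<lceil>m * last_zero W \<omega>\<rceil>) / m \<le> last_zero W \<omega> + 1 / m"
        using m by (simp_all add: field_simps)
      moreover have "0 \<le> 1 / m" using m by simp
      moreover have "\<bar>min 1 q - u\<bar> \<le> e" if "u \<le> q" "q \<le> u + e" "0 \<le> e" "u \<le> 1" for q u e :: real
        using that by (auto simp: min_def abs_le_iff)
      ultimately show ?thesis using g(2) unfolding m_def by blast
    qed
    have "(\<lambda>n. 1 / real (Suc n)) \<longlonglongrightarrow> 0"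
      using LIMSEQ_inverse_real_of_nat by (simp add: inverse_eq_divide)
    then have "(\<lambda>n. ?u n (?k n \<omega>) - last_zero W \<omega>) \<longlonglongrightarrow> 0"
      by (rule Lim_null_comparison [rotated]) (use near in \<open>auto intro!: always_eventually\<close>)
    then have "(\<lambda>n. ?u n (?k n \<omega>)) \<longlonglongrightarrow> last_zero W \<omega>"
      by (rule LIM_zero_cancel)
    then show "(\<lambda>n. path_energy (?u n (?k n \<omega>)) \<omega>) \<longlonglongrightarrow> path_energy (last_zero W \<omega>) \<omega>"
    proof (rule continuous_on_tendsto_compose [OF continuous_on_path_energy [OF \<omega>]])
      have "min 1 (real k / real (Suc n)) \<in> {0..1}" for k n by simp
      then show "\<forall>\<^sub>F n in sequentially. ?u n (?k n \<omega>) \<in> {0..1}" by (intro always_eventually allI)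
    qed (use g in simp)
  qed
  show ?thesis by measurable
qed

lemma meander_energy_nonneg: "0 \<le> meander_energy \<omega>"
  by (intro divide_nonneg_nonneg path_energy_nonneg) simp

lemma exp_meander_energy_le_1: "exp (- (l\<^sup>2 / 2) * meander_energy \<omega>) \<le> 1"
proof -
  have "0 \<le> l\<^sup>2 / 2 * meander_energy \<omega>"
    by (intro mult_nonneg_nonneg meander_energy_nonneg) simp
  then show ?thesis by (simp only: exp_le_one_iff mult_minus_left neg_le_0_iff_le)
qed

text \<open>Of the two factors 1 / (1 - g), one is the squared normalisation of the meander and one
  comes from the substitution r = g + (1 - g) t. For g = 1 both sides are 0 by division by
  zero.\<close>

lemma L2_norm01_meander:
  assumes \<omega>: "\<omega> \<in> space M"
  shows "L2_norm01 (\<lambda>t. meander W t \<omega>) = sqrt (meander_energy \<omega>)"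
proof -
  define g where "g = last_zero W \<omega>"
  note gp = last_zero_props [OF \<omega>, folded g_def]
  show ?thesis
  proof (cases "g = 1")
    case True
    then show ?thesis by (simp add: L2_norm01_def meander_def g_def [symmetric])
  next
    case False
    then have g: "0 < 1 - g" using gp(2) by simp
    have si: "set_integrable lborel {g..1} (\<lambda>r. (W r \<omega>)\<^sup>2)"
      using gp(1) by (intro borel_integrable_atLeastAtMost' continuous_intros continuous_path [OF \<omega>])
    have "(LINT t:{0..1}|lborel. (meander W t \<omega>)\<^sup>2)
      = (LINT t|lborel. 1 / (1 - g) * (indicator {g..1} (g + (1 - g) * t) * (W (g + (1 - g) * t) \<omega>)\<^sup>2))"
      unfolding set_lebesgue_integral_def
    proof (rule Bochner_Integration.integral_cong [OF refl])
      fix t :: real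
      have "indicator {0..1} t = (indicator {g..1} (g + (1 - g) * t) :: real)"
        using g mult_le_cancel_left_pos [OF g, of t 1] zero_le_mult_iff [of "1 - g" t]
        by (auto simp: indicator_def algebra_simps)
      moreover have "(meander W t \<omega>)\<^sup>2 = 1 / (1 - g) * (W (g + (1 - g) * t) \<omega>)\<^sup>2"
        using g by (simp add: meander_def g_def [symmetric] power_divide mult.commute)
      ultimately show "indicator {0..1} t *\<^sub>R (meander W t \<omega>)\<^sup>2
        = 1 / (1 - g) * (indicator {g..1} (g + (1 - g) * t) * (W (g + (1 - g) * t) \<omega>)\<^sup>2)"
        by simp
    qed
    also have "\<dots> = 1 / (1 - g) * (LINT t|lborel. indicator {g..1} (g + (1 - g) * t) * (W (g + (1 - g) * t) \<omega>)\<^sup>2)"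
      by (rule integral_mult_right_zero)
    also have "(LINT t|lborel. indicator {g..1} (g + (1 - g) * t) * (W (g + (1 - g) * t) \<omega>)\<^sup>2)
      = (LINT r|lborel. indicator {g..1} r * (W r \<omega>)\<^sup>2) / (1 - g)"
      using lborel_integral_real_affine [of "1 - g" "\<lambda>r. indicator {g..1} r * (W r \<omega>)\<^sup>2" g] g by simp
    also have "(LINT r|lborel. indicator {g..1} r * (W r \<omega>)\<^sup>2) = path_energy g \<omega>"
      using set_borel_integral_eq_integral(2) [OF si] by (simp add: set_lebesgue_integral_def)
    finally show ?thesis
      unfolding L2_norm01_def by (simp add: g_def [symmetric] power2_eq_square)
  qed
qed

text \<open>A difference of the two indicators is 1 exactly for the cell that contains the last zero
  g, so the sum is one exponential with frequency and energy evaluated at the ends of that cell.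
  Both ends tend to g, where the exponent is that of the meander energy. The indicators telescope,
  hence the bound 1.\<close>

lemma partition_sum_tendsto:
  fixes l a b :: real
  assumes ab: "0 < a" "a < b" "b < 1" and \<omega>: "\<omega> \<in> space M"
  defines "x \<equiv> \<lambda>N k. a + real k * ((b - a) / real N)"
  shows "(\<lambda>N. \<Sum>k<N. (of_bool (no_zero (x N (Suc k)) \<omega>) - of_bool (no_zero (x N k) \<omega>)) *
      exp (- ((l / (1 - x N k))\<^sup>2 / 2) * path_energy (x N (Suc k)) \<omega>))
    \<longlonglongrightarrow> of_bool (a \<le> last_zero W \<omega> \<and> last_zero W \<omega> < b) * exp (- (l\<^sup>2 / 2) * meander_energy \<omega>)"
    (is "?f \<longlonglongrightarrow> ?L")
    and "N > 0 \<Longrightarrow> \<bar>\<Sum>k<N. (of_bool (no_zero (x N (Suc k)) \<omega>) - of_bool (no_zero (x N k) \<omega>)) *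
      exp (- ((l / (1 - x N k))\<^sup>2 / 2) * path_energy (x N (Suc k)) \<omega>)\<bar> \<le> 1"
proof -
  define g where "g = last_zero W \<omega>"
  define F where "F u v = exp (- ((l / (1 - u))\<^sup>2 / 2) * path_energy v \<omega>)" for u v
  define d where "d N k = (of_bool (no_zero (x N (Suc k)) \<omega>) - of_bool (no_zero (x N k) \<omega>) :: real)" for N k
  have x_range: "x N k \<in> {a..b}" if "k \<le> N" "N > 0" for N k
  proof -
    have h: "0 < (b - a) / real N" using ab that by simp
    have "real k * ((b - a) / real N) \<le> real N * ((b - a) / real N)"
      using that h by (intro mult_right_mono) auto
    moreover have "0 \<le> real k * ((b - a) / real N)"
      by (intro mult_nonneg_nonneg of_nat_0_le_iff less_imp_le [OF h])
    ultimately show ?thesis using that by (simp add: x_def)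
  qed
  have x_step: "x N (Suc k) = x N k + (b - a) / real N" for N k
    by (simp add: x_def distrib_right add_divide_distrib diff_divide_distrib)
  have nz: "no_zero u \<omega> \<longleftrightarrow> g < u" if "u \<in> {a..b}" for u
    unfolding g_def using that ab by (intro last_zero_less_iff [OF \<omega>, symmetric]) auto
  have d_eq: "d N k = of_bool (x N k \<le> g \<and> g < x N (Suc k))" if "k < N" for N k
  proof -
    have "0 < (b - a) / real N" using that ab by simp
    then have "x N k < x N (Suc k)" unfolding x_step by linarith
    then show ?thesis
      using nz [OF x_range, of k N] nz [OF x_range, of "Suc k" N] that
      by (auto simp: d_def)
  qed
  have d_sum: "(\<Sum>k<N. d N k) = of_bool (a \<le> g \<and> g < b)" if "N > 0" for N
  proof -
    have "(\<Sum>k<N. d N k) = of_bool (no_zero (x N N) \<omega>) - of_bool (no_zero (x N 0) \<omega>)"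
      unfolding d_def by (rule sum_lessThan_telescope)
    also have "x N N = b" using that by (simp add: x_def)
    also have "x N 0 = a" by (simp add: x_def)
    finally show ?thesis using nz [of a] nz [of b] ab by (auto simp: not_less)
  qed
  have d01: "0 \<le> d N k" if "k < N" for N k using d_eq [OF that] by simp
  have F01: "0 \<le> F u v" "F u v \<le> 1" for u v
    using path_energy_nonneg [of v \<omega>] by (simp_all add: F_def)
  show "\<bar>\<Sum>k<N. (of_bool (no_zero (x N (Suc k)) \<omega>) - of_bool (no_zero (x N k) \<omega>)) *
      exp (- ((l / (1 - x N k))\<^sup>2 / 2) * path_energy (x N (Suc k)) \<omega>)\<bar> \<le> 1" if "N > 0" for N
  proof -
    have "\<bar>\<Sum>k<N. d N k * F (x N k) (x N (Suc k))\<bar> \<le> (\<Sum>k<N. d N k)"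
      using d01 F01 by (intro order_trans [OF sum_abs] sum_mono) (simp add: abs_mult mult_left_le)
    also have "\<dots> \<le> 1" unfolding d_sum [OF that] by simp
    finally show ?thesis by (simp only: d_def F_def)
  qed
  have L: "?L = of_bool (a \<le> g \<and> g < b) * F g g"
    by (simp add: F_def g_def power_divide)
  have f: "?f = (\<lambda>N. \<Sum>k<N. d N k * F (x N k) (x N (Suc k)))" by (simp only: d_def F_def)
  show "?f \<longlonglongrightarrow> ?L"
    unfolding L f
  proof (rule metric_LIMSEQ_I)
    fix e :: real assume e: "e > 0"
    have cF: "continuous_on ({a..b} \<times> {a..b}) (\<lambda>p. F (fst p) (snd p))"
      unfolding F_def using ab
      by (intro continuous_intros continuous_on_compose2 [OF continuous_on_path_energy [OF \<omega>]]) auto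
    have "uniformly_continuous_on ({a..b} \<times> {a..b}) (\<lambda>p. F (fst p) (snd p))"
      by (rule compact_uniformly_continuous [OF cF]) (intro compact_Times compact_Icc)
    then obtain \<delta> where \<delta>: "\<delta> > 0" "\<And>p q. p \<in> {a..b} \<times> {a..b} \<Longrightarrow> q \<in> {a..b} \<times> {a..b} \<Longrightarrow> dist q p < \<delta> \<Longrightarrow>
        dist (F (fst q) (snd q)) (F (fst p) (snd p)) < e / 2"
      unfolding uniformly_continuous_on_def using e by (metis half_gt_zero)
    obtain N0 :: nat where N0: "2 * (b - a) / \<delta> < real N0" using reals_Archimedean2 by blast
    show "\<exists>N0. \<forall>N\<ge>N0. dist (\<Sum>k<N. d N k * F (x N k) (x N (Suc k))) (of_bool (a \<le> g \<and> g < b) * F g g) < e"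
    proof (intro exI [of _ "Suc N0"] allI impI)
      fix N assume "N \<ge> Suc N0"
      then have N: "N > 0" "2 * (b - a) / \<delta> < real N" using N0 by auto
      then have h: "2 * ((b - a) / real N) < \<delta>" using \<delta>(1) by (simp add: field_simps)
      have "(\<Sum>k<N. d N k * F (x N k) (x N (Suc k))) - of_bool (a \<le> g \<and> g < b) * F g g
        = (\<Sum>k<N. d N k * (F (x N k) (x N (Suc k)) - F g g))"
        unfolding d_sum [OF N(1), symmetric] by (simp add: right_diff_distrib sum_subtractf sum_distrib_right)
      also have "\<bar>\<dots>\<bar> \<le> (\<Sum>k<N. d N k * (e / 2))"
      proof (intro order_trans [OF sum_abs] sum_mono)
        fix k assume "k \<in> {..<N}"
        then have k: "k < N" by simp
        show "\<bar>d N k * (F (x N k) (x N (Suc k)) - F g g)\<bar> \<le> d N k * (e / 2)"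
        proof (cases "x N k \<le> g \<and> g < x N (Suc k)")
          case True
          have r: "x N k \<in> {a..b}" "x N (Suc k) \<in> {a..b}" using x_range k by auto
          then have gr: "g \<in> {a..b}" using True by auto
          have "dist (x N k, x N (Suc k)) (g, g) \<le> dist (x N k) g + dist (x N (Suc k)) g"
            unfolding dist_Pair_Pair using sqrt_sum_squares_le_sum [of "dist (x N k) g" "dist (x N (Suc k)) g"] by simp
          also have "\<dots> \<le> 2 * ((b - a) / real N)"
          proof -
            have "0 < (b - a) / real N" using ab N by simp
            moreover have "dist (x N k) g = g - x N k" "dist (x N (Suc k)) g = x N (Suc k) - g"
              using True by (simp_all add: dist_real_def)
            ultimately show ?thesis using x_step [of N k] by linarith
          qed
          finally have "dist (x N k, x N (Suc k)) (g, g) < \<delta>" using h by simp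
          then have "dist (F (x N k) (x N (Suc k))) (F g g) < e / 2"
            using \<delta>(2) [of "(g, g)" "(x N k, x N (Suc k))"] r gr by simp
          then show ?thesis using d_eq [OF k] True by (simp add: dist_real_def)
        next
          case False
          then have "d N k = 0" using d_eq [OF k] by simp
          then show ?thesis by simp
        qed
      qed
      also have "\<dots> = of_bool (a \<le> g \<and> g < b) * (e / 2)"
        by (simp only: sum_distrib_right [symmetric] d_sum [OF N(1)])
      also have "\<dots> \<le> e / 2" using e by simp
      also have "\<dots> < e" using e by simp
      finally show "dist (\<Sum>k<N. d N k * F (x N k) (x N (Suc k))) (of_bool (a \<le> g \<and> g < b) * F g g) < e"
        by (simp only: dist_real_def)
    qed
  qed
qed

text \<open>The expectation of the cell sums converges by dominated convergence on one side, and as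
  a Riemann sum for the arcsine density on the other. The cells stay away from 0 and 1, where that
  density is unbounded.\<close>

lemma expectation_partial_laplace:
  fixes l a b :: real
  assumes l: "l > 0" and ab: "0 < a" "a < b" "b < 1"
  shows "expectation (\<lambda>\<omega>. of_bool (a \<le> last_zero W \<omega> \<and> last_zero W \<omega> < b) * exp (- (l\<^sup>2 / 2) * meander_energy \<omega>))
    = sqrt (l / sinh l) / cosh l * (2 / pi * (arcsin (sqrt b) - arcsin (sqrt a)))"
proof -
  define x where "x N k = a + real k * ((b - a) / real N)" for N k :: nat
  define \<Phi> where "\<Phi> s u v \<omega> = of_bool (no_zero s \<omega>) * exp (- ((l / (1 - u))\<^sup>2 / 2) * path_energy v \<omega>)" for s u v \<omega>
  have \<Phi>m: "\<Phi> s u v \<in> borel_measurable M" if "0 < s" "s < 1" "0 < v" "v < 1" for s u v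
  proof -
    have [measurable]: "Measurable.pred M (no_zero s)" using that by (intro measurable_no_zero) auto
    have [measurable]: "path_energy v \<in> borel_measurable M"
      using that by (intro measurable_path_energy) auto
    have "(\<lambda>\<omega>. (if no_zero s \<omega> then 1 else 0) * exp (- ((l / (1 - u))\<^sup>2 / 2) * path_energy v \<omega>)) \<in> borel_measurable M"
      by measurable
    then show ?thesis by (simp only: \<Phi>_def [abs_def] of_bool_def)
  qed
  have \<Phi>i: "integrable M (\<Phi> s u v)" if "0 < s" "s < 1" "0 < v" "v < 1" for s u v
    using \<Phi>m [OF that] path_energy_nonneg
    by (intro integrable_const_bound [of _ 1] AE_I2) (auto simp: \<Phi>_def abs_mult)
  have x_range: "0 < x N k \<and> x N k < 1" if "k \<le> N" "N > 0" for N k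
  proof -
    have h: "0 < (b - a) / real N" using ab that by simp
    have "real k * ((b - a) / real N) \<le> real N * ((b - a) / real N)"
      using that h by (intro mult_right_mono) auto
    moreover have "0 \<le> real k * ((b - a) / real N)"
      by (intro mult_nonneg_nonneg of_nat_0_le_iff less_imp_le [OF h])
    moreover have "real N * ((b - a) / real N) = b - a" using that by simp
    ultimately show ?thesis using ab unfolding x_def by linarith
  qed
  have x_mono: "x N k \<le> x N (Suc k)" if "N > 0" for N k
    using ab that unfolding x_def by (intro add_left_mono mult_right_mono) auto
  let ?f = "\<lambda>N \<omega>. \<Sum>k<N. (of_bool (no_zero (x N (Suc k)) \<omega>) - of_bool (no_zero (x N k) \<omega>)) *
      exp (- ((l / (1 - x N k))\<^sup>2 / 2) * path_energy (x N (Suc k)) \<omega>)"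
  have f_eq: "?f N \<omega> = (\<Sum>k<N. \<Phi> (x N (Suc k)) (x N k) (x N (Suc k)) \<omega> - \<Phi> (x N k) (x N k) (x N (Suc k)) \<omega>)" for N \<omega>
    by (simp only: \<Phi>_def left_diff_distrib)
  have fm: "?f N \<in> borel_measurable M" for N
    unfolding f_eq using x_range [of _ N] by (intro borel_measurable_sum borel_measurable_diff \<Phi>m) auto
  have Ef: "expectation (?f N) = (\<Sum>k<N. sign_value (x N (Suc k)) (x N (Suc k)) (l / (1 - x N k)) (l / (1 - x N k) * (1 - x N (Suc k)))
      - sign_value (x N k) (x N (Suc k)) (l / (1 - x N k)) (l / (1 - x N k) * (1 - x N (Suc k))))" for N
  proof -
    have "expectation (?f N) = (\<Sum>k<N. expectation (\<Phi> (x N (Suc k)) (x N k) (x N (Suc k))) - expectation (\<Phi> (x N k) (x N k) (x N (Suc k))))"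
      unfolding f_eq using x_range [of _ N]
      by (subst Bochner_Integration.integral_sum) (auto intro!: Bochner_Integration.integrable_diff \<Phi>i sum.cong Bochner_Integration.integral_diff)
    also have "\<dots> = (\<Sum>k<N. sign_value (x N (Suc k)) (x N (Suc k)) (l / (1 - x N k)) (l / (1 - x N k) * (1 - x N (Suc k)))
      - sign_value (x N k) (x N (Suc k)) (l / (1 - x N k)) (l / (1 - x N k) * (1 - x N (Suc k))))"
    proof (rule sum.cong [OF refl])
      fix k assume "k \<in> {..<N}"
      then have r: "0 < x N k" "x N k \<le> x N (Suc k)" "x N (Suc k) < 1" "0 < x N (Suc k)" "l / (1 - x N k) > 0"
        using x_range [of k N] x_range [of "Suc k" N] x_mono [of N k] l by auto
      show "expectation (\<Phi> (x N (Suc k)) (x N k) (x N (Suc k))) - expectation (\<Phi> (x N k) (x N k) (x N (Suc k)))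
        = sign_value (x N (Suc k)) (x N (Suc k)) (l / (1 - x N k)) (l / (1 - x N k) * (1 - x N (Suc k)))
      - sign_value (x N k) (x N (Suc k)) (l / (1 - x N k)) (l / (1 - x N k) * (1 - x N (Suc k)))"
        unfolding \<Phi>_def
        using expectation_no_zero_energy [OF r(4) order.refl r(3,5)] expectation_no_zero_energy [OF r(1,2,3,5)] by simp
    qed
    finally show ?thesis .
  qed
  have lim: "(\<lambda>N. expectation (?f N)) \<longlonglongrightarrow> sqrt (l / sinh l) / cosh l * (2 / pi * (arcsin (sqrt b) - arcsin (sqrt a)))"
    unfolding Ef unfolding x_def by (rule sign_value_sum_tendsto [OF l ab])
  have "(\<lambda>N. expectation (?f N)) \<longlonglongrightarrow> expectation (\<lambda>\<omega>. of_bool (a \<le> last_zero W \<omega> \<and> last_zero W \<omega> < b) * exp (- (l\<^sup>2 / 2) * meander_energy \<omega>))"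
  proof (rule integral_dominated_convergence [where w = "\<lambda>_. 1"])
    show "?f N \<in> borel_measurable M" for N by (rule fm)
    have "(\<lambda>\<omega>. (if a \<le> last_zero W \<omega> \<and> last_zero W \<omega> < b then 1 else 0) * exp (- (l\<^sup>2 / 2) * meander_energy \<omega>)) \<in> borel_measurable M"
      by measurable
    then show "(\<lambda>\<omega>. of_bool (a \<le> last_zero W \<omega> \<and> last_zero W \<omega> < b) * exp (- (l\<^sup>2 / 2) * meander_energy \<omega>)) \<in> borel_measurable M"
      by (simp only: of_bool_def)
    show "AE \<omega> in M. (\<lambda>N. ?f N \<omega>) \<longlonglongrightarrow> of_bool (a \<le> last_zero W \<omega> \<and> last_zero W \<omega> < b) * exp (- (l\<^sup>2 / 2) * meander_energy \<omega>)"
      unfolding x_def by (intro AE_I2 partition_sum_tendsto(1) [OF ab])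
    show "AE \<omega> in M. norm (?f N \<omega>) \<le> 1" for N
    proof (cases "N > 0")
      case True
      show ?thesis
        unfolding x_def real_norm_def by (intro AE_I2 partition_sum_tendsto(2) [OF ab _ True])
    qed simp
  qed simp
  then show ?thesis using lim LIMSEQ_unique by blast
qed

lemma expectation_interior_laplace:
  assumes l: "l > 0"
  shows "expectation (\<lambda>\<omega>. of_bool (0 < last_zero W \<omega> \<and> last_zero W \<omega> < 1) * exp (- (l\<^sup>2 / 2) * meander_energy \<omega>))
    = sqrt (l / sinh l) / cosh l"
proof -
  \<comment> \<open>With 3 in place of 2 the interval from \<open>a n\<close> to \<open>b n\<close>
    = 1 - \<open>a n\<close> is nondegenerate already for n = 0. In the limit the arcsine factor is
    (2 / pi) (pi / 2) = 1.\<close>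
  define a where "a n = 1 / (real n + 3)" for n :: nat
  define b where "b n = 1 - 1 / (real n + 3)" for n :: nat
  have ab: "0 < a n" "a n < b n" "b n < 1" for n by (simp_all add: a_def b_def field_simps)
  have lim: "a \<longlonglongrightarrow> 0" "b \<longlonglongrightarrow> 1" unfolding a_def b_def by real_asymp+
  have "(\<lambda>n. expectation (\<lambda>\<omega>. of_bool (a n \<le> last_zero W \<omega> \<and> last_zero W \<omega> < b n) * exp (- (l\<^sup>2 / 2) * meander_energy \<omega>)))
    \<longlonglongrightarrow> expectation (\<lambda>\<omega>. of_bool (0 < last_zero W \<omega> \<and> last_zero W \<omega> < 1) * exp (- (l\<^sup>2 / 2) * meander_energy \<omega>))"
  proof (rule integral_dominated_convergence [where w = "\<lambda>_. 1"])
    have "(\<lambda>\<omega>. (if 0 < last_zero W \<omega> \<and> last_zero W \<omega> < 1 then 1 else 0) * exp (- (l\<^sup>2 / 2) * meander_energy \<omega>)) \<in> borel_measurable M"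
      by measurable
    then show "(\<lambda>\<omega>. of_bool (0 < last_zero W \<omega> \<and> last_zero W \<omega> < 1) * exp (- (l\<^sup>2 / 2) * meander_energy \<omega>)) \<in> borel_measurable M"
      by (simp only: of_bool_def)
    have "(\<lambda>\<omega>. (if a n \<le> last_zero W \<omega> \<and> last_zero W \<omega> < b n then 1 else 0) * exp (- (l\<^sup>2 / 2) * meander_energy \<omega>)) \<in> borel_measurable M" for n
      by measurable
    then show "(\<lambda>\<omega>. of_bool (a n \<le> last_zero W \<omega> \<and> last_zero W \<omega> < b n) * exp (- (l\<^sup>2 / 2) * meander_energy \<omega>)) \<in> borel_measurable M" for n
      by (simp only: of_bool_def)
    show "AE \<omega> in M. (\<lambda>n. of_bool (a n \<le> last_zero W \<omega> \<and> last_zero W \<omega> < b n) * exp (- (l\<^sup>2 / 2) * meander_energy \<omega>))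
      \<longlonglongrightarrow> of_bool (0 < last_zero W \<omega> \<and> last_zero W \<omega> < 1) * exp (- (l\<^sup>2 / 2) * meander_energy \<omega>)"
    proof (rule AE_I2)
      fix \<omega> assume \<omega>: "\<omega> \<in> space M"
      have "\<forall>\<^sub>F n in sequentially. (a n \<le> last_zero W \<omega> \<and> last_zero W \<omega> < b n) = (0 < last_zero W \<omega> \<and> last_zero W \<omega> < 1)"
      proof (cases "0 < last_zero W \<omega> \<and> last_zero W \<omega> < 1")
        case True
        then have "\<forall>\<^sub>F n in sequentially. a n < last_zero W \<omega>" "\<forall>\<^sub>F n in sequentially. last_zero W \<omega> < b n"
          using order_tendstoD(2) [OF lim(1)] order_tendstoD(1) [OF lim(2)] by auto
        then show ?thesis by eventually_elim (use True in auto)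
      next
        case False
        then have "\<not> (a n \<le> last_zero W \<omega> \<and> last_zero W \<omega> < b n)" for n using ab [of n] by auto
        then show ?thesis using False by (intro always_eventually allI) blast
      qed
      then have "\<forall>\<^sub>F n in sequentially. of_bool (a n \<le> last_zero W \<omega> \<and> last_zero W \<omega> < b n) * exp (- (l\<^sup>2 / 2) * meander_energy \<omega>)
        = of_bool (0 < last_zero W \<omega> \<and> last_zero W \<omega> < 1) * exp (- (l\<^sup>2 / 2) * meander_energy \<omega>)"
        by (rule eventually_mono) simp
      then show "(\<lambda>n. of_bool (a n \<le> last_zero W \<omega> \<and> last_zero W \<omega> < b n) * exp (- (l\<^sup>2 / 2) * meander_energy \<omega>))
        \<longlonglongrightarrow> of_bool (0 < last_zero W \<omega> \<and> last_zero W \<omega> < 1) * exp (- (l\<^sup>2 / 2) * meander_energy \<omega>)"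
        by (rule tendsto_eventually)
    qed
    show "AE \<omega> in M. norm (of_bool (a n \<le> last_zero W \<omega> \<and> last_zero W \<omega> < b n) * exp (- (l\<^sup>2 / 2) * meander_energy \<omega>)) \<le> 1" for n
    proof -
      have le1: "norm (of_bool P * x) \<le> 1" if "0 \<le> x" "x \<le> 1" for P and x :: real
        using that by simp
      show ?thesis by (rule AE_I2) (rule le1 [OF exp_ge_zero exp_meander_energy_le_1])
    qed
  qed simp
  moreover have "(\<lambda>n. expectation (\<lambda>\<omega>. of_bool (a n \<le> last_zero W \<omega> \<and> last_zero W \<omega> < b n) * exp (- (l\<^sup>2 / 2) * meander_energy \<omega>)))
    \<longlonglongrightarrow> sqrt (l / sinh l) / cosh l * (2 / pi * (arcsin (sqrt 1) - arcsin (sqrt 0)))"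
    unfolding expectation_partial_laplace [OF l ab]
  proof (intro tendsto_intros)
    have sqrt_range: "sqrt u \<in> {- 1..1}" if "0 < u" "u < 1" for u
    proof -
      have "0 \<le> sqrt u" "sqrt u \<le> 1" using that by simp_all
      then show ?thesis unfolding atLeastAtMost_iff by linarith
    qed
    have ab': "0 < b n" "a n < 1" for n
      by (rule less_trans [OF ab(1,2)], rule less_trans [OF ab(2,3)])
    show "(\<lambda>n. arcsin (sqrt (b n))) \<longlonglongrightarrow> arcsin (sqrt 1)"
      by (rule continuous_on_tendsto_compose [OF continuous_on_arcsin' tendsto_real_sqrt [OF lim(2)]])
        (simp, intro always_eventually allI sqrt_range ab' ab)
    show "(\<lambda>n. arcsin (sqrt (a n))) \<longlonglongrightarrow> arcsin (sqrt 0)"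
      by (rule continuous_on_tendsto_compose [OF continuous_on_arcsin' tendsto_real_sqrt [OF lim(1)]])
        (simp, intro always_eventually allI sqrt_range ab' ab)
  qed
  ultimately have "expectation (\<lambda>\<omega>. of_bool (0 < last_zero W \<omega> \<and> last_zero W \<omega> < 1) * exp (- (l\<^sup>2 / 2) * meander_energy \<omega>))
    = sqrt (l / sinh l) / cosh l * (2 / pi * (arcsin (sqrt 1) - arcsin (sqrt 0)))"
    by (rule LIMSEQ_unique)
  then show ?thesis by simp
qed

text \<open>The exponential weight is at most 1, so the probability of the event bounds each of the
  transforms from above, and these tend to 1 as l tends to 0.\<close>

lemma AE_last_zero_interior: "AE \<omega> in M. 0 < last_zero W \<omega> \<and> last_zero W \<omega> < 1"
proof -
  let ?A = "{\<omega> \<in> space M. 0 < last_zero W \<omega> \<and> last_zero W \<omega> < 1}"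
  have A: "?A \<in> sets M" by measurable
  have le: "sqrt (l / sinh l) / cosh l \<le> prob ?A" if l: "l > 0" for l
  proof -
    have "sqrt (l / sinh l) / cosh l = expectation (\<lambda>\<omega>. of_bool (0 < last_zero W \<omega> \<and> last_zero W \<omega> < 1) * exp (- (l\<^sup>2 / 2) * meander_energy \<omega>))"
      by (rule expectation_interior_laplace [OF l, symmetric])
    also have "\<dots> \<le> expectation (indicator ?A)"
    proof (rule integral_mono')
      show "integrable M (indicator ?A :: 'a \<Rightarrow> real)"
        using A by (intro integrable_real_indicator) (auto simp: emeasure_eq_measure)
      fix \<omega> assume "\<omega> \<in> space M"
      then have "indicator ?A \<omega> = (of_bool (0 < last_zero W \<omega> \<and> last_zero W \<omega> < 1) :: real)"
        by (simp add: indicator_def)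
      then show "of_bool (0 < last_zero W \<omega> \<and> last_zero W \<omega> < 1) * exp (- (l\<^sup>2 / 2) * meander_energy \<omega>) \<le> indicator ?A \<omega>"
        by (simp only:) (rule mult_left_le [OF exp_meander_energy_le_1], simp)
    qed simp
    finally show ?thesis by simp
  qed
  have "((\<lambda>l::real. sqrt (l / sinh l) / cosh l) \<longlongrightarrow> 1) (at_right 0)"
    by real_asymp
  then have "1 \<le> prob ?A"
    by (rule tendsto_upperbound) (auto intro!: le eventually_at_rightI [of 0 1])
  then have "prob ?A = 1" by (intro antisym prob_le_1)
  then have "AE \<omega> in M. \<omega> \<in> ?A" by (simp only: AE_in_set_eq_1 [OF A])
  then show ?thesis by eventually_elim simp
qed

lemma laplace_meander_energy:
  assumes l: "l > 0"
  shows "expectation (\<lambda>\<omega>. exp (- (l\<^sup>2 / 2) * meander_energy \<omega>)) = sqrt (l / sinh l) / cosh l"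
proof -
  have "expectation (\<lambda>\<omega>. exp (- (l\<^sup>2 / 2) * meander_energy \<omega>))
    = expectation (\<lambda>\<omega>. of_bool (0 < last_zero W \<omega> \<and> last_zero W \<omega> < 1) * exp (- (l\<^sup>2 / 2) * meander_energy \<omega>))"
  proof (rule integral_cong_AE)
    have "(\<lambda>\<omega>. (if 0 < last_zero W \<omega> \<and> last_zero W \<omega> < 1 then 1 else 0) * exp (- (l\<^sup>2 / 2) * meander_energy \<omega>)) \<in> borel_measurable M"
      by measurable
    then show "(\<lambda>\<omega>. of_bool (0 < last_zero W \<omega> \<and> last_zero W \<omega> < 1) * exp (- (l\<^sup>2 / 2) * meander_energy \<omega>)) \<in> borel_measurable M"
      by (simp only: of_bool_def)
    show "AE \<omega> in M. exp (- (l\<^sup>2 / 2) * meander_energy \<omega>)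
      = of_bool (0 < last_zero W \<omega> \<and> last_zero W \<omega> < 1) * exp (- (l\<^sup>2 / 2) * meander_energy \<omega>)"
      using AE_last_zero_interior by eventually_elim simp
  qed measurable
  then show ?thesis unfolding expectation_interior_laplace [OF l] .
qed

end

theorem proposition10:
  fixes M :: "'a measure" and W :: "real \<Rightarrow> 'a \<Rightarrow> real"
  assumes "std_brownian_motion M W"
  shows "(\<lambda>\<epsilon>::real. measure M {\<omega> \<in> space M. L2_norm01 (\<lambda>t. meander W t \<omega>) \<le> \<epsilon>})
           \<sim>[at_right 0] (\<lambda>\<epsilon>. 4 * sqrt (2 / (3 * pi)) * exp (- (9 / 8) * (1 / \<epsilon>\<^sup>2)))"
proof -
  interpret std_brownian_motion M W by (rule assms)
  have "(\<lambda>v. prob {\<omega> \<in> space M. meander_energy \<omega> \<le> v}) \<sim>[at_right 0] (\<lambda>v. 4 * sqrt (2 / (3 * pi)) * exp (- (9 / 8) * (1 / v)))"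
    by (rule small_deviation_of_laplace [OF measurable_meander_energy meander_energy_nonneg laplace_meander_energy])
  moreover have "filterlim (\<lambda>\<epsilon>::real. \<epsilon>\<^sup>2) (at_right 0) (at_right 0)"
    by real_asymp
  ultimately have *: "(\<lambda>\<epsilon>. prob {\<omega> \<in> space M. meander_energy \<omega> \<le> \<epsilon>\<^sup>2}) \<sim>[at_right 0] (\<lambda>\<epsilon>. 4 * sqrt (2 / (3 * pi)) * exp (- (9 / 8) * (1 / \<epsilon>\<^sup>2)))"
    by (rule asymp_equiv_compose')
  have "prob {\<omega> \<in> space M. meander_energy \<omega> \<le> \<epsilon>\<^sup>2} = prob {\<omega> \<in> space M. L2_norm01 (\<lambda>t. meander W t \<omega>) \<le> \<epsilon>}" if "\<epsilon> > 0" for \<epsilon>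
  proof -
    have "L2_norm01 (\<lambda>t. meander W t \<omega>) \<le> \<epsilon> \<longleftrightarrow> meander_energy \<omega> \<le> \<epsilon>\<^sup>2" if "\<omega> \<in> space M" for \<omega>
      unfolding L2_norm01_meander [OF that] using \<open>\<epsilon> > 0\<close> sqrt_le_D real_le_lsqrt by (metis less_imp_le)
    then have "{\<omega> \<in> space M. meander_energy \<omega> \<le> \<epsilon>\<^sup>2} = {\<omega> \<in> space M. L2_norm01 (\<lambda>t. meander W t \<omega>) \<le> \<epsilon>}" by blast
    then show ?thesis by simp
  qed
  then have "\<forall>\<^sub>F \<epsilon> in at_right 0. prob {\<omega> \<in> space M. meander_energy \<omega> \<le> \<epsilon>\<^sup>2} = prob {\<omega> \<in> space M. L2_norm01 (\<lambda>t. meander W t \<omega>) \<le> \<epsilon>}"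
    by (intro eventually_at_rightI [of 0 1]) auto
  then show ?thesis
    by (rule asymp_equiv_transfer [OF *]) simp
qed

end
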